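(* Let $\epsilon\in\{0,-1\}$ and let $n\ge3$ be an odd integer. Then the following assertions hold. (i) There exists a rotational strictly convex $n$-translator $\Sigma_0$ in $\mathbb Q_\epsilon^n\times\mathbb R$ (called the $n$-bowl soliton) which is a vertical graph over an open ball $B_R(o)\subset\Pi_0$ of radius $R>0$. Moreover, $\Sigma_0$ is contained in the closed half-space $\mathbb Q_\epsilon^n\times[0,+\infty)$ with unbounded height, and is asymptotic to $\partial B_R(o)\times\mathbb R$. (ii) There exists a one-parameter family $\mathscr K_n=\{\mathcal K_\lambda\,;\,0<\lambda<1\}$ of properly embedded rotational cones in $\mathbb Q_\epsilon^n\times\mathbb R$ with vertex at $o\in\Pi_0$ (called $n$-translating cones), which are all $n$-translators. Any $\mathcal K_\lambda\in\mathscr K_n$ is the union of two vertical graphs $\mathcal G_{\pm\lambda}$ defined on open balls $B_{R_\pm}(o)\subset\Pi_0$ of radii $R_\pm=R_\pm(\epsilon,n,\lambda)$, $R_->R_+>0$, both with a conical singularity at $o$. In addition, $\mathcal K_\lambda$ has the following properties: - It is contained in a half-space and its height function is unbounded from above. - Its graphs $\mathcal G_{\pm\lambda}$ are vertically asymptotic to the vertical cylinders $\partial B_{R_\pm}(o)\times\mathbb R$, respectively, and their angle functions $\Theta_{\pm\lambda}$ satisfy $\lim_{s\to0}\Theta_{\pm\lambda}^2(s)=1-\lambda^2$. - It is $C^2$-smooth, except at the vertex $o$, where it is singular, and on its $(n-1)$-sphere of minimal height, where it is $C^2$-singular. (iii) There exists a one-parameter family $\mathscr C_n=\{\Sigma_\mu\,;\,\mu\ge0\}$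 of properly embedded rotational $n$-translators in $\mathbb Q_\epsilon^n\times\mathbb R$ (called $n$-grim reapers). Each $\Sigma_\mu\in\mathscr C_n$ is a vertical graph over an annulus $B_R(o)-B_\mu(o)$, $R=R(\epsilon,n,\mu)>\mu$, and has the following properties: - It is contained in a half-space, and its height function is unbounded from above. - It is vertically asymptotic to the cylinders $\partial B_R(o)\times\mathbb R$ and $\partial B_\mu(o)\times\mathbb R$, where the latter reduces to a vertical line for $\mu=0$. - It is $C^2$-singular along its $(n-1)$-sphere of minimal height.
   Context: $\mathbb Q_0^n=\mathbb R^n$ and $\mathbb Q_{-1}^n=\mathbb H^n$; $\mathbb Q_\epsilon^n\times\mathbb R$ carries the product metric, $\partial_t$ is the unit vertical field (gradient of the projection onto $\mathbb R$), $\Pi_0=\mathbb Q_\epsilon^n\times\{0\}$. The height function of a hypersurface is the restriction of the projection onto $\mathbb R$. For an oriented hypersurface $\Sigma$ with unit normal $N$, the shape operator is $AX=-\overline\nabla_XN$ ($\overline\nabla$ the ambient Levi-Civita connection), with principal curvatures $k_1,\dots,k_n$; $H_n=k_1\cdots k_n$ is the Gaussian curvature and $\Theta=\langle N,\partial_t\rangle$ is the angle function. Hypersurfaces are of class at least $C^2$ except possibly on a set $\Lambda$ of null measure, where they are only of class $C^1$; then $\Sigma$ is called $C^2$-singular on $\Lambda$. $\Sigma$ is an $n$-translator (translator to the Gaussian curvature flow) if $H_n=\Theta$ on $\Sigma$ (on $\Sigma-\Lambda$ if there is a $C^2$-singular set $\Lambda$). For $n$ odd this is independent of the choice of $N$.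 In the case of cones, the vertex is additionally a conical singular point, at which the graphs are not differentiable. Rotational means invariant under rotations of $\mathbb Q_\epsilon^n$ about a fixed point $o$, extended to $\mathbb Q_\epsilon^n\times\mathbb R$ by fixing the $\mathbb R$ factor. $B_R(o)$ is the geodesic ball of radius $R$ centered at $o$ ($B_0(o)$ being reduced to $\{o\}$). The angle function of a rotational graph is regarded as a function of $s$, the distance in $\mathbb Q_\epsilon^n$ to $o$. Strictly convex means that all principal curvatures are positive. *)

theory Defs
  imports "HOL-Analysis.Analysis"
begin

section \<open>Riemannian metrics on open subsets of a Euclidean space\<close>

text \<open>A metric is a map sending a point to a bilinear form on tangent vectors.
  The Christoffel map is given by the Koszul formula on constant vector fields, so that the
  Levi-Civita derivative of a field \<open>Y\<close> in direction \<open>X\<close> is \<open>D\<^sub>X Y + \<Gamma> X Y\<close>.\<close>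

definition christoffel ::
  "('a::real_normed_vector \<Rightarrow> 'a \<Rightarrow> 'a \<Rightarrow> real) \<Rightarrow> 'a \<Rightarrow> 'a \<Rightarrow> 'a \<Rightarrow> 'a" where
  "christoffel g p X Y = (THE W. \<forall>Z. 2 * g p W Z =
      frechet_derivative (\<lambda>q. g q Y Z) (at p) X
    + frechet_derivative (\<lambda>q. g q X Z) (at p) Y
    - frechet_derivative (\<lambda>q. g q X Y) (at p) Z)"

definition curve_length ::
  "('a::real_normed_vector \<Rightarrow> 'a \<Rightarrow> 'a \<Rightarrow> real) \<Rightarrow> (real \<Rightarrow> 'a) \<Rightarrow> real" where
  "curve_length g \<gamma> = integral {0..1}
     (\<lambda>t. sqrt (g (\<gamma> t) (vector_derivative \<gamma> (at t)) (vector_derivative \<gamma> (at t))))"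

text \<open>Only \<open>C\<^sup>1\<close> curves are admitted: a \<open>valid_path\<close> may have a non-integrable speed, for which
  \<open>integral\<close> would return the junk value \<open>0\<close>.\<close>

definition riemannian_dist ::
  "'a::real_normed_vector set \<Rightarrow> ('a \<Rightarrow> 'a \<Rightarrow> 'a \<Rightarrow> real) \<Rightarrow> 'a \<Rightarrow> 'a \<Rightarrow> real" where
  "riemannian_dist M g x y = Inf (curve_length g `
     {\<gamma>. \<gamma> C1_differentiable_on {0..1} \<and> \<gamma> ` {0..1} \<subseteq> M \<and> \<gamma> 0 = x \<and> \<gamma> 1 = y})"

section \<open>The space forms and their product with the real line\<close>

text \<open>The simply connected space form of curvature \<open>\<epsilon> \<le> 0\<close> in its conformal chart centred at the
  base point \<open>o\<close>, which is therefore the origin \<open>0\<close>. The metric is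
  \<open>\<bar>dx\<bar>\<^sup>2 / (1 + \<epsilon> \<bar>x\<bar>\<^sup>2 / 4)\<^sup>2\<close> on the set where \<open>1 + \<epsilon> \<bar>x\<bar>\<^sup>2 / 4 > 0\<close>: for \<open>\<epsilon> = 0\<close> this is Euclidean
  space, and for \<open>\<epsilon> = -1\<close> it is the Poincare model of hyperbolic space on the ball of (Euclidean)
  radius 2.\<close>

definition Q_space :: "real \<Rightarrow> (real^'n) set" where
  "Q_space \<epsilon> = {x. 0 < 1 + \<epsilon> * (norm x)\<^sup>2 / 4}"

definition Q_metric :: "real \<Rightarrow> real^'n \<Rightarrow> real^'n \<Rightarrow> real^'n \<Rightarrow> real" where
  "Q_metric \<epsilon> x u v = (u \<bullet> v) / (1 + \<epsilon> * (norm x)\<^sup>2 / 4)\<^sup>2"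

definition Q_dist :: "real \<Rightarrow> real^'n \<Rightarrow> real^'n \<Rightarrow> real" where
  "Q_dist \<epsilon> = riemannian_dist (Q_space \<epsilon>) (Q_metric \<epsilon>)"

definition Q_ball :: "real \<Rightarrow> real \<Rightarrow> (real^'n) set" where
  "Q_ball \<epsilon> r = {x \<in> Q_space \<epsilon>. Q_dist \<epsilon> 0 x < r}"

definition Q_cball :: "real \<Rightarrow> real \<Rightarrow> (real^'n) set" where
  "Q_cball \<epsilon> r = {x \<in> Q_space \<epsilon>. Q_dist \<epsilon> 0 x \<le> r}"

definition Q_sphere :: "real \<Rightarrow> real \<Rightarrow> (real^'n) set" where
  "Q_sphere \<epsilon> r = {x \<in> Q_space \<epsilon>. Q_dist \<epsilon> 0 x = r}"

definition QR_space :: "real \<Rightarrow> ((real^'n) \<times> real) set" where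
  "QR_space \<epsilon> = Q_space \<epsilon> \<times> UNIV"

definition QR_metric ::
  "real \<Rightarrow> (real^'n) \<times> real \<Rightarrow> (real^'n) \<times> real \<Rightarrow> (real^'n) \<times> real \<Rightarrow> real" where
  "QR_metric \<epsilon> p X Y = Q_metric \<epsilon> (fst p) (fst X) (fst Y) + snd X * snd Y"

definition QR_dist :: "real \<Rightarrow> (real^'n) \<times> real \<Rightarrow> (real^'n) \<times> real \<Rightarrow> real" where
  "QR_dist \<epsilon> = riemannian_dist (QR_space \<epsilon>) (QR_metric \<epsilon>)"

definition rotational :: "((real^'n) \<times> real) set \<Rightarrow> bool" where
  "rotational S \<longleftrightarrow> (\<forall>A. rotation_matrix A \<longrightarrow> (\<lambda>(x, t). (A *v x, t)) ` S = S)"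

section \<open>Hypersurfaces\<close>

definition C1_on :: "'a::real_normed_vector set \<Rightarrow> ('a \<Rightarrow> 'b::real_normed_vector) \<Rightarrow> bool" where
  "C1_on U f \<longleftrightarrow> open U \<and> (\<exists>f' :: 'a \<Rightarrow> 'a \<Rightarrow>\<^sub>L 'b.
     (\<forall>x\<in>U. (f has_derivative blinfun_apply (f' x)) (at x)) \<and> continuous_on U f')"

definition C2_on :: "'a::real_normed_vector set \<Rightarrow> ('a \<Rightarrow> 'b::real_normed_vector) \<Rightarrow> bool" where
  "C2_on U f \<longleftrightarrow> open U \<and> (\<exists>f' :: 'a \<Rightarrow> 'a \<Rightarrow>\<^sub>L 'b.
     (\<forall>x\<in>U. (f has_derivative blinfun_apply (f' x)) (at x)) \<and> C1_on U f')"

text \<open>Near \<open>p\<close>, the set \<open>S\<close> is the regular zero set of a function of the given class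
  (\<open>C1_on\<close> or \<open>C2_on\<close>), i.e. an embedded hypersurface of that class.\<close>

definition hypersurface_at ::
  "('a::real_normed_vector set \<Rightarrow> ('a \<Rightarrow> real) \<Rightarrow> bool) \<Rightarrow> 'a set \<Rightarrow> 'a \<Rightarrow> bool" where
  "hypersurface_at C S p \<longleftrightarrow> p \<in> S \<and> (\<exists>U F. open U \<and> p \<in> U \<and> C U F \<and>
     S \<inter> U = {q \<in> U. F q = 0} \<and> (\<forall>q\<in>S \<inter> U. frechet_derivative F (at q) \<noteq> (\<lambda>_. 0)))"

definition embedded_C1_hypersurface :: "real \<Rightarrow> ((real^'n) \<times> real) set \<Rightarrow> bool" where
  "embedded_C1_hypersurface \<epsilon> S \<longleftrightarrow> S \<subseteq> QR_space \<epsilon> \<and> (\<forall>p\<in>S. hypersurface_at C1_on S p)"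

text \<open>Properness of the inclusion map.\<close>

definition proper_in_QR :: "real \<Rightarrow> ((real^'n) \<times> real) set \<Rightarrow> bool" where
  "proper_in_QR \<epsilon> S \<longleftrightarrow> S \<subseteq> QR_space \<epsilon> \<and>
     (\<forall>K. compact K \<and> K \<subseteq> QR_space \<epsilon> \<longrightarrow> compact (S \<inter> K))"

text \<open>\<open>L\<close> has null \<open>n\<close>-dimensional measure in \<open>S\<close>: its points are covered by local parametrizations
  of \<open>S\<close> in which \<open>L\<close> corresponds to a Lebesgue null set.\<close>

definition null_in_hypersurface ::
  "((real^'n) \<times> real) set \<Rightarrow> ((real^'n) \<times> real) set \<Rightarrow> bool" where
  "null_in_hypersurface S L \<longleftrightarrow> (\<forall>p\<in>L. \<exists>U (V :: (real^'n) set) f h.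
     open U \<and> p \<in> U \<and> C1_on V f \<and> (\<forall>x\<in>V. inj (frechet_derivative f (at x))) \<and>
     homeomorphism V (S \<inter> U) f h \<and> negligible {x \<in> V. f x \<in> L})"

text \<open>\<open>S\<close> is an embedded \<open>C\<^sup>1\<close> hypersurface, and \<open>L\<close> is exactly the set of points at which it fails to
  be \<open>C\<^sup>2\<close>; with \<open>L = {}\<close> this says that \<open>S\<close> is an embedded \<open>C\<^sup>2\<close> hypersurface.\<close>

definition C2_singular_on ::
  "real \<Rightarrow> ((real^'n) \<times> real) set \<Rightarrow> ((real^'n) \<times> real) set \<Rightarrow> bool" where
  "C2_singular_on \<epsilon> S L \<longleftrightarrow> embedded_C1_hypersurface \<epsilon> S \<and> L \<subseteq> S \<and> null_in_hypersurface S L \<and>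
     (\<forall>p\<in>S - L. hypersurface_at C2_on S p) \<and> (\<forall>p\<in>L. \<not> hypersurface_at C2_on S p)"

definition tangent_space :: "'a::real_normed_vector set \<Rightarrow> 'a \<Rightarrow> 'a set" where
  "tangent_space S p = {v. \<exists>\<gamma> \<delta>. 0 < \<delta> \<and> \<gamma> 0 = p \<and>
     (\<forall>t. \<bar>t\<bar> < \<delta> \<longrightarrow> \<gamma> t \<in> S) \<and> (\<gamma> has_vector_derivative v) (at (0::real))}"

definition unit_normal_field ::
  "real \<Rightarrow> ((real^'n) \<times> real) set \<Rightarrow> ((real^'n) \<times> real \<Rightarrow> (real^'n) \<times> real) \<Rightarrow> bool" where
  "unit_normal_field \<epsilon> S N \<longleftrightarrow> continuous_on S N \<and> (\<forall>p\<in>S. QR_metric \<epsilon> p (N p) (N p) = 1 \<and>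
     (\<forall>v\<in>tangent_space S p. QR_metric \<epsilon> p (N p) v = 0))"

text \<open>For \<open>N\<close> differentiable along \<open>S\<close>, its derivative within \<open>S\<close> is uniquely determined
  on tangent vectors, which are the only arguments at which the shape operator is used.\<close>

definition shape_operator ::
  "real \<Rightarrow> ((real^'n) \<times> real) set \<Rightarrow> ((real^'n) \<times> real \<Rightarrow> (real^'n) \<times> real) \<Rightarrow>
   (real^'n) \<times> real \<Rightarrow> (real^'n) \<times> real \<Rightarrow> (real^'n) \<times> real" where
  "shape_operator \<epsilon> S N p X =
     - (frechet_derivative N (at p within S) X + christoffel (QR_metric \<epsilon>) p X (N p))"

text \<open>\<open>k\<close> enumerates the principal curvatures at \<open>p\<close>, i.e. the eigenvalues (with multiplicity) of
  the shape operator for some orthonormal basis \<open>e\<close> of the tangent space; \<open>k\<close> is unique up to a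
  permutation of the index type, and exists at every \<open>C\<^sup>2\<close> point.\<close>

definition principal_curvatures ::
  "real \<Rightarrow> ((real^'n) \<times> real) set \<Rightarrow> ((real^'n) \<times> real \<Rightarrow> (real^'n) \<times> real) \<Rightarrow>
   (real^'n) \<times> real \<Rightarrow> ('n \<Rightarrow> real) \<Rightarrow> bool" where
  "principal_curvatures \<epsilon> S N p k \<longleftrightarrow> N differentiable (at p within S) \<and>
     (\<exists>e :: 'n \<Rightarrow> (real^'n) \<times> real. (\<forall>i. e i \<in> tangent_space S p) \<and>
       (\<forall>i j. QR_metric \<epsilon> p (e i) (e j) = (if i = j then 1 else 0)) \<and>
       (\<forall>i. shape_operator \<epsilon> S N p (e i) = k i *\<^sub>R e i))"

definition angle_function ::
  "real \<Rightarrow> ((real^'n) \<times> real \<Rightarrow> (real^'n) \<times> real) \<Rightarrow> (real^'n) \<times> real \<Rightarrow> real" where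
  "angle_function \<epsilon> N p = QR_metric \<epsilon> p (N p) (0, 1)"

definition strictly_convex ::
  "real \<Rightarrow> ((real^'n) \<times> real) set \<Rightarrow> ((real^'n) \<times> real \<Rightarrow> (real^'n) \<times> real) \<Rightarrow> bool" where
  "strictly_convex \<epsilon> S N \<longleftrightarrow>
     (\<forall>p\<in>S. \<exists>k. principal_curvatures \<epsilon> S N p k \<and> (\<forall>i. 0 < k i))"

text \<open>The equation \<open>H\<^sub>n = \<Theta>\<close> off the \<open>C\<^sup>2\<close>-singular set \<open>L\<close>.\<close>

definition n_translator ::
  "real \<Rightarrow> ((real^'n) \<times> real) set \<Rightarrow> ((real^'n) \<times> real \<Rightarrow> (real^'n) \<times> real) \<Rightarrow>
   ((real^'n) \<times> real) set \<Rightarrow> bool" where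
  "n_translator \<epsilon> S N L \<longleftrightarrow> C2_singular_on \<epsilon> S L \<and> unit_normal_field \<epsilon> S N \<and>
     (\<forall>p\<in>S - L. \<exists>k. principal_curvatures \<epsilon> S N p k \<and> (\<Prod>i\<in>UNIV. k i) = angle_function \<epsilon> N p)"

section \<open>Graphs, heights and asymptotics\<close>

definition vertical_graph :: "(real^'n \<Rightarrow> real) \<Rightarrow> (real^'n) set \<Rightarrow> ((real^'n) \<times> real) set" where
  "vertical_graph u D = (\<lambda>x. (x, u x)) ` D"

text \<open>At \<open>o\<close>, the graph of \<open>u\<close> is not differentiable and is tangent to a circular cone with
  slope \<open>c \<noteq> 0\<close>.\<close>

definition conical_singularity :: "real \<Rightarrow> (real^'n \<Rightarrow> real) \<Rightarrow> bool" where
  "conical_singularity \<epsilon> u \<longleftrightarrow> \<not> u differentiable (at 0) \<and>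
     (\<exists>c. c \<noteq> 0 \<and> ((\<lambda>x. (u x - u 0) / Q_dist \<epsilon> 0 x) \<longlongrightarrow> c) (at 0))"

definition height_unbounded_above :: "((real^'n) \<times> real) set \<Rightarrow> bool" where
  "height_unbounded_above S \<longleftrightarrow> (\<forall>M. \<exists>p\<in>S. M < snd p)"

definition in_upper_half_space :: "((real^'n) \<times> real) set \<Rightarrow> bool" where
  "in_upper_half_space S \<longleftrightarrow> (\<exists>c. S \<subseteq> UNIV \<times> {c..})"

definition min_height_set :: "((real^'n) \<times> real) set \<Rightarrow> ((real^'n) \<times> real) set" where
  "min_height_set S = {p \<in> S. \<forall>q\<in>S. snd p \<le> snd q}"

definition horizontal_sphere :: "real \<Rightarrow> ((real^'n) \<times> real) set \<Rightarrow> bool" where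
  "horizontal_sphere \<epsilon> M \<longleftrightarrow> (\<exists>r h. 0 < r \<and> M = Q_sphere \<epsilon> r \<times> {h})"

text \<open>\<open>S\<close> and the (union of) vertical cylinders \<open>C\<close> become arbitrarily close to each other at
  large heights, and \<open>S\<close> approaches \<open>C\<close> only by going up to infinity.\<close>

definition vertically_asymptotic ::
  "real \<Rightarrow> ((real^'n) \<times> real) set \<Rightarrow> ((real^'n) \<times> real) set \<Rightarrow> bool" where
  "vertically_asymptotic \<epsilon> S C \<longleftrightarrow>
     (\<forall>\<eta>>0. \<exists>T. (\<forall>p\<in>S. T < snd p \<longrightarrow> (\<exists>q\<in>C. QR_dist \<epsilon> p q < \<eta>)) \<and>
                (\<forall>q\<in>C. T < snd q \<longrightarrow> (\<exists>p\<in>S. QR_dist \<epsilon> p q < \<eta>))) \<and>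
     (\<forall>T. \<exists>\<eta>>0. \<forall>p\<in>S. \<forall>q\<in>C. QR_dist \<epsilon> p q < \<eta> \<longrightarrow> T < snd p)"

text \<open>On the graph of \<open>u\<close> over \<open>B\<^sub>R(o)\<close> without \<open>o\<close>, the angle function depends only on the distance
  \<open>s\<close> to \<open>o\<close>, and as a function of \<open>s\<close> its square has limit \<open>a\<close> at \<open>s = 0\<close>.\<close>

definition angle_square_limit ::
  "real \<Rightarrow> ((real^'n) \<times> real \<Rightarrow> (real^'n) \<times> real) \<Rightarrow> (real^'n \<Rightarrow> real) \<Rightarrow> real \<Rightarrow> real \<Rightarrow> bool" where
  "angle_square_limit \<epsilon> N u R a \<longleftrightarrow> (\<exists>\<Theta> :: real \<Rightarrow> real.
     (\<forall>x\<in>Q_ball \<epsilon> R - {0}. angle_function \<epsilon> N (x, u x) = \<Theta> (Q_dist \<epsilon> 0 x)) \<and>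
     ((\<lambda>s. (\<Theta> s)\<^sup>2) \<longlongrightarrow> a) (at_right 0))"

end

theory Submission imports Defs
begin

text \<open>
  In the conformal chart, with \<open>r = norm x\<close> and \<open>c(r) = 1 + \<epsilon> r\<^sup>2 / 4\<close>, a rotational graph
  \<open>t = \<psi>(r)\<close> is governed by the angle \<open>\<theta>\<close> with \<open>tan \<theta> = c \<psi>'\<close>. Its upward unit normal is
  \<open>(- (c sin \<theta> / r) x, cos \<theta>)\<close>; the principal curvature in the radial direction is
  \<open>c cos \<theta> \<theta>'\<close>, and the \<open>m = n - 1\<close> others are \<open>(1 - \<epsilon> r\<^sup>2 / 4) / r sin \<theta>\<close>
  (\<open>rot_sheet_principal_curvatures\<close>). The equation \<open>H\<^sub>n = \<Theta>\<close> therefore separates: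
  \<open>sin\<^sup>m \<theta> \<theta>' = (r / (1 - \<epsilon> r\<^sup>2 / 4))\<^sup>m / c\<close>, that is \<open>F(\<theta>) = T(r) + C\<close> for the
  primitives \<open>F\<close> and \<open>T\<close> of the two sides that vanish at \<open>0\<close>.

  As \<open>m\<close> is even, \<open>F\<close> and \<open>T\<close> are odd and strictly increasing, and \<open>T\<close> maps the interval where
  \<open>c > 0\<close> onto the real line. So for every constant \<open>C\<close> there is exactly one interval \<open>[A, B]\<close> on
  which \<open>\<theta>\<close> climbs from \<open>- \<pi> / 2\<close> to \<open>\<pi> / 2\<close>, and \<open>\<theta>\<close> vanishes at exactly one point \<open>r\<^sub>0\<close>.
  Here negative radii are allowed: reflecting \<open>r\<close> exchanges \<open>C\<close> and \<open>- C\<close>. All the translators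
  come from this one profile curve.

  \<^item> \<open>C = 0\<close> gives \<open>r\<^sub>0 = 0\<close> and \<open>A = - B\<close>: rotating the curve about its minimum gives the bowl.
  \<^item> \<open>C = F(arcsin l)\<close> and \<open>C = F(- arcsin l)\<close> give \<open>A < 0 < B\<close> and slopes \<open>\<plusminus> tan (arcsin l)\<close> at
    \<open>r = 0\<close>: the two graphs over balls form the cone, and only the second one has its minimum
    at a positive radius.
  \<^item> \<open>C = F(- \<pi> / 2) - T(a)\<close> with \<open>a \<ge> 0\<close> gives \<open>A = a\<close>: rotation gives the grim reaper over an
    annulus.

  The height tends to infinity at both ends, because \<open>M \<psi> + ln cos \<theta>\<close> is monotone near an end for
  a suitable constant \<open>M\<close>, while \<open>cos \<theta>\<close> tends to \<open>0\<close> there (\<open>blow_up\<close>). Regularity is decided at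
  \<open>r\<^sub>0\<close>: there \<open>F'\<close> vanishes, while \<open>T'(r\<^sub>0) > 0\<close> unless \<open>r\<^sub>0 = 0\<close>, so for \<open>r\<^sub>0 \<noteq> 0\<close> the angle is continuous
  but not differentiable; if \<open>r\<^sub>0 > 0\<close>, the surface is \<open>C\<^sup>1\<close> but not \<open>C\<^sup>2\<close> along its sphere of minimal height
  (\<open>C2_hypersurface_profile_differentiable\<close>). For \<open>r\<^sub>0 = 0\<close> the zeros of \<open>F'\<close> and \<open>T'\<close> have the same
  order and cancel, \<open>\<theta>' = 1\<close> at the origin, and the bowl is \<open>C\<^sup>2\<close>.

  Distances enter through two estimates. The function \<open>x \<mapsto> s(e \<bullet> x)\<close>, where \<open>s(r)\<close> is the geodesic
  distance corresponding to the chart radius \<open>r\<close> and \<open>e\<close> is a unit vector, has gradient of length at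
  most \<open>1\<close>, and this bounds lengths of curves from below; radial segments bound distances from above.
\<close>

section \<open>Radial distances in the conformal chart\<close>

text \<open>The metric of the chart is \<open>\<bar>dx\<bar>\<^sup>2 / (conf \<epsilon> (norm x))\<^sup>2\<close>.\<close>

definition conf :: "real \<Rightarrow> real \<Rightarrow> real" where
  "conf \<epsilon> r = 1 + \<epsilon> * r\<^sup>2 / 4"

text \<open>Geodesic distance from the origin as a function of the chart radius: the primitive of
  \<open>1 / conf \<epsilon>\<close> for \<open>\<epsilon> = 0\<close> and \<open>\<epsilon> = -1\<close>; as an odd function it also takes negative radii.\<close>

definition geo_radius :: "real \<Rightarrow> real \<Rightarrow> real" where
  "geo_radius \<epsilon> r = (if \<epsilon> = 0 then r else 2 * artanh (r / 2))"

definition chart_radius :: "real \<Rightarrow> real \<Rightarrow> real" where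
  "chart_radius \<epsilon> s = (if \<epsilon> = 0 then s else 2 * tanh (s / 2))"

lemma conf_0 [simp]: "conf \<epsilon> 0 = 1"
  by (simp add: conf_def)

lemma conf_minus [simp]: "conf \<epsilon> (- r) = conf \<epsilon> r"
  by (simp add: conf_def)

lemma conf_abs [simp]: "conf \<epsilon> \<bar>r\<bar> = conf \<epsilon> r"
  by (simp add: conf_def)

lemma conf_antimono: "\<epsilon> \<le> 0 \<Longrightarrow> \<bar>r\<bar> \<le> \<bar>s\<bar> \<Longrightarrow> conf \<epsilon> s \<le> conf \<epsilon> r"
  using mult_left_mono_neg[of "r\<^sup>2" "s\<^sup>2" \<epsilon>] by (auto simp: conf_def abs_le_square_iff)

lemma conf_between:
  assumes "\<epsilon> \<le> 0" "0 < conf \<epsilon> a" "0 < conf \<epsilon> b" "a \<le> r" "r \<le> b"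
  shows "0 < conf \<epsilon> r"
proof (cases "\<bar>r\<bar> \<le> \<bar>a\<bar>")
  case True
  then show ?thesis using conf_antimono[OF assms(1) True] assms by linarith
next
  case False
  then have "\<bar>r\<bar> \<le> \<bar>b\<bar>" using assms by linarith
  then show ?thesis using conf_antimono[OF assms(1), of r b] assms by linarith
qed

lemma conf_le_1: "\<epsilon> \<le> 0 \<Longrightarrow> conf \<epsilon> r \<le> 1"
  using conf_antimono[of \<epsilon> 0 r] by simp

lemma conf_has_derivative [derivative_intros]:
  "(conf \<epsilon> has_real_derivative \<epsilon> * r / 2) (at r)"
  unfolding conf_def[abs_def] by (auto intro!: derivative_eq_intros)

lemma continuous_on_conf [continuous_intros]:
  "continuous_on A f \<Longrightarrow> continuous_on A (\<lambda>x. conf \<epsilon> (f x))"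
  unfolding conf_def by (intro continuous_intros) auto

lemma conf_pos_iff: "0 < conf (-1) r \<longleftrightarrow> \<bar>r\<bar> < 2"
proof -
  have "0 < conf (-1) r \<longleftrightarrow> r\<^sup>2 < 2\<^sup>2" by (simp add: conf_def)
  also have "\<dots> \<longleftrightarrow> \<bar>r\<bar> < 2" using abs_square_less_1[of "r/2"] by (simp add: power_divide)
  finally show ?thesis .
qed

lemma open_conf_pos: "open {r. 0 < conf \<epsilon> r}"
  by (intro open_Collect_less continuous_intros)

lemma geo_radius_has_derivative:
  assumes "\<epsilon> \<in> {0, -1}" "0 < conf \<epsilon> r"
  shows "(geo_radius \<epsilon> has_real_derivative 1 / conf \<epsilon> r) (at r)"
proof (cases "\<epsilon> = 0")
  case True
  then show ?thesis by (simp add: geo_radius_def[abs_def] conf_def)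
next
  case False
  then have e: "\<epsilon> = -1" using assms by simp
  have "\<bar>r / 2\<bar> < 1" using assms(2) conf_pos_iff[of r] by (simp add: e)
  have half: "2 * (1 / d * (1 / 2)) = 1 / d" for d :: real by simp
  have c: "conf \<epsilon> r = 1 - (r / 2)\<^sup>2" by (simp add: conf_def e power_divide)
  have "((\<lambda>r. 2 * artanh (r / 2)) has_real_derivative 1 / conf \<epsilon> r) (at r)"
    by (rule DERIV_cong[OF DERIV_cmult[OF DERIV_chain2[OF
          artanh_real_has_field_derivative[OF \<open>\<bar>r / 2\<bar> < 1\<close>] DERIV_cdivide[OF DERIV_ident]], of 2]])
      (simp only: c half)
  then show ?thesis using False by (simp add: geo_radius_def[abs_def])
qed

lemma geo_radius_0 [simp]: "geo_radius \<epsilon> 0 = 0"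
  by (simp add: geo_radius_def)

lemma conf_chart_radius: "\<epsilon> \<in> {0, -1} \<Longrightarrow> 0 < conf \<epsilon> (chart_radius \<epsilon> s)"
  using conf_pos_iff[of "2 * tanh (s / 2)"] tanh_real_bounds[of "s / 2"]
  by (auto simp: chart_radius_def conf_def abs_mult)

lemma geo_radius_chart_radius [simp]: "geo_radius \<epsilon> (chart_radius \<epsilon> s) = s"
  by (simp add: geo_radius_def chart_radius_def artanh_tanh_real)

lemma chart_radius_nonneg: "0 \<le> s \<Longrightarrow> 0 \<le> chart_radius \<epsilon> s"
  by (simp add: chart_radius_def)

lemma geo_radius_strict_mono:
  assumes "\<epsilon> \<in> {0, -1}" "0 < conf \<epsilon> a" "0 < conf \<epsilon> b" "a < b"
  shows "geo_radius \<epsilon> a < geo_radius \<epsilon> b"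
proof (rule DERIV_pos_imp_increasing[OF \<open>a < b\<close>])
  fix x assume "a \<le> x" "x \<le> b"
  then have "0 < conf \<epsilon> x" using conf_between[of \<epsilon> a b x] assms by auto
  then show "\<exists>y. (geo_radius \<epsilon> has_real_derivative y) (at x) \<and> 0 < y"
    using geo_radius_has_derivative[OF assms(1)] by fastforce
qed

lemma geo_radius_less_iff:
  assumes "\<epsilon> \<in> {0, -1}" "0 < conf \<epsilon> a" "0 < conf \<epsilon> b"
  shows "geo_radius \<epsilon> a < geo_radius \<epsilon> b \<longleftrightarrow> a < b"
  using geo_radius_strict_mono[OF assms] geo_radius_strict_mono[OF assms(1,3,2)]
  by (cases a b rule: linorder_cases) auto

lemma geo_radius_le_iff:
  assumes "\<epsilon> \<in> {0, -1}" "0 < conf \<epsilon> a" "0 < conf \<epsilon> b"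
  shows "geo_radius \<epsilon> a \<le> geo_radius \<epsilon> b \<longleftrightarrow> a \<le> b"
  using geo_radius_less_iff[OF assms(1,3,2)] by (simp add: linorder_not_less[symmetric])

lemma geo_radius_eq_iff:
  assumes "\<epsilon> \<in> {0, -1}" "0 < conf \<epsilon> a" "0 < conf \<epsilon> b"
  shows "geo_radius \<epsilon> a = geo_radius \<epsilon> b \<longleftrightarrow> a = b"
  using geo_radius_le_iff[OF assms] geo_radius_le_iff[OF assms(1,3,2)] by auto

lemma chart_radius_geo_radius:
  assumes "\<epsilon> \<in> {0, -1}" "0 < conf \<epsilon> r"
  shows "chart_radius \<epsilon> (geo_radius \<epsilon> r) = r"
  using geo_radius_eq_iff[OF assms(1) conf_chart_radius[OF assms(1)] assms(2), of "geo_radius \<epsilon> r"] by simp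

lemma chart_radius_tendsto_0: "(chart_radius \<epsilon> \<longlongrightarrow> 0) (at_right 0)"
proof -
  have "isCont (\<lambda>s. 2 * tanh (s / 2) :: real) 0"
    by (intro continuous_intros isCont_tanh) auto
  then have "((\<lambda>s. 2 * tanh (s / 2) :: real) \<longlongrightarrow> 0) (at 0)" by (simp add: isCont_def)
  then have "((\<lambda>s. 2 * tanh (s / 2) :: real) \<longlongrightarrow> 0) (at_right 0)"
    by (rule tendsto_within_subset) auto
  then show ?thesis by (cases "\<epsilon> = 0") (auto simp: chart_radius_def[abs_def])
qed

lemma Q_space_iff: "x \<in> Q_space \<epsilon> \<longleftrightarrow> 0 < conf \<epsilon> (norm x)"
  by (simp add: Q_space_def conf_def)

lemma Q_metric_conf: "Q_metric \<epsilon> x u v = (u \<bullet> v) / (conf \<epsilon> (norm x))\<^sup>2"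
  by (simp add: Q_metric_def conf_def)

text \<open>Calibration: along a curve, a function with gradient of length at most \<open>1\<close> grows no faster than
  arc length.\<close>

lemma curve_length_ge:
  fixes \<gamma> :: "real \<Rightarrow> 'a::real_normed_vector" and f :: "'a \<Rightarrow> real"
  assumes "\<gamma> C1_differentiable_on {0..1}"
    and f: "\<And>x. x \<in> \<gamma> ` {0..1} \<Longrightarrow> (f has_derivative f' x) (at x)"
    and le: "\<And>x v. x \<in> \<gamma> ` {0..1} \<Longrightarrow> f' x v \<le> sqrt (g x v v)"
    and cont: "\<And>\<gamma>'. continuous_on {0..1} \<gamma>' \<Longrightarrow> continuous_on {0..1} \<gamma> \<Longrightarrow>
       continuous_on {0..1} (\<lambda>t::real. sqrt (g (\<gamma> t) (\<gamma>' t) (\<gamma>' t)))"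
  shows "f (\<gamma> 1) - f (\<gamma> 0) \<le> curve_length g \<gamma>"
proof -
  let ?d = "\<lambda>t. vector_derivative \<gamma> (at t)"
  have d: "(\<gamma> has_vector_derivative ?d t) (at t)" if "t \<in> {0..1}" for t
    using assms(1) that by (auto simp: C1_differentiable_on_eq vector_derivative_works)
  have cd: "continuous_on {0..1} ?d"
    using assms(1) by (auto simp: C1_differentiable_on_eq)
  have "((\<lambda>t. f (\<gamma> t)) has_vector_derivative f' (\<gamma> t) (?d t)) (at t within {0..1})"
    if "t \<in> {0..1}" for t
    using vector_derivative_diff_chain_within[of \<gamma> "?d t" t "{0..1}" f "f' (\<gamma> t)"] d[OF that] f[of "\<gamma> t"] that
    by (auto simp: o_def intro: has_vector_derivative_at_within has_derivative_at_withinI)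
  then have I: "((\<lambda>t. f' (\<gamma> t) (?d t)) has_integral (f (\<gamma> 1) - f (\<gamma> 0))) {0..1}"
    by (intro fundamental_theorem_of_calculus) auto
  have "continuous_on {0..1} \<gamma>"
    using d by (meson continuous_at_imp_continuous_on has_vector_derivative_continuous)
  then have "(\<lambda>t. sqrt (g (\<gamma> t) (?d t) (?d t))) integrable_on {0..1}"
    by (intro integrable_continuous_interval cont cd)
  then have "((\<lambda>t. sqrt (g (\<gamma> t) (?d t) (?d t))) has_integral curve_length g \<gamma>) {0..1}"
    unfolding curve_length_def by (rule integrable_integral)
  from has_integral_le[OF I this] show ?thesis
    using le by auto
qed

lemma inner_unit_le: "norm e = 1 \<Longrightarrow> \<bar>e \<bullet> v\<bar> \<le> norm v" for e v :: "'a::real_inner"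
  using Cauchy_Schwarz_ineq2[of e v] by simp

text \<open>Since \<open>\<bar>e \<bullet> x\<bar> \<le> norm x\<close>, the conformal factor at \<open>e \<bullet> x\<close> dominates the one at \<open>x\<close>. Unlike the
  distance to the origin, this calibrating function is smooth at the origin.\<close>

lemma geo_radius_inner_derivative:
  fixes e :: "real^'n"
  assumes "\<epsilon> \<in> {0, -1}" "norm e = 1" "x \<in> Q_space \<epsilon>"
  shows "((\<lambda>y. geo_radius \<epsilon> (e \<bullet> y)) has_derivative (\<lambda>v. (e \<bullet> v) / conf \<epsilon> (e \<bullet> x))) (at x)"
    and "(e \<bullet> v) / conf \<epsilon> (e \<bullet> x) \<le> sqrt (Q_metric \<epsilon> x v v)"
proof -
  have c: "0 < conf \<epsilon> (norm x)" using assms by (simp add: Q_space_iff)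
  have c2: "conf \<epsilon> (norm x) \<le> conf \<epsilon> (e \<bullet> x)"
    using conf_antimono[of \<epsilon> "e \<bullet> x" "norm x"] assms(1) inner_unit_le[OF assms(2), of x] by auto
  have "((\<lambda>y. e \<bullet> y) has_derivative (\<lambda>v. e \<bullet> v)) (at x)" by (auto intro!: derivative_eq_intros)
  from has_derivative_compose[OF this geo_radius_has_derivative[OF assms(1), of "e \<bullet> x", unfolded has_field_derivative_def]] c c2
  show "((\<lambda>y. geo_radius \<epsilon> (e \<bullet> y)) has_derivative (\<lambda>v. (e \<bullet> v) / conf \<epsilon> (e \<bullet> x))) (at x)"
    by (simp add: field_simps)
  have "(e \<bullet> v) / conf \<epsilon> (e \<bullet> x) \<le> norm v / conf \<epsilon> (norm x)"
    using c c2 inner_unit_le[OF assms(2), of v] by (intro frac_le) auto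
  also have "\<dots> = sqrt (Q_metric \<epsilon> x v v)"
    using c by (simp add: Q_metric_conf real_sqrt_divide norm_eq_sqrt_inner)
  finally show "(e \<bullet> v) / conf \<epsilon> (e \<bullet> x) \<le> sqrt (Q_metric \<epsilon> x v v)" .
qed

lemma Q_curve_length_ge:
  fixes \<gamma> :: "real \<Rightarrow> real^'n" and e :: "real^'n"
  assumes "\<epsilon> \<in> {0, -1}" "norm e = 1" "\<gamma> C1_differentiable_on {0..1}" "\<gamma> ` {0..1} \<subseteq> Q_space \<epsilon>"
  shows "geo_radius \<epsilon> (e \<bullet> \<gamma> 1) - geo_radius \<epsilon> (e \<bullet> \<gamma> 0) \<le> curve_length (Q_metric \<epsilon>) \<gamma>"
proof (rule curve_length_ge[OF assms(3), of "\<lambda>x. geo_radius \<epsilon> (e \<bullet> x)" "\<lambda>x v. (e \<bullet> v) / conf \<epsilon> (e \<bullet> x)"])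
  fix \<gamma>' :: "real \<Rightarrow> real^'n"
  assume *: "continuous_on {0..1} \<gamma>'" "continuous_on {0..1} \<gamma>"
  show "continuous_on {0..1} (\<lambda>t. sqrt (Q_metric \<epsilon> (\<gamma> t) (\<gamma>' t) (\<gamma>' t)))"
    unfolding Q_metric_conf
    by (intro continuous_intros *) (use assms(4) in \<open>force simp: Q_space_iff\<close>)
qed (use geo_radius_inner_derivative[OF assms(1,2)] assms(4) in auto)

lemma QR_curve_length_ge:
  fixes \<gamma> :: "real \<Rightarrow> (real^'n) \<times> real" and e :: "real^'n"
  assumes "\<epsilon> \<in> {0, -1}" "norm e = 1" "\<gamma> C1_differentiable_on {0..1}" "\<gamma> ` {0..1} \<subseteq> QR_space \<epsilon>"
  shows "geo_radius \<epsilon> (e \<bullet> fst (\<gamma> 1)) - geo_radius \<epsilon> (e \<bullet> fst (\<gamma> 0)) \<le> curve_length (QR_metric \<epsilon>) \<gamma>"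
proof (rule curve_length_ge[OF assms(3), of "\<lambda>p. geo_radius \<epsilon> (e \<bullet> fst p)" "\<lambda>p v. (e \<bullet> fst v) / conf \<epsilon> (e \<bullet> fst p)"])
  fix \<gamma>' :: "real \<Rightarrow> (real^'n) \<times> real"
  assume *: "continuous_on {0..1} \<gamma>'" "continuous_on {0..1} \<gamma>"
  show "continuous_on {0..1} (\<lambda>t. sqrt (QR_metric \<epsilon> (\<gamma> t) (\<gamma>' t) (\<gamma>' t)))"
    unfolding Q_metric_conf QR_metric_def
    by (intro continuous_intros *) (use assms(4) in \<open>force simp: Q_space_iff QR_space_def\<close>)
next
  fix p v :: "(real^'n) \<times> real" assume "p \<in> \<gamma> ` {0..1}"
  then have p: "fst p \<in> Q_space \<epsilon>" using assms(4) by (auto simp: QR_space_def)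
  show "((\<lambda>p. geo_radius \<epsilon> (e \<bullet> fst p)) has_derivative (\<lambda>v. (e \<bullet> fst v) / conf \<epsilon> (e \<bullet> fst p))) (at p)"
    using has_derivative_compose[of fst fst p UNIV, OF _ geo_radius_inner_derivative(1)[OF assms(1,2) p]]
    using bounded_linear_imp_has_derivative[OF bounded_linear_fst] by blast
  have "(e \<bullet> fst v) / conf \<epsilon> (e \<bullet> fst p) \<le> sqrt (Q_metric \<epsilon> (fst p) (fst v) (fst v))"
    by (rule geo_radius_inner_derivative(2)[OF assms(1,2) p])
  also have "\<dots> \<le> sqrt (QR_metric \<epsilon> p v v)" by (simp add: QR_metric_def)
  finally show "(e \<bullet> fst v) / conf \<epsilon> (e \<bullet> fst p) \<le> sqrt (QR_metric \<epsilon> p v v)" .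
qed

lemma linear_curve_C1:
  "(\<lambda>t::real. a + t *\<^sub>R (b :: 'a::real_normed_vector)) C1_differentiable_on {0..1}"
  unfolding C1_differentiable_on_def
  by (rule exI[of _ "\<lambda>_. b"]) (auto intro!: derivative_eq_intros)

lemma Q_space_convex: "\<epsilon> \<in> {0, -1} \<Longrightarrow> convex (Q_space \<epsilon> :: (real^'n) set)"
proof (cases "\<epsilon> = 0")
  case False
  assume "\<epsilon> \<in> {0, -1}"
  then have "\<epsilon> = -1" using False by simp
  then have "(Q_space \<epsilon> :: (real^'n) set) = ball 0 2"
    by (auto simp: Q_space_iff conf_pos_iff)
  then show ?thesis by simp
qed (auto simp: Q_space_def)

lemma curve_length_nonneg:
  assumes "\<And>p v. 0 \<le> g p v v"
  shows "0 \<le> curve_length g \<gamma>"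
proof (cases "(\<lambda>t. sqrt (g (\<gamma> t) (vector_derivative \<gamma> (at t)) (vector_derivative \<gamma> (at t)))) integrable_on {0..1}")
  case True
  then show ?thesis unfolding curve_length_def
    by (rule Henstock_Kurzweil_Integration.integral_nonneg) (use assms in auto)
qed (simp add: curve_length_def not_integrable_integral)

lemma curve_bdd_below:
  assumes "\<And>p v. 0 \<le> g p v v"
  shows "bdd_below (curve_length g ` X)"
  using curve_length_nonneg[of g] assms by (intro bdd_belowI[of _ 0]) auto

text \<open>A direction exists for \<open>x = 0\<close> too, which lets radial arguments include the origin.\<close>

lemma unit_direction:
  fixes x :: "real^'n"
  obtains e where "norm e = 1" "x = norm x *\<^sub>R e" "e \<bullet> x = norm x"
proof (cases "x = 0")
  case True
  show ?thesis by (rule that[of "axis undefined 1"]) (auto simp: True)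
next
  case False
  show ?thesis by (rule that[of "x /\<^sub>R norm x"]) (use False in \<open>auto simp: dot_square_norm power2_eq_square\<close>)
qed

text \<open>Parametrizing by \<open>t\<close> in \<open>[0, 1]\<close>, the speed of a radial segment is the derivative of
  \<open>geo_radius \<epsilon> (a + t (b - a))\<close> up to a constant sign.\<close>

lemma radial_segment_length:
  fixes e :: "real^'n"
  assumes \<epsilon>: "\<epsilon> \<in> {0, -1}" and e: "norm e = 1" and a: "0 < conf \<epsilon> a" and b: "0 < conf \<epsilon> b"
    and g: "\<And>t. g (\<gamma> t) w w = ((b - a) / conf \<epsilon> (a + t * (b - a)))\<^sup>2"
    and \<gamma>: "\<And>t. (\<gamma> has_vector_derivative w) (at t)"
  shows "curve_length g \<gamma> = \<bar>geo_radius \<epsilon> b - geo_radius \<epsilon> a\<bar>"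
proof -
  have pos: "0 < conf \<epsilon> (a + t * (b - a))" if "t \<in> {0..1}" for t
  proof (cases "a \<le> b")
    case True
    then have "a \<le> a + t * (b - a)" "a + t * (b - a) \<le> b"
      using that mult_left_le_one_le[of "b - a" t] by auto
    then show ?thesis using conf_between[of \<epsilon> a b] a b \<epsilon> by auto
  next
    case False
    then have "a + t * (b - a) \<le> a" "b \<le> a + t * (b - a)"
      using that mult_left_le_one_le[of "a - b" t] mult_nonneg_nonneg[of t "a - b"]
      by (auto simp: algebra_simps)
    then show ?thesis using conf_between[of \<epsilon> b a] a b \<epsilon> by auto
  qed
  have D: "((\<lambda>t. geo_radius \<epsilon> (a + t * (b - a))) has_vector_derivative (b - a) / conf \<epsilon> (a + t * (b - a))) (at t within {0..1})"
    if "t \<in> {0..1}" for t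
  proof -
    have "((\<lambda>t. a + t * (b - a)) has_real_derivative (b - a)) (at t)" by (auto intro!: derivative_eq_intros)
    from DERIV_chain2[OF geo_radius_has_derivative[OF \<epsilon> pos[OF that]] this]
    show ?thesis
      by (simp add: has_real_derivative_iff_has_vector_derivative has_vector_derivative_at_within)
  qed
  have "((\<lambda>t. (b - a) / conf \<epsilon> (a + t * (b - a))) has_integral (geo_radius \<epsilon> b - geo_radius \<epsilon> a)) {0..1}"
    using fundamental_theorem_of_calculus[OF _ D] by auto
  then have I: "((\<lambda>t. sgn (b - a) * ((b - a) / conf \<epsilon> (a + t * (b - a)))) has_integral sgn (b - a) * (geo_radius \<epsilon> b - geo_radius \<epsilon> a)) {0..1}"
    by (rule has_integral_mult_right)
  have vd: "vector_derivative \<gamma> (at t) = w" for t by (rule vector_derivative_at[OF \<gamma>])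
  have "sqrt (g (\<gamma> t) (vector_derivative \<gamma> (at t)) (vector_derivative \<gamma> (at t))) = sgn (b - a) * ((b - a) / conf \<epsilon> (a + t * (b - a)))"
    if "t \<in> {0..1}" for t
    unfolding vd g real_sqrt_abs using pos[OF that] by (auto simp: sgn_if abs_if field_simps)
  then have "((\<lambda>t. sqrt (g (\<gamma> t) (vector_derivative \<gamma> (at t)) (vector_derivative \<gamma> (at t)))) has_integral
      sgn (b - a) * (geo_radius \<epsilon> b - geo_radius \<epsilon> a)) {0..1}"
    using I by (subst has_integral_cong) auto
  then have "curve_length g \<gamma> = sgn (b - a) * (geo_radius \<epsilon> b - geo_radius \<epsilon> a)"
    unfolding curve_length_def by (rule integral_unique)
  then show ?thesis
    using geo_radius_le_iff[OF \<epsilon> a b] geo_radius_le_iff[OF \<epsilon> b a] by (auto simp: sgn_if abs_if)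
qed

lemma Q_space_radial: "norm e = 1 \<Longrightarrow> r *\<^sub>R e \<in> Q_space \<epsilon> \<longleftrightarrow> 0 < conf \<epsilon> r"
  by (simp add: Q_space_iff)

lemma convex_segment:
  assumes "convex S" "x \<in> S" "y \<in> S" "t \<in> {0..1}"
  shows "x + t *\<^sub>R (y - x) \<in> S"
  using convexD_alt[OF assms(1,2,3), of t] assms(4) by (simp add: algebra_simps)

lemma riemannian_dist_le:
  assumes "\<gamma> C1_differentiable_on {0..1}" "\<gamma> ` {0..1} \<subseteq> M" "\<gamma> 0 = x" "\<gamma> 1 = y" "\<And>p v. 0 \<le> g p v v"
  shows "riemannian_dist M g x y \<le> curve_length g \<gamma>"
  unfolding riemannian_dist_def by (rule cINF_lower) (use curve_bdd_below[of g] assms in auto)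

lemma riemannian_dist_ge:
  assumes "convex M" "x \<in> M" "y \<in> M"
    and "\<And>\<gamma>. \<gamma> C1_differentiable_on {0..1} \<Longrightarrow> \<gamma> ` {0..1} \<subseteq> M \<Longrightarrow> \<gamma> 0 = x \<Longrightarrow> \<gamma> 1 = y \<Longrightarrow>
       d \<le> curve_length g \<gamma>"
  shows "d \<le> riemannian_dist M g x y"
  unfolding riemannian_dist_def
proof (rule cINF_greatest)
  have "(\<lambda>t. x + t *\<^sub>R (y - x)) \<in> {\<gamma>. \<gamma> C1_differentiable_on {0..1} \<and> \<gamma> ` {0..1} \<subseteq> M \<and> \<gamma> 0 = x \<and> \<gamma> 1 = y}"
    using linear_curve_C1 convex_segment[OF assms(1-3)] by auto
  then show "{\<gamma>. \<gamma> C1_differentiable_on {0..1} \<and> \<gamma> ` {0..1} \<subseteq> M \<and> \<gamma> 0 = x \<and> \<gamma> 1 = y} \<noteq> {}" by blast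
qed (use assms(4) in auto)

lemma Q_metric_nonneg: "0 \<le> Q_metric \<epsilon> p v v"
  by (simp add: Q_metric_def)

lemma QR_metric_nonneg: "0 \<le> QR_metric \<epsilon> p v v"
  by (simp add: QR_metric_def Q_metric_def)

lemma Q_dist_origin:
  fixes x :: "real^'n"
  assumes \<epsilon>: "\<epsilon> \<in> {0, -1}" and x: "x \<in> Q_space \<epsilon>"
  shows "Q_dist \<epsilon> 0 x = geo_radius \<epsilon> (norm x)"
proof -
  obtain e where e: "norm e = 1" "x = norm x *\<^sub>R e" "e \<bullet> x = norm x" by (rule unit_direction)
  have 0: "(0::real^'n) \<in> Q_space \<epsilon>" by (simp add: Q_space_iff)
  let ?\<gamma> = "\<lambda>t. 0 + t *\<^sub>R x"
  have ee: "e \<bullet> e = 1" using e(1) by (simp add: dot_square_norm)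
  have "curve_length (Q_metric \<epsilon>) ?\<gamma> = \<bar>geo_radius \<epsilon> (norm x) - geo_radius \<epsilon> 0\<bar>"
  proof (rule radial_segment_length[OF \<epsilon> e(1), of _ _ _ _ x])
    show "Q_metric \<epsilon> (0 + t *\<^sub>R x) x x = ((norm x - 0) / conf \<epsilon> (0 + t * (norm x - 0)))\<^sup>2" for t
      using conf_abs[of \<epsilon> "t * norm x"]
      by (simp add: Q_metric_conf power_divide dot_square_norm abs_mult)
  qed (use x in \<open>auto simp: Q_space_iff intro!: derivative_eq_intros\<close>)
  moreover have "0 \<le> geo_radius \<epsilon> (norm x)"
    using geo_radius_le_iff[OF \<epsilon>, of 0 "norm x"] x by (simp add: Q_space_iff)
  ultimately have "Q_dist \<epsilon> 0 x \<le> geo_radius \<epsilon> (norm x)"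
    unfolding Q_dist_def
    using riemannian_dist_le[of ?\<gamma> "Q_space \<epsilon>" 0 x "Q_metric \<epsilon>"] linear_curve_C1[of 0 x]
      convex_segment[OF Q_space_convex[OF \<epsilon>] 0 x] Q_metric_nonneg by (auto simp: image_subset_iff)
  moreover have "geo_radius \<epsilon> (norm x) \<le> Q_dist \<epsilon> 0 x"
    unfolding Q_dist_def
    by (rule riemannian_dist_ge[OF Q_space_convex[OF \<epsilon>] 0 x])
      (use Q_curve_length_ge[OF \<epsilon> e(1)] e(3) in fastforce)
  ultimately show ?thesis by simp
qed

lemma QR_space_convex: "\<epsilon> \<in> {0, -1} \<Longrightarrow> convex (QR_space \<epsilon> :: ((real^'n) \<times> real) set)"
  unfolding QR_space_def by (intro convex_Times Q_space_convex) auto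

text \<open>The calibration is used with the direction of whichever endpoint is farther out; for the reverse
  difference, oddness of \<open>geo_radius\<close> allows the opposite direction.\<close>

lemma QR_dist_ge:
  fixes p q :: "(real^'n) \<times> real"
  assumes \<epsilon>: "\<epsilon> \<in> {0, -1}" and p: "fst p \<in> Q_space \<epsilon>" and q: "fst q \<in> Q_space \<epsilon>"
  shows "\<bar>geo_radius \<epsilon> (norm (fst p)) - geo_radius \<epsilon> (norm (fst q))\<bar> \<le> QR_dist \<epsilon> p q"
proof -
  have *: "geo_radius \<epsilon> (norm y) - geo_radius \<epsilon> (norm x) \<le> geo_radius \<epsilon> (e \<bullet> y) - geo_radius \<epsilon> (e \<bullet> x)"
    if e: "norm e = 1" "e \<bullet> y = norm y" and x: "x \<in> Q_space \<epsilon>" for x y e :: "real^'n"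
  proof -
    have "conf \<epsilon> (norm x) \<le> conf \<epsilon> (e \<bullet> x)"
      using conf_antimono[of \<epsilon> "e \<bullet> x" "norm x"] \<epsilon> inner_unit_le[OF e(1), of x] by auto
    then have "geo_radius \<epsilon> (e \<bullet> x) \<le> geo_radius \<epsilon> (norm x)"
      using geo_radius_le_iff[OF \<epsilon>, of "e \<bullet> x" "norm x"] inner_unit_le[OF e(1), of x] x by (auto simp: Q_space_iff)
    then show ?thesis using e by simp
  qed
  have 1: "p \<in> QR_space \<epsilon>" "q \<in> QR_space \<epsilon>" using p q by (auto simp: QR_space_def mem_Times_iff)
  obtain e where e: "norm e = 1" "e \<bullet> fst q = norm (fst q)" by (rule unit_direction[of "fst q"]) 
  obtain d where d: "norm d = 1" "d \<bullet> fst p = norm (fst p)" by (rule unit_direction[of "fst p"])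
  have "geo_radius \<epsilon> (norm (fst q)) - geo_radius \<epsilon> (norm (fst p)) \<le> QR_dist \<epsilon> p q"
    unfolding QR_dist_def
    by (rule riemannian_dist_ge[OF QR_space_convex[OF \<epsilon>] 1])
      (use QR_curve_length_ge[OF \<epsilon> e(1)] *[OF e p] in fastforce)
  moreover have "geo_radius \<epsilon> (norm (fst p)) - geo_radius \<epsilon> (norm (fst q)) \<le> QR_dist \<epsilon> p q"
    unfolding QR_dist_def
  proof (rule riemannian_dist_ge[OF QR_space_convex[OF \<epsilon>] 1])
    fix \<gamma> :: "real \<Rightarrow> (real^'n) \<times> real"
    assume g: "\<gamma> C1_differentiable_on {0..1}" "\<gamma> ` {0..1} \<subseteq> QR_space \<epsilon>" "\<gamma> 0 = p" "\<gamma> 1 = q"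
    have nd: "norm (-d) = 1" using d by simp
    have odd: "geo_radius \<epsilon> (- r) = - geo_radius \<epsilon> r" if "0 < conf \<epsilon> r" for r
      using that conf_pos_iff[of r] \<epsilon> by (auto simp: geo_radius_def)
    have "0 < conf \<epsilon> (d \<bullet> fst q)" 
      using conf_antimono[of \<epsilon> "d \<bullet> fst q" "norm (fst q)"] \<epsilon> inner_unit_le[OF d(1), of "fst q"] q
      by (auto simp: Q_space_iff)
    then have "geo_radius \<epsilon> (-d \<bullet> fst q) = - geo_radius \<epsilon> (d \<bullet> fst q)" "geo_radius \<epsilon> (-d \<bullet> fst p) = - geo_radius \<epsilon> (d \<bullet> fst p)"
      using odd p d(2) by (auto simp: Q_space_iff)
    then show "geo_radius \<epsilon> (norm (fst p)) - geo_radius \<epsilon> (norm (fst q)) \<le> curve_length (QR_metric \<epsilon>) \<gamma>"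
      using QR_curve_length_ge[OF \<epsilon> nd g(1,2)] *[OF d q] g(3,4) by simp
  qed
  ultimately show ?thesis by linarith
qed

lemma QR_dist_radial_le:
  fixes e :: "real^'n"
  assumes \<epsilon>: "\<epsilon> \<in> {0, -1}" and e: "norm e = 1" and a: "0 < conf \<epsilon> a" and b: "0 < conf \<epsilon> b"
  shows "QR_dist \<epsilon> (a *\<^sub>R e, t) (b *\<^sub>R e, t) \<le> \<bar>geo_radius \<epsilon> b - geo_radius \<epsilon> a\<bar>"
proof -
  let ?x = "(a *\<^sub>R e, t)" and ?w = "((b - a) *\<^sub>R e, 0::real)"
  let ?\<gamma> = "\<lambda>\<tau>. ?x + \<tau> *\<^sub>R ?w"
  have in1: "?x \<in> QR_space \<epsilon>" "(b *\<^sub>R e, t) \<in> QR_space \<epsilon>" 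
    using a b e by (auto simp: QR_space_def Q_space_radial)
  have ee: "e \<bullet> e = 1" using e by (simp add: dot_square_norm)
  have w: "?w = (b *\<^sub>R e, t) - ?x" by (simp add: algebra_simps)
  have "curve_length (QR_metric \<epsilon>) ?\<gamma> = \<bar>geo_radius \<epsilon> b - geo_radius \<epsilon> a\<bar>"
  proof (rule radial_segment_length[OF \<epsilon> e a b, of _ _ ?w])
    fix \<tau>
    have f: "fst (?\<gamma> \<tau>) = (a + \<tau> * (b - a)) *\<^sub>R e" by (simp add: algebra_simps)
    show "QR_metric \<epsilon> (?\<gamma> \<tau>) ?w ?w = ((b - a) / conf \<epsilon> (a + \<tau> * (b - a)))\<^sup>2"
      unfolding QR_metric_def f using e by (simp add: Q_metric_conf power_divide ee power2_eq_square)
  qed (auto intro!: derivative_eq_intros)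
  moreover have "riemannian_dist (QR_space \<epsilon>) (QR_metric \<epsilon>) ?x (b *\<^sub>R e, t) \<le> curve_length (QR_metric \<epsilon>) ?\<gamma>"
    by (rule riemannian_dist_le[OF linear_curve_C1])
      (use convex_segment[OF QR_space_convex[OF \<epsilon>] in1] QR_metric_nonneg w in \<open>auto simp: algebra_simps\<close>)
  ultimately show ?thesis unfolding QR_dist_def by simp
qed

lemma Q_ball_eq:
  assumes "\<epsilon> \<in> {0, -1}" "0 < conf \<epsilon> b" "0 \<le> b"
  shows "Q_ball \<epsilon> (geo_radius \<epsilon> b) = {x :: real^'n. norm x < b}"
    and "Q_cball \<epsilon> (geo_radius \<epsilon> b) = {x :: real^'n. norm x \<le> b}"
    and "Q_sphere \<epsilon> (geo_radius \<epsilon> b) = {x :: real^'n. norm x = b}"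
proof -
  have *: "norm x \<le> b \<Longrightarrow> x \<in> Q_space \<epsilon>" for x :: "real^'n"
    using conf_antimono[of \<epsilon> "norm x" b] assms by (auto simp: Q_space_iff)
  show "Q_ball \<epsilon> (geo_radius \<epsilon> b) = {x :: real^'n. norm x < b}"
    using * by (auto simp: Q_ball_def Q_dist_origin[OF assms(1)] Q_space_iff geo_radius_less_iff[OF assms(1) _ assms(2)])
  show "Q_cball \<epsilon> (geo_radius \<epsilon> b) = {x :: real^'n. norm x \<le> b}"
    using * by (auto simp: Q_cball_def Q_dist_origin[OF assms(1)] Q_space_iff geo_radius_le_iff[OF assms(1) _ assms(2)])
  show "Q_sphere \<epsilon> (geo_radius \<epsilon> b) = {x :: real^'n. norm x = b}"
    using * by (auto simp: Q_sphere_def Q_dist_origin[OF assms(1)] Q_space_iff geo_radius_eq_iff[OF assms(1) _ assms(2)])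
qed

section \<open>Curvature of rotational graphs\<close>

lemma QR_metric_has_derivative:
  fixes p X Y Z :: "(real^'n) \<times> real"
  assumes "fst p \<in> Q_space \<epsilon>"
  shows "((\<lambda>q. QR_metric \<epsilon> q Y Z) has_derivative
     (\<lambda>X. - \<epsilon> * (fst p \<bullet> fst X) * (fst Y \<bullet> fst Z) / (conf \<epsilon> (norm (fst p)))^3)) (at p)"
proof -
  let ?c = "\<lambda>q :: (real^'n) \<times> real. 1 + \<epsilon> * (fst q \<bullet> fst q) / 4"
  have c: "?c q = conf \<epsilon> (norm (fst q))" for q by (simp add: conf_def power2_norm_eq_inner)
  have c0: "?c p > 0" using assms by (simp add: c Q_space_iff)
  have dc: "(?c has_derivative (\<lambda>X. \<epsilon> / 2 * (fst p \<bullet> fst X))) (at p)"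
    by (auto intro!: derivative_eq_intros simp: inner_commute)
  have inv_sq: "((\<lambda>t. a / t\<^sup>2 + b) has_real_derivative - 2 * a / t^3) (at t)" if "t \<noteq> 0" for a b t :: real
    using that
    by (intro DERIV_cong[OF DERIV_add[OF DERIV_divide[OF DERIV_const[of a] DERIV_power[OF DERIV_ident, of 2 t]] DERIV_const[of b]]])
      (simp_all add: power2_eq_square power3_eq_cube mult_ac)
  have "((\<lambda>t. (fst Y \<bullet> fst Z) / t\<^sup>2 + snd Y * snd Z) has_real_derivative - 2 * (fst Y \<bullet> fst Z) / (?c p)^3) (at (?c p))"
    using inv_sq[of "?c p"] c0 by simp
  from has_derivative_compose[OF dc this[unfolded has_field_derivative_def]]
  have "((\<lambda>q. (fst Y \<bullet> fst Z) / (?c q)\<^sup>2 + snd Y * snd Z) has_derivative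
      (\<lambda>X. - 2 * (fst Y \<bullet> fst Z) / (?c p)^3 * (\<epsilon> / 2 * (fst p \<bullet> fst X)))) (at p)" .
  moreover have "(\<lambda>X :: (real^'n) \<times> real. - 2 * (fst Y \<bullet> fst Z) / (?c p)^3 * (\<epsilon> / 2 * (fst p \<bullet> fst X))) =
     (\<lambda>X. - \<epsilon> * (fst p \<bullet> fst X) * (fst Y \<bullet> fst Z) / (conf \<epsilon> (norm (fst p)))^3)"
    by (auto simp: c)
  ultimately show ?thesis
    by (simp only: c QR_metric_def[abs_def] Q_metric_conf)
qed

text \<open>The Koszul formula determines the field because the metric is nondegenerate. The correction is that of the
  conformal factor, whose logarithmic gradient is \<open>\<epsilon> x / (2 c)\<close>.\<close>

lemma christoffel_QR:
  fixes p X Y :: "(real^'n) \<times> real"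
  assumes "fst p \<in> Q_space \<epsilon>"
  defines "x \<equiv> fst p"
  shows "christoffel (QR_metric \<epsilon>) p X Y =
    ((- \<epsilon> / (2 * conf \<epsilon> (norm x))) *\<^sub>R
      ((x \<bullet> fst X) *\<^sub>R fst Y + (x \<bullet> fst Y) *\<^sub>R fst X - (fst X \<bullet> fst Y) *\<^sub>R x), 0)"
proof -
  let ?c = "conf \<epsilon> (norm x)"
  have c: "?c > 0" using assms by (simp add: Q_space_iff)
  have fd: "frechet_derivative (\<lambda>q. QR_metric \<epsilon> q Y Z) (at p) =
     (\<lambda>X. - \<epsilon> * (x \<bullet> fst X) * (fst Y \<bullet> fst Z) / ?c^3)" for Y Z :: "(real^'n) \<times> real"
    using frechet_derivative_at[OF QR_metric_has_derivative[OF assms(1), of Y Z]] by (simp add: x_def)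
  define W0 :: "(real^'n) \<times> real" where "W0 = ((- \<epsilon> / (2 * ?c)) *\<^sub>R ((x \<bullet> fst X) *\<^sub>R fst Y + (x \<bullet> fst Y) *\<^sub>R fst X - (fst X \<bullet> fst Y) *\<^sub>R x), 0)"
  have 1: "2 * QR_metric \<epsilon> p W0 Z =
      frechet_derivative (\<lambda>q. QR_metric \<epsilon> q Y Z) (at p) X
    + frechet_derivative (\<lambda>q. QR_metric \<epsilon> q X Z) (at p) Y
    - frechet_derivative (\<lambda>q. QR_metric \<epsilon> q X Y) (at p) Z" for Z
  proof -
    have "2 * (- \<epsilon> / (2 * c) * (a * b + d * f - g * h) / c\<^sup>2 + 0 * z) =
      - \<epsilon> * a * b / c^3 + - \<epsilon> * d * f / c^3 - - \<epsilon> * h * g / c^3" if "c \<noteq> 0" for a b c d f g h z :: real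
      using that by (simp add: field_simps power2_eq_square power3_eq_cube)
    from this[of ?c] c show ?thesis
      unfolding fd unfolding W0_def QR_metric_def Q_metric_conf x_def[symmetric]
      by (simp add: inner_add_left inner_diff_left)
  qed
  have "christoffel (QR_metric \<epsilon>) p X Y = W0" unfolding christoffel_def
  proof (rule the_equality)
    fix W assume W: "\<forall>Z. 2 * QR_metric \<epsilon> p W Z = frechet_derivative (\<lambda>q. QR_metric \<epsilon> q Y Z) (at p) X
    + frechet_derivative (\<lambda>q. QR_metric \<epsilon> q X Z) (at p) Y - frechet_derivative (\<lambda>q. QR_metric \<epsilon> q X Y) (at p) Z"
    have "2 * QR_metric \<epsilon> p W (W - W0) = 2 * QR_metric \<epsilon> p W0 (W - W0)"
      unfolding 1 by (rule W[rule_format])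
    moreover have "QR_metric \<epsilon> p W V - QR_metric \<epsilon> p W' V = QR_metric \<epsilon> p (W - W') V" for V W' :: "(real^'n) \<times> real"
      by (simp add: QR_metric_def Q_metric_conf inner_diff_left diff_divide_distrib left_diff_distrib)
    ultimately have "QR_metric \<epsilon> p (W - W0) (W - W0) = 0"
      by (metis diff_self mult_cancel_left zero_neq_numeral)
    then have "fst (W - W0) = 0 \<and> snd (W - W0) = 0"
      using c unfolding QR_metric_def Q_metric_conf x_def[symmetric]
      by (simp add: add_nonneg_eq_0_iff)
    then show "W = W0" by (intro prod_eqI) (simp_all only: fst_diff snd_diff right_minus_eq)
  qed (use 1 in auto)
  then show ?thesis by (simp add: W0_def)
qed

lemma tangent_space_graph:
  fixes u :: "'a::real_normed_vector \<Rightarrow> real"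
  assumes U: "open U" "p \<in> U" and S: "\<And>q. q \<in> U \<Longrightarrow> q \<in> S \<longleftrightarrow> snd q = u (fst q)" and "p \<in> S"
    and D: "(u has_derivative D) (at (fst p))"
  shows "tangent_space S p = {v. snd v = D (fst v)}"
proof (intro set_eqI iffI)
  fix v assume "v \<in> tangent_space S p"
  then obtain \<gamma> \<delta> where \<gamma>: "0 < \<delta>" "\<gamma> 0 = p" "\<And>t. \<bar>t\<bar> < \<delta> \<Longrightarrow> \<gamma> t \<in> S"
    "(\<gamma> has_vector_derivative v) (at (0::real))" by (auto simp: tangent_space_def)
  have "isCont \<gamma> 0" using \<gamma>(4) by (rule has_vector_derivative_continuous)
  then have "\<forall>\<^sub>F t in at 0. \<gamma> t \<in> U" using U \<gamma>(2) by (auto simp: isCont_def intro: topological_tendstoD)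
  moreover have "\<forall>\<^sub>F t in at 0. \<bar>t\<bar> < \<delta>"
    using \<gamma>(1) by (auto simp: eventually_at intro!: exI[of _ \<delta>])
  ultimately have ev: "\<forall>\<^sub>F t in at 0. snd (\<gamma> t) = u (fst (\<gamma> t))"
  proof eventually_elim
    case (elim t)
    then show ?case using S[of "\<gamma> t"] \<gamma>(3)[of t] by simp
  qed
  have f: "((\<lambda>t. fst (\<gamma> t)) has_vector_derivative fst v) (at 0)"
    and s: "((\<lambda>t. snd (\<gamma> t)) has_vector_derivative snd v) (at 0)"
    using bounded_linear.has_vector_derivative[OF bounded_linear_fst \<gamma>(4)]
      bounded_linear.has_vector_derivative[OF bounded_linear_snd \<gamma>(4)] by auto
  have "((\<lambda>t. u (fst (\<gamma> t))) has_vector_derivative D (fst v)) (at 0)"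
    using vector_derivative_diff_chain_within[OF f, of u D] D \<gamma>(2)
    by (auto simp: o_def intro: has_derivative_at_withinI)
  then have "((\<lambda>t. snd (\<gamma> t)) has_vector_derivative D (fst v)) (at 0)"
    unfolding has_vector_derivative_def
    by (rule has_derivative_transform_eventually)
      (use eventually_mono[OF ev sym] S[of p] U \<open>p \<in> S\<close> \<gamma>(2) in auto)
  with s show "v \<in> {v. snd v = D (fst v)}" by (auto dest: vector_derivative_unique_at)
next
  fix v assume "v \<in> {v. snd v = D (fst v)}"
  then obtain w where v: "v = (w, D w)" by (cases v) auto
  let ?\<gamma> = "\<lambda>t::real. (fst p + t *\<^sub>R w, u (fst p + t *\<^sub>R w))"
  have l: "((\<lambda>t. fst p + t *\<^sub>R w) has_vector_derivative w) (at 0)"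
    by (auto intro!: derivative_eq_intros)
  have "((\<lambda>t. u (fst p + t *\<^sub>R w)) has_vector_derivative D w) (at 0)"
    using vector_derivative_diff_chain_within[OF l, of u D] D
    by (auto simp: o_def intro: has_derivative_at_withinI)
  with l have g: "(?\<gamma> has_vector_derivative v) (at 0)" unfolding v by (intro has_vector_derivative_Pair) auto
  have p: "?\<gamma> 0 = p" using S[of p] U \<open>p \<in> S\<close> by (simp add: prod_eq_iff)
  have "isCont ?\<gamma> 0" using g by (rule has_vector_derivative_continuous)
  then have "\<forall>\<^sub>F t in at 0. ?\<gamma> t \<in> U" using U p by (auto simp: isCont_def intro: topological_tendstoD)
  then obtain \<delta> where "0 < \<delta>" "\<And>t. t \<noteq> 0 \<Longrightarrow> \<bar>t\<bar> < \<delta> \<Longrightarrow> ?\<gamma> t \<in> U"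
    by (auto simp: eventually_at dist_norm)
  moreover have "?\<gamma> 0 \<in> U" unfolding p by (rule U(2))
  ultimately have inS: "?\<gamma> t \<in> S" if "\<bar>t\<bar> < \<delta>" for t
    using S[of "?\<gamma> t"] that by (cases "t = 0") simp_all
  then show "v \<in> tangent_space S p" unfolding tangent_space_def using p g
    by (intro CollectI exI[of _ ?\<gamma>] exI[of _ \<delta>] conjI allI impI) (use \<open>0 < \<delta>\<close> inS in blast)+
qed

text \<open>A derivative within a hypersurface is not unique, but its values on velocities of curves in the
  hypersurface are.\<close>

lemma frechet_derivative_tangent:
  assumes "(N has_derivative D) (at p within S)" "v \<in> tangent_space S p"
  shows "frechet_derivative N (at p within S) v = D v"
proof -
  obtain \<gamma> \<delta> where \<gamma>: "0 < \<delta>" "\<gamma> 0 = p" "\<And>t. \<bar>t\<bar> < \<delta> \<Longrightarrow> \<gamma> t \<in> S"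
    "(\<gamma> has_vector_derivative v) (at (0::real))" using assms(2) by (auto simp: tangent_space_def)
  let ?J = "{- \<delta> <..< \<delta>}"
  have J: "at (0::real) within ?J = at 0" using \<gamma>(1) by (intro at_within_open) auto
  have sub: "\<gamma> ` ?J \<subseteq> S" using \<gamma>(3) by (auto simp: abs_less_iff)
  have *: "((\<lambda>t. N (\<gamma> t)) has_vector_derivative D' v) (at 0)" if "(N has_derivative D') (at p within S)" for D'
    using vector_derivative_diff_chain_within[of \<gamma> v 0 ?J N D'] \<gamma>(2,4) that has_derivative_subset[OF that sub]
    by (auto simp: o_def J)
  have "(N has_derivative frechet_derivative N (at p within S)) (at p within S)"
    using assms(1) by (metis differentiableI frechet_derivative_works)
  from vector_derivative_unique_at[OF *[OF this] *[OF assms(1)]] show ?thesis .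
qed

text \<open>The upward unit normal of the graph whose profile makes the angle \<open>\<theta>\<close> with the horizontal. Division
  by zero makes it \<open>(0, cos (\<theta> 0))\<close> at the origin, which is the right value if \<open>\<theta> 0 = 0\<close>.\<close>

definition rot_normal :: "real \<Rightarrow> (real \<Rightarrow> real) \<Rightarrow> real^'n \<Rightarrow> (real^'n) \<times> real" where
  "rot_normal \<epsilon> \<theta> x =
     (- (conf \<epsilon> (norm x) * sin (\<theta> (norm x)) / norm x) *\<^sub>R x, cos (\<theta> (norm x)))"

text \<open>Only the part of \<open>S\<close> near \<open>p\<close> is required to be a graph, so that the notion applies to both sheets
  of a cone.\<close>

definition rot_sheet ::
  "real \<Rightarrow> ((real^'n) \<times> real) set \<Rightarrow> ((real^'n) \<times> real \<Rightarrow> (real^'n) \<times> real) \<Rightarrow>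
   (real^'n) \<times> real \<Rightarrow> (real \<Rightarrow> real) \<Rightarrow> (real \<Rightarrow> real) \<Rightarrow> bool" where
  "rot_sheet \<epsilon> S N p \<psi> \<theta> \<longleftrightarrow> p \<in> S \<and> (\<exists>U. open U \<and> p \<in> U \<and>
     (\<forall>q\<in>U. q \<in> S \<longleftrightarrow> snd q = \<psi> (norm (fst q))) \<and>
     (\<forall>q\<in>S \<inter> U. N q = rot_normal \<epsilon> \<theta> (fst q)))"

lemma radial_has_derivative:
  fixes x :: "'a::real_inner"
  assumes "(f has_real_derivative f') (at (norm x))" "x \<noteq> 0"
  shows "((\<lambda>y. f (norm y)) has_derivative (\<lambda>w. f' * (x \<bullet> w) / norm x)) (at x)"
proof -
  have "(norm has_derivative (\<lambda>w. sgn x \<bullet> w)) (at x)"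
    using has_derivative_norm[OF assms(2)] by (simp add: inner_commute)
  from has_derivative_compose[OF this assms(1)[unfolded has_field_derivative_def]]
  show ?thesis by (simp add: sgn_div_norm divide_inverse mult_ac)
qed

lemma radial_has_derivative_0:
  fixes x :: "'a::real_inner"
  assumes "(f has_real_derivative 0) (at 0)"
  shows "((\<lambda>y::'a. f (norm y)) has_derivative (\<lambda>w. 0)) (at 0)"
proof -
  have "((\<lambda>h. (f h - f 0) / h) \<longlongrightarrow> 0) (at 0)"
    using assms by (simp add: DERIV_def)
  moreover have "filterlim norm (at 0) (at (0::'a))"
    by (auto simp: filterlim_at eventually_at_filter tendsto_norm_zero)
  ultimately have "((\<lambda>y::'a. (f (norm y) - f 0) / norm y) \<longlongrightarrow> 0) (at 0)"
    by (rule filterlim_compose)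
  then have "((\<lambda>y::'a. norm ((f (norm y) - f 0) / norm y)) \<longlongrightarrow> 0) (at 0)"
    by (rule tendsto_norm_zero)
  then show ?thesis
    by (simp add: has_derivative_at)
qed

lemma rot_normal_has_derivative:
  fixes x :: "real^'n" and \<epsilon> :: real
  assumes x: "x \<noteq> 0" and \<theta>: "(\<theta> has_real_derivative \<theta>') (at (norm x))"
  defines "r \<equiv> norm x"
  defines "m' \<equiv> (\<epsilon> * r / 2 * sin (\<theta> r) + conf \<epsilon> r * (cos (\<theta> r) * \<theta>')) / r - conf \<epsilon> r * sin (\<theta> r) / r\<^sup>2"
  shows "(rot_normal \<epsilon> \<theta> has_derivative
     (\<lambda>w. (- (m' * (x \<bullet> w) / r) *\<^sub>R x - (conf \<epsilon> r * sin (\<theta> r) / r) *\<^sub>R w, - sin (\<theta> r) * \<theta>' * (x \<bullet> w) / r))) (at x)"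
proof -
  have r: "r > 0" using x by (simp add: r_def)
  note th = \<theta>[folded r_def]
  have "((\<lambda>s. conf \<epsilon> s * sin (\<theta> s) / s) has_real_derivative m') (at r)"
    unfolding m'_def
    by (rule DERIV_cong[OF DERIV_divide[OF DERIV_mult[OF conf_has_derivative DERIV_fun_sin[OF th]] DERIV_ident]])
      (use r in \<open>simp_all add: field_simps power2_eq_square\<close>)
  from radial_has_derivative[OF this[unfolded r_def] x]
  have 1: "((\<lambda>y. conf \<epsilon> (norm y) * sin (\<theta> (norm y)) / norm y) has_derivative (\<lambda>w. m' * (x \<bullet> w) / r)) (at x)"
    by (simp add: r_def)
  have "((\<lambda>s. cos (\<theta> s)) has_real_derivative (- sin (\<theta> r) * \<theta>')) (at r)"
    by (auto intro!: derivative_eq_intros th)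
  from radial_has_derivative[OF this[unfolded r_def] x]
  have 2: "((\<lambda>y. cos (\<theta> (norm y))) has_derivative (\<lambda>w. - sin (\<theta> r) * \<theta>' * (x \<bullet> w) / r)) (at x)"
    by (simp add: r_def)
  show ?thesis unfolding rot_normal_def[abs_def]
    by (rule has_derivative_eq_rhs[OF has_derivative_Pair[OF has_derivative_scaleR[OF has_derivative_minus[OF 1] has_derivative_ident] 2]])
      (auto simp: r_def algebra_simps)
qed

text \<open>For \<open>\<theta>\<close> tangent to the identity at \<open>0\<close>, the horizontal part is \<open>- x\<close> to first order.\<close>

lemma rot_normal_has_derivative_0:
  assumes \<theta>: "(\<theta> has_real_derivative 1) (at 0)" and \<theta>0: "\<theta> 0 = 0"
  shows "(rot_normal \<epsilon> \<theta> has_derivative (\<lambda>w. (- w, 0))) (at (0 :: real^'n))"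
proof -
  let ?m = "\<lambda>r. conf \<epsilon> r * sin (\<theta> r) / r"
  have "((\<lambda>r. conf \<epsilon> r * sin (\<theta> r)) has_real_derivative 1) (at 0)"
    by (auto intro!: derivative_eq_intros \<theta> simp: \<theta>0)
  then have "(?m \<longlongrightarrow> 1) (at 0)" by (simp add: DERIV_def \<theta>0)
  moreover have n: "filterlim norm (at 0) (at (0::real^'n))"
    by (auto simp: filterlim_at eventually_at_filter tendsto_norm_zero)
  ultimately have "((\<lambda>x :: real^'n. ?m (norm x)) \<longlongrightarrow> 1) (at 0)"
    by (rule filterlim_compose)
  then have "((\<lambda>x :: real^'n. \<bar>?m (norm x) - 1\<bar>) \<longlongrightarrow> 0) (at 0)"
    using LIM_zero tendsto_rabs_zero by blast
  moreover have "norm (- (?m (norm x)) *\<^sub>R x - - x) / norm x = \<bar>?m (norm x) - 1\<bar>" if "x \<noteq> 0" for x :: "real^'n"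
  proof -
    have "- (?m (norm x)) *\<^sub>R x - - x = (1 - ?m (norm x)) *\<^sub>R x" by (simp add: algebra_simps)
    then show ?thesis using that by simp
  qed
  then have "\<forall>\<^sub>F x :: real^'n in at 0. norm (- (?m (norm x)) *\<^sub>R x - - x) / norm x = \<bar>?m (norm x) - 1\<bar>"
    by (simp add: eventually_at_filter)
  ultimately have "((\<lambda>x :: real^'n. norm (- (?m (norm x)) *\<^sub>R x - - x) / norm x) \<longlongrightarrow> 0) (at 0)"
    using tendsto_cong by fastforce
  then have 1: "((\<lambda>x :: real^'n. - (?m (norm x)) *\<^sub>R x) has_derivative (\<lambda>w. - w)) (at 0)"
    by (simp add: has_derivative_at bounded_linear_minus[OF bounded_linear_ident])
  have "((\<lambda>r. cos (\<theta> r)) has_real_derivative 0) (at 0)"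
    by (auto intro!: derivative_eq_intros \<theta> simp: \<theta>0)
  from radial_has_derivative_0[OF this] 1 show ?thesis unfolding rot_normal_def[abs_def]
    by (intro has_derivative_Pair) auto
qed

lemma rot_sheet_normal_derivative:
  assumes "rot_sheet \<epsilon> S N p \<psi> \<theta>" "(rot_normal \<epsilon> \<theta> has_derivative D) (at (fst p))"
  shows "(N has_derivative (\<lambda>v. D (fst v))) (at p within S)"
proof -
  obtain U where U: "p \<in> S" "open U" "p \<in> U" "\<forall>q\<in>S \<inter> U. N q = rot_normal \<epsilon> \<theta> (fst q)"
    using assms(1) by (auto simp: rot_sheet_def)
  have "((\<lambda>q. rot_normal \<epsilon> \<theta> (fst q)) has_derivative (\<lambda>v. D (fst v))) (at p)"
    using has_derivative_compose[OF bounded_linear_imp_has_derivative[OF bounded_linear_fst] assms(2)] .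
  then have "((\<lambda>q. rot_normal \<epsilon> \<theta> (fst q)) has_derivative (\<lambda>v. D (fst v))) (at p within S)"
    by (rule has_derivative_at_withinI)
  moreover have "\<forall>\<^sub>F q in at p within S. rot_normal \<epsilon> \<theta> (fst q) = N q"
    using U unfolding eventually_at_topological by (intro exI[of _ U]) auto
  ultimately show ?thesis
    by (rule has_derivative_transform_eventually) (use U in auto)
qed

lemma rot_sheet_tangent_space:
  assumes "rot_sheet \<epsilon> S N p \<psi> \<theta>" "((\<lambda>x. \<psi> (norm x)) has_derivative D) (at (fst p))"
  shows "tangent_space S p = {v. snd v = D (fst v)}"
  using assms(1) tangent_space_graph[OF _ _ _ _ assms(2), of _ S] unfolding rot_sheet_def by blast

text \<open>In the chart the eigenvectors are the radial tangent vector \<open>(c cos \<theta> e, sin \<theta>)\<close>, with \<open>e\<close> the unit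
  radial vector, and the horizontal vectors \<open>(c b, 0)\<close> for \<open>b\<close> orthogonal to \<open>e\<close>. The Christoffel term changes
  the flat curvature \<open>c sin \<theta> / r\<close> of the latter by \<open>- \<epsilon> r sin \<theta> / 2\<close>, which turns \<open>c\<close> into
  \<open>1 - \<epsilon> r\<^sup>2 / 4\<close>.\<close>

lemma rot_sheet_principal_curvatures:
  fixes S :: "((real^'n) \<times> real) set" and k0 :: 'n
  assumes sh: "rot_sheet \<epsilon> S N p \<psi> \<theta>" and x0: "fst p \<noteq> 0"
    and \<theta>: "(\<theta> has_real_derivative \<theta>') (at (norm (fst p)))"
    and \<psi>: "(\<psi> has_real_derivative tan (\<theta> (norm (fst p))) / conf \<epsilon> (norm (fst p))) (at (norm (fst p)))"
    and cos: "0 < cos (\<theta> (norm (fst p)))" and c: "0 < conf \<epsilon> (norm (fst p))"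
  defines "r \<equiv> norm (fst p)"
  shows "principal_curvatures \<epsilon> S N p (\<lambda>i. if i = k0 then conf \<epsilon> r * cos (\<theta> r) * \<theta>'
     else (1 - \<epsilon> * r\<^sup>2 / 4) / r * sin (\<theta> r))"
proof -
  define x where "x = fst p"
  have xr: "norm x = r" and r: "0 < r" using x0 by (auto simp: x_def r_def)
  have xx: "x \<bullet> x = r * r" using xr by (simp add: dot_square_norm power2_eq_square)
  define C where "C = conf \<epsilon> r"
  define s where "s = sin (\<theta> r)"
  define k where "k = cos (\<theta> r)"
  have sk: "s * s + k * k = 1" using sin_cos_squared_add[of "\<theta> r"] by (simp add: s_def k_def power2_eq_square)
  have C0: "0 < C" and k0': "0 < k" using c cos by (auto simp: C_def k_def r_def)
  have Cr: "C = 1 + \<epsilon> * r * r / 4" by (simp add: C_def conf_def power2_eq_square)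
  have tan: "tan (\<theta> r) = s / k" by (simp add: tan_def s_def k_def)
  define e where "e = (1 / r) *\<^sub>R x"
  have e: "norm e = 1" using xr r by (simp add: e_def)
  have xe: "x = r *\<^sub>R e" using r by (simp add: e_def)
  \<comment> \<open>An orthonormal basis whose member at index \<open>k0\<close> is the radial direction.\<close>
  obtain A where A: "orthogonal_matrix A" "A *v (axis k0 1) = e"
    using orthogonal_matrix_exists_basis[OF e] by blast
  define b where "b i = A *v axis i (1::real)" for i :: 'n
  have bb: "b i \<bullet> b j = (if i = j then 1 else 0)" for i j
  proof -
    have "b i \<bullet> b j = axis i (1::real) \<bullet> (axis j (1::real) :: real^'n)"
      using orthogonal_transformation_matrix[of "(*v) A"] A(1) 
      by (simp add: b_def orthogonal_transformation_def matrix_of_matrix_vector_mul)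
    then show ?thesis by (simp add: inner_axis_axis)
  qed
  have be: "b k0 = e" by (simp add: b_def A)
  have D\<psi>: "((\<lambda>y. \<psi> (norm y)) has_derivative (\<lambda>w. s / k / C * (x \<bullet> w) / r)) (at (fst p))"
    using radial_has_derivative[OF \<psi> x0] by (simp add: r_def[symmetric] tan C_def x_def)
  have ts: "tangent_space S p = {v. snd v = s / k / C * (x \<bullet> fst v) / r}"
    using rot_sheet_tangent_space[OF sh D\<psi>] .
  define m' where "m' = (\<epsilon> * r / 2 * s + C * (k * \<theta>')) / r - C * s / r\<^sup>2"
  have DN: "(N has_derivative (\<lambda>v. (- (m' * (x \<bullet> fst v) / r) *\<^sub>R x - (C * s / r) *\<^sub>R fst v, - s * \<theta>' * (x \<bullet> fst v) / r))) (at p within S)"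
    using rot_sheet_normal_derivative[OF sh rot_normal_has_derivative[OF x0 \<theta>]]
    by (simp add: r_def[symmetric] m'_def C_def s_def k_def x_def)
  have Np: "N p = (- (C * s / r) *\<^sub>R x, k)"
    using sh by (auto simp: rot_sheet_def rot_normal_def x_def C_def s_def k_def r_def)
  \<comment> \<open>The principal directions, orthonormal for the product metric.\<close>
  define E where "E i = (if i = k0 then ((C * k) *\<^sub>R e, s) else (C *\<^sub>R b i, 0))" for i
  have ebk: "e \<bullet> b i = 0" if "i \<noteq> k0" for i using bb[of k0 i] that by (simp add: be)
  have ee: "e \<bullet> e = 1" using e by (simp add: dot_square_norm)
  have Ets: "E i \<in> tangent_space S p" for i
    using r C0 k0' ebk[of i] by (auto simp: ts E_def xe ee)
  have Qp: "QR_metric \<epsilon> p X Y = fst X \<bullet> fst Y / (C * C) + snd X * snd Y" for X Y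
    by (simp add: QR_metric_def Q_metric_conf C_def r_def power2_eq_square)
  have orth: "QR_metric \<epsilon> p (E i) (E j) = (if i = j then 1 else 0)" for i j
    using C0 sk bb[of i j] ebk[of i] ebk[of j] by (auto simp: Qp E_def ee inner_commute algebra_simps)
  have so: "shape_operator \<epsilon> S N p X = 
     ((m' * (x \<bullet> fst X) / r) *\<^sub>R x + (s * (1 - \<epsilon> * r * r / 4) / r) *\<^sub>R fst X, s * \<theta>' * (x \<bullet> fst X) / r)"
    if X: "X \<in> tangent_space S p" for X
  proof -
    have p: "fst p \<in> Q_space \<epsilon>" using c by (simp add: Q_space_iff)
    have "(x \<bullet> fst X) *\<^sub>R fst (N p) + (x \<bullet> fst (N p)) *\<^sub>R fst X - (fst X \<bullet> fst (N p)) *\<^sub>R x = (- (C * s * r)) *\<^sub>R fst X"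
      using r by (simp add: Np xx inner_commute mult_ac)
    then have ch: "christoffel (QR_metric \<epsilon>) p X (N p) = ((\<epsilon> / 2 * s * r) *\<^sub>R fst X, 0)"
      unfolding christoffel_QR[OF p] using C0 by (simp add: x_def[symmetric] xr C_def[symmetric])
    have *: "C * s / r - \<epsilon> / 2 * s * r = s * (1 - \<epsilon> * r * r / 4) / r"
      using r by (simp add: Cr field_simps)
    show ?thesis unfolding shape_operator_def frechet_derivative_tangent[OF DN X] ch *[symmetric]
      by (simp add: scaleR_left_diff_distrib algebra_simps)
  qed
  have "shape_operator \<epsilon> S N p (E i) = (if i = k0 then C * k * \<theta>' else (1 - \<epsilon> * r\<^sup>2 / 4) / r * s) *\<^sub>R E i" for i
  proof (cases "i = k0")
    case True
    have "m' * r + s * (1 - \<epsilon> * r * r / 4) / r = C * k * \<theta>'"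
      unfolding m'_def Cr using r by (simp add: field_simps power2_eq_square)
    then have "(m' * r + s * (1 - \<epsilon> * r * r / 4) / r) * (C * k) = C * k * \<theta>' * (C * k)" by simp
    then have "(m' * (r * (C * k)) / r) *\<^sub>R r *\<^sub>R e + (s * (1 - \<epsilon> * r * r / 4) / r) *\<^sub>R (C * k) *\<^sub>R e = (C * k * \<theta>' * (C * k)) *\<^sub>R e"
    proof -
      assume *: "(m' * r + s * (1 - \<epsilon> * r * r / 4) / r) * (C * k) = C * k * \<theta>' * (C * k)"
      have "(m' * (r * (C * k)) / r) *\<^sub>R r *\<^sub>R e + (s * (1 - \<epsilon> * r * r / 4) / r) *\<^sub>R (C * k) *\<^sub>R e
        = (m' * (r * (C * k)) / r * r + s * (1 - \<epsilon> * r * r / 4) / r * (C * k)) *\<^sub>R e"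
        by (simp only: scaleR_add_left scaleR_scaleR)
      also have "m' * (r * (C * k)) / r * r + s * (1 - \<epsilon> * r * r / 4) / r * (C * k)
        = (m' * r + s * (1 - \<epsilon> * r * r / 4) / r) * (C * k)"
        using r by (simp add: distrib_right)
      finally show ?thesis unfolding * .
    qed
    then show ?thesis unfolding so[OF Ets] using True r
      by (simp add: E_def xe ee mult_ac)
  next
    case False
    then show ?thesis unfolding so[OF Ets] using r ebk[of i]
      by (simp add: E_def xe power2_eq_square mult_ac)
  qed
  then show ?thesis unfolding principal_curvatures_def
    using Ets orth DN by (auto simp: C_def s_def k_def intro!: differentiableI exI[of _ E])
qed

text \<open>At the vertex of a cap the Christoffel symbols vanish, so the shape operator is minus the derivative of
  the normal.\<close>

lemma rot_sheet_principal_curvatures_0: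
  fixes S :: "((real^'n) \<times> real) set"
  assumes sh: "rot_sheet \<epsilon> S N p \<psi> \<theta>" and x0: "fst p = 0"
    and \<theta>: "(\<theta> has_real_derivative 1) (at 0)" and \<theta>0: "\<theta> 0 = 0"
    and \<psi>: "(\<psi> has_real_derivative 0) (at 0)"
  shows "principal_curvatures \<epsilon> S N p (\<lambda>i. 1)"
proof -
  have ts: "tangent_space S p = {v. snd v = 0}"
    using rot_sheet_tangent_space[OF sh, of "\<lambda>_. 0"] radial_has_derivative_0[OF \<psi>] x0 by auto
  have DN: "(N has_derivative (\<lambda>v. (- fst v, 0))) (at p within S)"
    using rot_sheet_normal_derivative[OF sh, of "\<lambda>w. (- w, 0)"] rot_normal_has_derivative_0[OF \<theta> \<theta>0] x0 by auto
  have Np: "N p = (0, 1)"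
    using sh by (auto simp: rot_sheet_def rot_normal_def x0 \<theta>0)
  define E where "E i = (axis i (1::real) :: real^'n, 0::real)" for i
  have p: "fst p \<in> Q_space \<epsilon>" by (simp add: Q_space_iff x0)
  have Ets: "E i \<in> tangent_space S p" for i by (simp add: ts E_def)
  have "shape_operator \<epsilon> S N p (E i) = E i" for i
    unfolding shape_operator_def frechet_derivative_tangent[OF DN Ets] christoffel_QR[OF p]
    by (simp add: x0 Np E_def)
  moreover have "QR_metric \<epsilon> p (E i) (E j) = (if i = j then 1 else 0)" for i j
    by (simp add: QR_metric_def Q_metric_conf x0 E_def inner_axis_axis)
  ultimately show ?thesis unfolding principal_curvatures_def
    using Ets DN by (auto intro!: differentiableI exI[of _ E])
qed

lemma rot_sheet_unit_normal:
  fixes S :: "((real^'n) \<times> real) set"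
  assumes sh: "rot_sheet \<epsilon> S N p \<psi> \<theta>"
    and \<psi>: "(\<psi> has_real_derivative tan (\<theta> (norm (fst p))) / conf \<epsilon> (norm (fst p))) (at (norm (fst p)))"
    and cos: "0 < cos (\<theta> (norm (fst p)))" and c: "0 < conf \<epsilon> (norm (fst p))"
    and 0: "fst p = 0 \<Longrightarrow> \<theta> 0 = 0"
  shows "QR_metric \<epsilon> p (N p) (N p) = 1"
    and "v \<in> tangent_space S p \<Longrightarrow> QR_metric \<epsilon> p (N p) v = 0"
    and "angle_function \<epsilon> N p = cos (\<theta> (norm (fst p)))"
proof -
  have Np: "N p = rot_normal \<epsilon> \<theta> (fst p)" using sh by (auto simp: rot_sheet_def)
  show "angle_function \<epsilon> N p = cos (\<theta> (norm (fst p)))"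
    by (simp add: angle_function_def Np rot_normal_def QR_metric_def Q_metric_conf)
  show "QR_metric \<epsilon> p (N p) (N p) = 1"
  proof (cases "fst p = 0")
    case True
    then show ?thesis using 0 by (simp add: Np rot_normal_def QR_metric_def Q_metric_conf)
  next
    case False
    then show ?thesis using c sin_cos_squared_add[of "\<theta> (norm (fst p))"]
      by (simp add: Np rot_normal_def QR_metric_def Q_metric_conf dot_square_norm power2_eq_square)
  qed
  assume v: "v \<in> tangent_space S p"
  show "QR_metric \<epsilon> p (N p) v = 0"
  proof (cases "fst p = 0")
    case True
    then have "(\<psi> has_real_derivative 0) (at 0)" using \<psi> 0 by simp
    then have "tangent_space S p = {v. snd v = 0}"
      using rot_sheet_tangent_space[OF sh, of "\<lambda>_. 0"] radial_has_derivative_0 True by auto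
    then show ?thesis using v True 0 by (simp add: Np rot_normal_def QR_metric_def Q_metric_conf)
  next
    case False
    have "snd v = tan (\<theta> (norm (fst p))) / conf \<epsilon> (norm (fst p)) * (fst p \<bullet> fst v) / norm (fst p)"
      using rot_sheet_tangent_space[OF sh radial_has_derivative[OF \<psi> False]] v by auto
    then show ?thesis using False c cos
      by (simp add: Np rot_normal_def QR_metric_def Q_metric_conf tan_def power2_eq_square)
  qed
qed

section \<open>Regularity of rotational graphs\<close>

lemma C1_onI:
  assumes "open U" "\<And>x. x \<in> U \<Longrightarrow> (f has_derivative blinfun_apply (f' x)) (at x)" "continuous_on U f'"
  shows "C1_on U f"
  using assms by (auto simp: C1_on_def)

lemma C1_on_subset: "C1_on U f \<Longrightarrow> open V \<Longrightarrow> V \<subseteq> U \<Longrightarrow> C1_on V f"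
  unfolding C1_on_def using continuous_on_subset by blast

lemma C1_on_continuous: "C1_on U f \<Longrightarrow> continuous_on U f"
  unfolding C1_on_def
  by (meson continuous_at_imp_continuous_on has_derivative_continuous)

lemma C2_on_imp_C1_on: "C2_on U f \<Longrightarrow> C1_on U f"
  using C1_on_continuous unfolding C2_on_def C1_on_def by metis

lemma C2_on_subset: "C2_on U f \<Longrightarrow> open V \<Longrightarrow> V \<subseteq> U \<Longrightarrow> C2_on V f"
  unfolding C2_on_def using C1_on_subset by (metis subsetD)

lemma C1_on_bounded_linear: 
  assumes "bounded_linear L" "open U" shows "C1_on U L"
  by (rule C1_onI[of _ _ "\<lambda>_. Blinfun L"])
    (use assms in \<open>auto simp: bounded_linear_Blinfun_apply bounded_linear_imp_has_derivative\<close>)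

lemma C1_on_diff: 
  assumes "C1_on U f" "C1_on U g" shows "C1_on U (\<lambda>x. f x - g x)"
proof -
  obtain f' g' where *: "open U" "\<And>x. x \<in> U \<Longrightarrow> (f has_derivative blinfun_apply (f' x)) (at x)" "continuous_on U f'"
    "\<And>x. x \<in> U \<Longrightarrow> (g has_derivative blinfun_apply (g' x)) (at x)" "continuous_on U g'"
    using assms by (auto simp: C1_on_def)
  show ?thesis
    by (rule C1_onI[of _ _ "\<lambda>x. f' x - g' x"])
      (use * in \<open>auto intro!: derivative_eq_intros continuous_intros simp: blinfun.diff_left\<close>)
qed

lemma C1_on_scaleR: 
  fixes f :: "'a::real_normed_vector \<Rightarrow> real" and g :: "'a \<Rightarrow> 'b::real_normed_vector"
  assumes "C1_on U f" "C1_on U g" shows "C1_on U (\<lambda>x. f x *\<^sub>R g x)"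
proof -
  obtain f' g' where *: "open U" "\<And>x. x \<in> U \<Longrightarrow> (f has_derivative blinfun_apply (f' x)) (at x)" "continuous_on U f'"
    "\<And>x. x \<in> U \<Longrightarrow> (g has_derivative blinfun_apply (g' x)) (at x)" "continuous_on U g'"
    using assms by (auto simp: C1_on_def)
  have c: "continuous_on U f" "continuous_on U g" using assms by (auto intro: C1_on_continuous)
  have e: "(\<lambda>w. f x *\<^sub>R g' x w + f' x w *\<^sub>R g x) = blinfun_apply (f x *\<^sub>R g' x + (blinfun_scaleR_left (g x) o\<^sub>L f' x))" for x
    by (auto simp: blinfun.add_left blinfun.scaleR_left)
  show ?thesis
  proof (rule C1_onI[of _ _ "\<lambda>x. f x *\<^sub>R g' x + (blinfun_scaleR_left (g x) o\<^sub>L f' x)"])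
    fix x assume "x \<in> U"
    show "((\<lambda>x. f x *\<^sub>R g x) has_derivative blinfun_apply (f x *\<^sub>R g' x + (blinfun_scaleR_left (g x) o\<^sub>L f' x))) (at x)"
      using has_derivative_scaleR[OF *(2)[OF \<open>x \<in> U\<close>] *(4)[OF \<open>x \<in> U\<close>]] by (simp only: e)
  next
    show "continuous_on U (\<lambda>x. f x *\<^sub>R g' x + (blinfun_scaleR_left (g x) o\<^sub>L f' x))"
      by (intro continuous_intros c * bounded_linear.continuous_on[OF bounded_linear_blinfun_scaleR_left])
  qed fact
qed

lemma C1_on_linear_compose:
  assumes "C1_on U f" "bounded_linear L" "bounded_linear M"
  shows "C1_on (M -` U) (\<lambda>x. L (f (M x)))"
proof -
  obtain f' where *: "open U" "\<And>x. x \<in> U \<Longrightarrow> (f has_derivative blinfun_apply (f' x)) (at x)" "continuous_on U f'"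
    using assms by (auto simp: C1_on_def)
  have M: "continuous_on A M" for A using assms(3) by (simp add: linear_continuous_on)
  show ?thesis
  proof (rule C1_onI[of _ _ "\<lambda>x. Blinfun L o\<^sub>L f' (M x) o\<^sub>L Blinfun M"])
    show "open (M -` U)" using * M by (metis open_vimage)
    show "continuous_on (M -` U) (\<lambda>x. Blinfun L o\<^sub>L f' (M x) o\<^sub>L Blinfun M)"
      by (intro continuous_intros continuous_on_compose2[OF *(3) M]) auto
    fix x assume "x \<in> M -` U"
    then have "((\<lambda>x. L (f (M x))) has_derivative (\<lambda>w. L (f' (M x) (M w)))) (at x)"
      by (intro bounded_linear.has_derivative[OF assms(2)] has_derivative_compose[OF bounded_linear_imp_has_derivative[OF assms(3)] *(2)]) auto
    then show "((\<lambda>x. L (f (M x))) has_derivative blinfun_apply (Blinfun L o\<^sub>L f' (M x) o\<^sub>L Blinfun M)) (at x)"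
      by (rule has_derivative_eq_rhs) (auto simp: bounded_linear_Blinfun_apply assms)
  qed
qed

lemma C1_on_graph_function:
  fixes u :: "'a::real_normed_vector \<Rightarrow> real"
  assumes "C1_on D u" shows "C1_on (fst -` D) (\<lambda>q. snd q - u (fst q))"
proof -
  have "open (fst -` D :: ('a \<times> real) set)" 
    using assms by (auto simp: C1_on_def intro!: open_vimage_fst)
  then show ?thesis
    using C1_on_diff[OF C1_on_bounded_linear[OF bounded_linear_snd] C1_on_linear_compose[OF assms bounded_linear_ident bounded_linear_fst]]
    by simp
qed

lemma C2_on_graph_function:
  fixes u :: "'a::real_normed_vector \<Rightarrow> real"
  assumes "C2_on D u" shows "C2_on (fst -` D) (\<lambda>q. snd q - u (fst q))"
proof -
  obtain u' where u: "open D" "\<And>x. x \<in> D \<Longrightarrow> (u has_derivative blinfun_apply (u' x)) (at x)" "C1_on D u'"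
    using assms by (auto simp: C2_on_def)
  let ?F' = "\<lambda>q :: 'a \<times> real. snd_blinfun - (u' (fst q) o\<^sub>L fst_blinfun)"
  have o: "open (fst -` D :: ('a \<times> real) set)" using u by (auto intro!: open_vimage_fst)
  have const: "C1_on (fst -` D :: ('a \<times> real) set) (\<lambda>_. snd_blinfun :: ('a \<times> real) \<Rightarrow>\<^sub>L real)"
  proof (rule C1_onI[where f' = "\<lambda>_. 0", OF o])
    show "((\<lambda>_. snd_blinfun :: ('a \<times> real) \<Rightarrow>\<^sub>L real) has_derivative blinfun_apply 0) (at q)" for q :: "'a \<times> real"
      by (rule has_derivative_eq_rhs[OF has_derivative_const]) auto
  qed auto
  have "C1_on (fst -` D) ?F'"
    by (intro C1_on_diff const C1_on_linear_compose[OF u(3) _ bounded_linear_fst] 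
        bounded_bilinear.bounded_linear_left[OF bounded_bilinear_blinfun_compose])
  moreover have "((\<lambda>q. snd q - u (fst q)) has_derivative blinfun_apply (?F' q)) (at q)" if "q \<in> fst -` D" for q
  proof -
    have "((\<lambda>q. u (fst q)) has_derivative (\<lambda>v. u' (fst q) (fst v))) (at q)"
      by (rule has_derivative_compose[OF bounded_linear_imp_has_derivative[OF bounded_linear_fst] u(2)]) (use that in auto)
    from has_derivative_diff[OF bounded_linear_imp_has_derivative[OF bounded_linear_snd] this]
    show ?thesis by (rule has_derivative_eq_rhs) (auto simp: blinfun.diff_left)
  qed
  ultimately show ?thesis
    unfolding C2_on_def by (intro conjI exI[of _ ?F'] ballI o)
qed

text \<open>The graph is the zero set of \<open>snd q - u (fst q)\<close>, whose derivative is nonzero in the direction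
  \<open>(0, 1)\<close>.\<close>

lemma hypersurface_graph:
  fixes u :: "'a::real_normed_vector \<Rightarrow> real"
  assumes D: "open D" "fst p \<in> D" and U: "open U" "p \<in> U" "p \<in> S" and S: "\<And>q. q \<in> U \<Longrightarrow> q \<in> S \<longleftrightarrow> snd q = u (fst q)"
  shows "C1_on D u \<Longrightarrow> hypersurface_at C1_on S p" and "C2_on D u \<Longrightarrow> hypersurface_at C2_on S p"
proof -
  let ?V = "U \<inter> fst -` D" and ?F = "\<lambda>q. snd q - u (fst q)"
  have V: "open ?V" "p \<in> ?V" using assms by (auto intro!: open_Int open_vimage_fst)
  have Z: "S \<inter> ?V = {q \<in> ?V. ?F q = 0}" using S by auto
  have nz: "frechet_derivative ?F (at q) \<noteq> (\<lambda>_. 0)" if "C1_on D u" "q \<in> ?V" for q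
  proof
    assume 0: "frechet_derivative ?F (at q) = (\<lambda>_. 0)"
    from that obtain u' where u: "(u has_derivative blinfun_apply (u' (fst q))) (at (fst q))"
      by (auto simp: C1_on_def)
    have "((\<lambda>q. u (fst q)) has_derivative (\<lambda>v. u' (fst q) (fst v))) (at q)"
      by (rule has_derivative_compose[OF bounded_linear_imp_has_derivative[OF bounded_linear_fst] u])
    from has_derivative_diff[OF bounded_linear_imp_has_derivative[OF bounded_linear_snd] this]
    have "frechet_derivative ?F (at q) = (\<lambda>v. snd v - u' (fst q) (fst v))"
      by (rule frechet_derivative_at[symmetric])
    with 0 have "(0::real) = snd (0::'a, 1) - u' (fst q) (fst (0::'a, 1::real))" by metis
    then show False by simp
  qed
  show "hypersurface_at C1_on S p" if "C1_on D u"
    unfolding hypersurface_at_def using V Z nz[OF that] U C1_on_subset[OF C1_on_graph_function[OF that] V(1)] by blast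
  show "hypersurface_at C2_on S p" if "C2_on D u"
    unfolding hypersurface_at_def using V Z nz[OF C2_on_imp_C1_on[OF that]] U C2_on_subset[OF C2_on_graph_function[OF that] V(1)] by blast
qed

lemma open_radial: "open J \<Longrightarrow> open {x::'a::real_normed_vector. norm x \<in> J}"
  using open_vimage[of J norm] by (simp add: vimage_def continuous_on_norm_id)

lemma radial_derivative_blinfun:
  fixes x :: "'a::real_inner"
  assumes "(f has_real_derivative f') (at (norm x))" "x \<noteq> 0"
  shows "((\<lambda>y. f (norm y)) has_derivative blinfun_apply ((f' / norm x) *\<^sub>R blinfun_inner_right x)) (at x)"
  using radial_has_derivative[OF assms] by (rule has_derivative_eq_rhs) (auto simp: blinfun.scaleR_left)

lemma C1_on_radial:
  fixes f :: "real \<Rightarrow> real"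
  assumes J: "open J" and f: "\<And>r. r \<in> J \<Longrightarrow> r \<noteq> 0 \<Longrightarrow> (f has_real_derivative f' r) (at r)" and c: "continuous_on (J - {0}) f'"
  shows "C1_on ({x::'a::real_inner. norm x \<in> J} - {0}) (\<lambda>x. f (norm x))"
proof (rule C1_onI[of _ _ "\<lambda>x. (f' (norm x) / norm x) *\<^sub>R blinfun_inner_right x"])
  show "open ({x::'a. norm x \<in> J} - {0})" using open_radial[OF J] by (intro open_Diff) auto
  show "continuous_on ({x::'a. norm x \<in> J} - {0}) (\<lambda>x. (f' (norm x) / norm x) *\<^sub>R blinfun_inner_right x)"
    by (intro continuous_intros continuous_on_compose2[OF c] bounded_linear.continuous_on[OF bounded_linear_blinfun_inner_right]) auto
  fix x :: 'a assume "x \<in> {x::'a. norm x \<in> J} - {0}"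
  then show "((\<lambda>x. f (norm x)) has_derivative blinfun_apply ((f' (norm x) / norm x) *\<^sub>R blinfun_inner_right x)) (at x)"
    by (intro radial_derivative_blinfun f) auto
qed

lemma C2_on_radial:
  fixes f :: "real \<Rightarrow> real"
  assumes J: "open J" and f: "\<And>r. r \<in> J \<Longrightarrow> r \<noteq> 0 \<Longrightarrow> (f has_real_derivative f' r) (at r)"
    and f': "\<And>r. r \<in> J \<Longrightarrow> r \<noteq> 0 \<Longrightarrow> (f' has_real_derivative f'' r) (at r)" and c: "continuous_on (J - {0}) f''"
  shows "C2_on ({x::'a::real_inner. norm x \<in> J} - {0}) (\<lambda>x. f (norm x))"
proof -
  have cf': "continuous_on (J - {0}) f'"
    by (rule continuous_at_imp_continuous_on) (use f' DERIV_isCont in blast)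
  have "C1_on ({x::'a. norm x \<in> J} - {0}) (\<lambda>x. f' (norm x) / norm x)"
  proof (rule C1_on_radial[OF J, of "\<lambda>r. f' r / r" "\<lambda>r. (f'' r * r - f' r) / (r * r)"])
    show "((\<lambda>r. f' r / r) has_real_derivative (f'' r * r - f' r) / (r * r)) (at r)" if "r \<in> J" "r \<noteq> 0" for r
      using DERIV_divide[OF f'[OF that] DERIV_ident that(2)] by simp
    show "continuous_on (J - {0}) (\<lambda>r. (f'' r * r - f' r) / (r * r))"
      by (intro continuous_intros c cf') auto
  qed
  moreover have o: "open ({x::'a. norm x \<in> J} - {0})" using open_radial[OF J] by (intro open_Diff) auto
  ultimately have "C1_on ({x::'a. norm x \<in> J} - {0}) (\<lambda>x. (f' (norm x) / norm x) *\<^sub>R blinfun_inner_right x)"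
    by (intro C1_on_scaleR C1_on_bounded_linear[OF bounded_linear_blinfun_inner_right])
  then show ?thesis
    unfolding C2_on_def using o
    by (intro conjI exI[of _ "\<lambda>x. (f' (norm x) / norm x) *\<^sub>R blinfun_inner_right x"] ballI radial_derivative_blinfun f) auto
qed

lemma filterlim_norm_at_0: "filterlim norm (at 0) (at (0::'a::real_normed_vector))"
  by (auto simp: filterlim_at eventually_at_filter tendsto_norm_zero)

text \<open>The gradient is \<open>q(norm x) x\<close> with \<open>q(r) = f'(r) / r\<close>. Its derivative differs from \<open>q(norm x)\<close> times the
  identity by a term of size \<open>\<bar>f'' - q\<bar>\<close>, and both \<open>q\<close> and \<open>f''\<close> tend to \<open>f'' 0\<close> at the origin, the
  former because \<open>f' 0 = 0\<close>.\<close>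

lemma C2_on_radial_even:
  fixes f :: "real \<Rightarrow> real"
  assumes b: "0 < b" and f: "\<And>r. \<bar>r\<bar> < b \<Longrightarrow> (f has_real_derivative f' r) (at r)"
    and f': "\<And>r. \<bar>r\<bar> < b \<Longrightarrow> (f' has_real_derivative f'' r) (at r)"
    and c: "continuous_on {-b<..<b} f''" and 0: "f' 0 = 0"
  shows "C2_on {x::'a::real_inner. norm x < b} (\<lambda>x. f (norm x))"
proof -
  let ?D = "{x::'a. norm x < b}"
  define q where "q r = f' r / r" for r
  define B :: "'a \<Rightarrow>\<^sub>L ('a \<Rightarrow>\<^sub>L real)" where "B = Blinfun blinfun_inner_right"
  define P where "P x = blinfun_scaleR_left (blinfun_inner_right x) o\<^sub>L blinfun_inner_right x" for x :: 'a
  define J where "J x = (if x = 0 then f'' 0 *\<^sub>R B else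
     q (norm x) *\<^sub>R B + ((f'' (norm x) - q (norm x)) / (norm x)\<^sup>2) *\<^sub>R P x)" for x :: 'a
  have B: "blinfun_apply B = blinfun_inner_right"
    by (simp add: B_def bounded_linear_Blinfun_apply bounded_linear_blinfun_inner_right)
  let ?G = "\<lambda>x::'a. q (norm x) *\<^sub>R blinfun_inner_right x"
  have nb: "- b < norm x" for x :: 'a using b norm_ge_zero[of x] by linarith
  have D: "?D = {x. norm x \<in> {-b<..<b}}" by (auto simp: nb)
  have oD: "open ?D" unfolding D by (rule open_radial) simp
  have df: "((\<lambda>y. f (norm y)) has_derivative blinfun_apply (?G x)) (at x)" if "x \<in> ?D" for x
  proof (cases "x = 0")
    case True
    have "blinfun_apply (?G (0::'a)) = (\<lambda>w. 0)" by (auto simp: blinfun.scaleR_left)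
    then show ?thesis using True radial_has_derivative_0[of f] f[of 0] 0 b by simp
  next
    case False
    then show ?thesis using radial_derivative_blinfun[of f "f' (norm x)" x] f[of "norm x"] that by (auto simp: q_def)
  qed
  have q0: "(q \<longlongrightarrow> f'' 0) (at 0)"
    using f'[of 0] b unfolding q_def DERIV_def by (simp add: 0)
  have qn: "((\<lambda>x::'a. q (norm x)) \<longlongrightarrow> f'' 0) (at 0)"
    by (rule filterlim_compose[OF q0 filterlim_norm_at_0])
  have dG: "(?G has_derivative blinfun_apply (J x)) (at x)" if "x \<in> ?D" for x
  proof (cases "x = 0")
    case True
    have bd: "norm (blinfun_inner_right h :: 'a \<Rightarrow>\<^sub>L real) \<le> norm h" for h :: 'a
      by (rule norm_blinfun_bound) (auto simp: Cauchy_Schwarz_ineq2)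
    have "((\<lambda>h. norm (?G h - f'' 0 *\<^sub>R blinfun_inner_right h) / norm h) \<longlongrightarrow> 0) (at 0)"
    proof (rule Lim_null_comparison)
      show "((\<lambda>h::'a. \<bar>q (norm h) - f'' 0\<bar>) \<longlongrightarrow> 0) (at 0)"
        using qn LIM_zero tendsto_rabs_zero by blast
      have "norm (norm (?G h - f'' 0 *\<^sub>R blinfun_inner_right h) / norm h) \<le> \<bar>q (norm h) - f'' 0\<bar>" for h
              proof -
        have "?G h - f'' 0 *\<^sub>R blinfun_inner_right h = (q (norm h) - f'' 0) *\<^sub>R blinfun_inner_right h"
          by (rule scaleR_left_diff_distrib[symmetric])
        then have "norm (?G h - f'' 0 *\<^sub>R blinfun_inner_right h) \<le> \<bar>q (norm h) - f'' 0\<bar> * norm h"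
          using mult_left_mono[OF bd[of h], of "\<bar>q (norm h) - f'' 0\<bar>"] by simp
        then show ?thesis by (cases "h = 0") (simp_all add: divide_le_eq)
      qed
      then show "\<forall>\<^sub>F h in at 0. norm (norm (?G h - f'' 0 *\<^sub>R blinfun_inner_right h) / norm h) \<le> \<bar>q (norm h) - f'' 0\<bar>"
        by simp
    qed
    moreover have "blinfun_apply (J 0) = (\<lambda>h. f'' 0 *\<^sub>R blinfun_inner_right h)"
      by (auto simp: J_def B blinfun.scaleR_left)
    moreover have "bounded_linear (\<lambda>h::'a. f'' 0 *\<^sub>R blinfun_inner_right h :: 'a \<Rightarrow>\<^sub>L real)"
      by (intro bounded_linear_intros)
    moreover have "blinfun_inner_right (0::'a) = 0" by (rule blinfun_eqI) simp
    ultimately show ?thesis unfolding True has_derivative_at by simp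
  next
    case False
    have n: "\<bar>norm x\<bar> < b" using that by simp
    have "(q has_real_derivative (f'' (norm x) * norm x - f' (norm x) * 1) / (norm x * norm x)) (at (norm x))"
      unfolding q_def[abs_def] by (rule DERIV_divide[OF f'[OF n] DERIV_ident]) (use False in simp)
    from has_derivative_scaleR[OF radial_derivative_blinfun[OF this False] bounded_linear_imp_has_derivative[OF bounded_linear_blinfun_inner_right]]
    show ?thesis
    proof (rule has_derivative_eq_rhs)
      have *: "(f'' (norm x) * norm x - f' (norm x) * 1) / (norm x * norm x) / norm x = (f'' (norm x) - q (norm x)) / (norm x)\<^sup>2"
        using False by (simp add: q_def field_simps power2_eq_square)
      show "(\<lambda>h. q (norm x) *\<^sub>R blinfun_inner_right h +
        blinfun_apply (((f'' (norm x) * norm x - f' (norm x) * 1) / (norm x * norm x) / norm x) *\<^sub>R blinfun_inner_right x) h *\<^sub>R blinfun_inner_right x) = blinfun_apply (J x)"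
        unfolding * using False by (auto simp: J_def P_def B blinfun.add_left blinfun.scaleR_left fun_eq_iff)
    qed
  qed
  have cf': "continuous_on {-b<..<b} f'"
  proof (intro continuous_at_imp_continuous_on ballI)
    fix r assume "r \<in> {-b<..<b}"
    then have "\<bar>r\<bar> < b" by auto
    then show "isCont f' r" using DERIV_isCont[OF f'] by simp
  qed
  have cP: "continuous_on A P" for A
    unfolding P_def
    by (intro continuous_intros bounded_linear.continuous_on[OF bounded_linear_blinfun_scaleR_left]
        bounded_linear.continuous_on[OF bounded_linear_blinfun_inner_right])
  have n1: "continuous_on (?D - {0}) (\<lambda>x. q (norm x))" "continuous_on (?D - {0}) (\<lambda>x. f'' (norm x))"
    unfolding q_def by (intro continuous_intros continuous_on_compose2[OF cf'] continuous_on_compose2[OF c]; auto simp: nb)+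
  have cJ: "continuous_on ?D J"
    unfolding continuous_on_eq_continuous_at[OF oD]
  proof
    fix x assume x: "x \<in> ?D"
    show "isCont J x"
    proof (cases "x = 0")
      case False
      have "continuous_on (?D - {0}) (\<lambda>x. q (norm x) *\<^sub>R B + ((f'' (norm x) - q (norm x)) / (norm x)\<^sup>2) *\<^sub>R P x)"
        by (intro continuous_intros n1 cP) auto
      then have "continuous_on (?D - {0}) J" by (rule continuous_on_eq) (simp add: J_def)
      then show ?thesis using x False oD continuous_on_eq_continuous_at[of "?D - {0}" J] by auto
    next
      case True
      have "bounded_bilinear (\<lambda>(x::'a) (y::'a). blinfun_scaleR_left (blinfun_inner_right x :: 'a \<Rightarrow>\<^sub>L real) o\<^sub>L (blinfun_inner_right y :: 'a \<Rightarrow>\<^sub>L real))"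
        by (rule bounded_bilinear.comp[OF bounded_bilinear_blinfun_compose
          bounded_linear_compose[OF bounded_linear_blinfun_scaleR_left bounded_linear_blinfun_inner_right] bounded_linear_blinfun_inner_right])
      from bounded_bilinear.bounded[OF this] obtain K where "\<And>x y. norm (blinfun_scaleR_left (blinfun_inner_right x :: 'a \<Rightarrow>\<^sub>L real) o\<^sub>L (blinfun_inner_right y :: 'a \<Rightarrow>\<^sub>L real)) \<le> norm x * norm y * K"
        by metis
      then have K: "norm (P x) \<le> norm x * norm x * K" for x by (simp add: P_def)
      have "isCont f'' 0" using c b by (auto simp: continuous_on_eq_continuous_at)
      then have "(f'' \<longlongrightarrow> f'' 0) (at 0)" by (simp add: isCont_def)
      then have f''n: "((\<lambda>x::'a. f'' (norm x)) \<longlongrightarrow> f'' 0) (at 0)"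
        by (rule filterlim_compose[OF _ filterlim_norm_at_0])
      have "((\<lambda>x::'a. ((f'' (norm x) - q (norm x)) / (norm x)\<^sup>2) *\<^sub>R P x) \<longlongrightarrow> 0) (at 0)"
      proof (rule Lim_null_comparison)
        show "((\<lambda>x::'a. \<bar>f'' (norm x) - q (norm x)\<bar> * K) \<longlongrightarrow> 0) (at 0)"
          using tendsto_mult_left_zero[OF tendsto_rabs_zero[OF tendsto_diff[OF f''n qn, simplified]]] by simp
        have "norm (((f'' (norm x) - q (norm x)) / (norm x)\<^sup>2) *\<^sub>R P x) \<le> \<bar>f'' (norm x) - q (norm x)\<bar> * K" if "x \<noteq> 0" for x :: 'a
        proof -
          have "norm (((f'' (norm x) - q (norm x)) / (norm x)\<^sup>2) *\<^sub>R P x) \<le> \<bar>f'' (norm x) - q (norm x)\<bar> / (norm x)\<^sup>2 * (norm x * norm x * K)"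
            using mult_left_mono[OF K[of x], of "\<bar>f'' (norm x) - q (norm x)\<bar> / (norm x)\<^sup>2"] by simp
          then show ?thesis using that by (simp add: power2_eq_square)
        qed
        then show "\<forall>\<^sub>F x::'a in at 0. norm (((f'' (norm x) - q (norm x)) / (norm x)\<^sup>2) *\<^sub>R P x) \<le> \<bar>f'' (norm x) - q (norm x)\<bar> * K"
          by (simp add: eventually_at_filter)
      qed
      from tendsto_add[OF tendsto_scaleR[OF qn tendsto_const[of B]] this]
      have "((\<lambda>x. q (norm x) *\<^sub>R B + ((f'' (norm x) - q (norm x)) / (norm x)\<^sup>2) *\<^sub>R P x) \<longlongrightarrow> J 0) (at 0)"
        by (simp add: J_def)
      then have "(J \<longlongrightarrow> J 0) (at 0)"
        by (rule Lim_transform_eventually) (simp add: eventually_at_filter J_def)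
      then show ?thesis using True by (simp add: isCont_def)
    qed
  qed
  show ?thesis
    unfolding C2_on_def by (intro conjI exI[of _ ?G] ballI oD df C1_onI[OF oD dG cJ])
qed

lemma tangent_space_zero_set:
  assumes "(F has_derivative D) (at p)" "open U" "p \<in> U" "S \<inter> U = {q \<in> U. F q = 0}" "p \<in> S"
    and "v \<in> tangent_space S p"
  shows "D v = 0"
proof -
  have 1: "(F has_derivative D) (at p within S)" using assms(1) by (rule has_derivative_at_withinI)
  have "((\<lambda>_. 0) has_derivative (\<lambda>_. 0)) (at p within S)" by simp
  then have 2: "(F has_derivative (\<lambda>_. 0)) (at p within S)"
  proof (rule has_derivative_transform_eventually)
    show "\<forall>\<^sub>F q in at p within S. 0 = F q"
      using assms unfolding eventually_at_topological by (intro exI[of _ U]) auto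
  qed (use assms in auto)
  show ?thesis using frechet_derivative_tangent[OF 1 assms(6)] frechet_derivative_tangent[OF 2 assms(6)] by simp
qed

text \<open>Suppose that \<open>S\<close> is the regular zero set of a \<open>C\<^sup>2\<close> function \<open>F\<close>. The tangent space at \<open>p\<close> is horizontal,
  so the vertical derivative \<open>F\<^sub>t\<close> is nonzero near \<open>p\<close>, and differentiating \<open>F(r e, \<psi>(r)) = 0\<close> gives
  \<open>\<psi>' = - F\<^sub>e / F\<^sub>t\<close> along the profile, where \<open>F\<^sub>e\<close> is the derivative of \<open>F\<close> in the horizontal direction \<open>e\<close>.
  The right-hand side is differentiable.\<close>

lemma C2_hypersurface_profile_differentiable:
  fixes S :: "('a::real_inner \<times> real) set"
  assumes U: "open U" "p \<in> U" "p \<in> S" and S: "\<And>q. q \<in> U \<Longrightarrow> q \<in> S \<longleftrightarrow> snd q = \<psi> (norm (fst q))"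
    and x0: "fst p \<noteq> 0" and J: "open J" "norm (fst p) \<in> J"
    and \<psi>: "\<And>r. r \<in> J \<Longrightarrow> (\<psi> has_real_derivative \<psi>' r) (at r)" and 0: "\<psi>' (norm (fst p)) = 0"
    and C2: "hypersurface_at C2_on S p"
  shows "\<psi>' differentiable (at (norm (fst p)))"
proof -
  define r0 where "r0 = norm (fst p)"
  define e where "e = fst p /\<^sub>R r0"
  have r0: "0 < r0" using x0 by (simp add: r0_def)
  have e: "norm e = 1" using r0 by (simp add: e_def r0_def)
  obtain W and F :: "'a \<times> real \<Rightarrow> real" where W: "open W" "p \<in> W" "C2_on W F" "S \<inter> W = {q \<in> W. F q = 0}"
    "\<forall>q\<in>S \<inter> W. frechet_derivative F (at q) \<noteq> (\<lambda>_. 0)"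
    using C2 unfolding hypersurface_at_def
    apply (elim conjE exE)
    subgoal for W F by (rule that[of W F])
    done
  obtain F' F'' where F: "\<And>q. q \<in> W \<Longrightarrow> (F has_derivative blinfun_apply (F' q)) (at q)"
    "\<And>q. q \<in> W \<Longrightarrow> (F' has_derivative blinfun_apply (F'' q)) (at q)"
    using W(3) by (auto simp: C2_on_def C1_on_def)
  define q where "q r = (r *\<^sub>R e, \<psi> r)" for r
  have q0: "q r0 = p" using S[of p] U r0 by (auto simp: q_def e_def prod_eq_iff r0_def)
  have dq: "(q has_vector_derivative (e, \<psi>' r)) (at r)" if "r \<in> J" for r
    unfolding q_def[abs_def]
    by (intro has_vector_derivative_Pair \<psi>[OF that, unfolded has_real_derivative_iff_has_vector_derivative])
      (auto intro!: derivative_eq_intros)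
  have J0: "r0 \<in> J" using J by (simp add: r0_def)
  have "isCont q r0" using dq[OF J0] by (rule has_vector_derivative_continuous)
  then have "(q \<longlongrightarrow> q r0) (nhds r0)" by (simp add: isCont_def tendsto_at_iff_tendsto_nhds)
  then have "(q \<longlongrightarrow> p) (nhds r0)" by (simp only: q0)
  then have "\<forall>\<^sub>F r in nhds r0. q r \<in> U \<inter> W" 
    using U W by (intro topological_tendstoD) auto
  moreover have "\<forall>\<^sub>F r in nhds r0. r \<in> J \<and> 0 < r"
    using eventually_nhds_in_open[of "J \<inter> {0<..}" r0] J J0 r0 by (simp add: open_Int)
  ultimately have ev: "\<forall>\<^sub>F r in nhds r0. q r \<in> W \<and> r \<in> J \<and> F (q r) = 0"
  proof eventually_elim
    case (elim r)
    then have "q r \<in> S" using S[of "q r"] e by (simp add: q_def)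
    then show ?case using elim W(4) by auto
  qed
  define a where "a r = F' (q r) (e, 0)" for r
  define b where "b r = F' (q r) (0, 1)" for r
  have eq: "\<forall>\<^sub>F r in nhds r0. a r + \<psi>' r * b r = 0"
    using eventually_eventually[THEN iffD2, OF ev] ev
  proof eventually_elim
    case (elim r)
    have "((F \<circ> q) has_vector_derivative F' (q r) (e, \<psi>' r)) (at r)"
      by (rule vector_derivative_diff_chain_within[OF dq has_derivative_at_withinI[OF F(1)]]) (use elim(2) in simp_all)
    then have "((\<lambda>r. F (q r)) has_vector_derivative F' (q r) (e, \<psi>' r)) (at r)" by (simp only: o_def)
    moreover have "((\<lambda>r. F (q r)) has_vector_derivative 0) (at r)"
      unfolding has_vector_derivative_def
    proof (rule has_derivative_transform_eventually[of "\<lambda>_. 0"])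
      show "\<forall>\<^sub>F r' in at r. 0 = F (q r')"
        using elim(1) unfolding eventually_at_filter by (rule eventually_mono) auto
    qed (use elim in auto)
    ultimately have "F' (q r) (e, \<psi>' r) = 0" by (rule vector_derivative_unique_at)
    moreover have "(e, \<psi>' r) = (e, 0) + \<psi>' r *\<^sub>R (0, 1)" by simp
    ultimately have "F' (q r) ((e, 0) + \<psi>' r *\<^sub>R (0, 1)) = 0" by (simp only:)
    then show ?case unfolding a_def b_def blinfun.add_right blinfun.scaleR_right real_scaleR_def .
  qed
  have ts: "tangent_space S p = {v. snd v = 0}"
    using tangent_space_graph[OF U(1,2) S U(3), of "\<lambda>_. 0"] radial_has_derivative[OF \<psi>[OF J(2)] x0] 0
    by simp
  have "F' p (w, 0) = 0" for w
    using tangent_space_zero_set[OF F(1) W(1,2,4) U(3), of "(w, 0)"] W(2) by (simp add: ts)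
  moreover have "frechet_derivative F (at p) = blinfun_apply (F' p)"
    using frechet_derivative_at[OF F(1)[OF W(2)]] by simp
  then have "blinfun_apply (F' p) \<noteq> (\<lambda>_. 0)" using W(2,5) U(3) by (metis IntI)
  then obtain v where "F' p v \<noteq> 0" by (auto simp: fun_eq_iff)
  moreover have "F' p v = F' p (fst v, 0) + snd v * F' p (0, 1)"
  proof -
    have "v = (fst v, 0) + snd v *\<^sub>R (0, 1)" by (simp add: prod_eq_iff)
    then have "F' p v = F' p ((fst v, 0) + snd v *\<^sub>R (0, 1))" by (rule arg_cong)
    then show ?thesis unfolding blinfun.add_right blinfun.scaleR_right real_scaleR_def .
  qed
  ultimately have "F' p (0, 1) \<noteq> 0" by (metis add.left_neutral mult_zero_right)
  then have b0: "b r0 \<noteq> 0" by (simp add: b_def q0)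
  have dF': "((\<lambda>r. F' (q r)) has_vector_derivative F'' p (e, \<psi>' r0)) (at r0)"
    using vector_derivative_diff_chain_within[OF dq[OF J0], of F' "F'' p"] has_derivative_at_withinI[OF F(2)[OF W(2)]]
    by (simp only: o_def q0)
  have dap: "\<exists>d. ((\<lambda>r. F' (q r) v) has_real_derivative d) (at r0)" for v
    using bounded_linear.has_vector_derivative[OF blinfun.bounded_linear_left dF', of v]
    by (auto simp: has_real_derivative_iff_has_vector_derivative)
  obtain da db where d: "(a has_real_derivative da) (at r0)" "(b has_real_derivative db) (at r0)"
    using dap[of "(e, 0)", folded a_def] dap[of "(0, 1)", folded b_def] by blast
  have "(b \<longlongrightarrow> b r0) (nhds r0)" using DERIV_isCont[OF d(2)] by (simp add: isCont_def tendsto_at_iff_tendsto_nhds)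
  then have "\<forall>\<^sub>F r in nhds r0. b r \<noteq> 0" using b0 by (rule tendsto_imp_eventually_ne)
  with eq have e\<psi>: "\<forall>\<^sub>F r in nhds r0. - a r / b r = \<psi>' r"
    by eventually_elim (simp add: field_simps)
  have "((\<lambda>r. - a r / b r) has_real_derivative ((- da) * b r0 - (- a r0) * db) / (b r0 * b r0)) (at r0)"
    by (rule DERIV_divide[OF DERIV_minus[OF d(1)] d(2) b0])
  then have "(\<psi>' has_real_derivative ((- da) * b r0 - (- a r0) * db) / (b r0 * b r0)) (at r0)"
    by (rule DERIV_cong_ev[OF refl e\<psi> refl, THEN iffD1])
  then show ?thesis unfolding r0_def[symmetric] by (rule real_differentiable_def[THEN iffD2, OF exI])
qed

section \<open>The profile equation\<close>

lemma primitive_has_derivative: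
  fixes f :: "real \<Rightarrow> real"
  assumes c: "continuous_on {a<..<b} f" and "a < 0" "0 < b" and r: "a < r" "r < b"
  shows "((\<lambda>u. LBINT y=ereal 0..ereal u. f y) has_real_derivative f r) (at r)"
proof -
  define a' b' where "a' = (a + min 0 r) / 2" and "b' = (b + max 0 r) / 2"
  have *: "a < a'" "a' < 0" "a' < r" "b' < b" "0 < b'" "r < b'"
    using assms by (auto simp: a'_def b'_def min_def max_def)
  have "continuous_on {a'..b'} f" by (rule continuous_on_subset[OF c]) (use * in auto)
  from interval_integral_FTC2[of a' 0 b' f r, OF _ _ this] *
  have "((\<lambda>u. LBINT y=ereal 0..ereal u. f y) has_vector_derivative f r) (at r within {a'..b'})" by simp
  moreover have "at r within {a'..b'} = at r" using * by (intro at_within_interior) auto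
  ultimately show ?thesis by (simp add: has_real_derivative_iff_has_vector_derivative)
qed

lemma primitive_odd:
  fixes f :: "real \<Rightarrow> real"
  assumes "\<And>y. f (- y) = f y"
  shows "(LBINT y=ereal 0..ereal (- r). f y) = - (LBINT y=ereal 0..ereal r. f y)"
proof -
  have "(LBINT y=ereal 0..ereal (- r). f y) = (LBINT y=ereal r..ereal 0. f y)"
    by (subst interval_integral_reflect) (simp add: assms)
  then show ?thesis by (simp add: interval_integral_endpoints_reverse[of "ereal r"])
qed

text \<open>The function \<open>F\<close> of the separated equation \<open>F(\<theta>) = T(r) + C\<close>.\<close>

definition sin_primitive :: "nat \<Rightarrow> real \<Rightarrow> real" where
  "sin_primitive m t = (LBINT y=ereal 0..ereal t. sin y ^ m)"

text \<open>In terms of the geodesic distance \<open>s\<close>, the base \<open>r / (1 - \<epsilon> r\<^sup>2 / 4)\<close> is \<open>s\<close> for \<open>\<epsilon> = 0\<close> and \<open>tanh s\<close>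
  for \<open>\<epsilon> = -1\<close>, and the factor \<open>1 / conf \<epsilon> r\<close> is \<open>ds / dr\<close>.\<close>

definition tan_density :: "real \<Rightarrow> nat \<Rightarrow> real \<Rightarrow> real" where
  "tan_density \<epsilon> m r = (r / (1 - \<epsilon> * r\<^sup>2 / 4)) ^ m / conf \<epsilon> r"

definition tan_primitive :: "real \<Rightarrow> nat \<Rightarrow> real \<Rightarrow> real" where
  "tan_primitive \<epsilon> m r = (LBINT y=ereal 0..ereal r. tan_density \<epsilon> m y)"

lemma sin_primitive_0 [simp]: "sin_primitive m 0 = 0"
  by (simp add: sin_primitive_def)

lemma tan_primitive_0 [simp]: "tan_primitive \<epsilon> m 0 = 0"
  by (simp add: tan_primitive_def)

lemma sin_primitive_has_derivative: "(sin_primitive m has_real_derivative sin t ^ m) (at t)"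
  unfolding sin_primitive_def[abs_def]
  by (rule primitive_has_derivative[of "- \<bar>t\<bar> - 1" "\<bar>t\<bar> + 1"]) (auto intro!: continuous_intros)

lemma sin_primitive_minus: "even m \<Longrightarrow> sin_primitive m (- t) = - sin_primitive m t"
  unfolding sin_primitive_def by (rule primitive_odd) simp

lemma tan_primitive_minus: "even m \<Longrightarrow> tan_primitive \<epsilon> m (- t) = - tan_primitive \<epsilon> m t"
  unfolding tan_primitive_def by (rule primitive_odd) (simp add: tan_density_def power_divide)

lemma denominator_pos: "\<epsilon> \<le> 0 \<Longrightarrow> 0 < 1 - \<epsilon> * r\<^sup>2 / (4::real)"
  using mult_nonpos_nonneg[of \<epsilon> "r\<^sup>2"] by auto

lemma tan_density_pos:
  assumes "\<epsilon> \<in> {0, -1}" "even m" "0 < conf \<epsilon> r" "r \<noteq> 0"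
  shows "0 < tan_density \<epsilon> m r"
proof -
  have "0 < 1 - \<epsilon> * r\<^sup>2 / 4" using denominator_pos[of \<epsilon> r] assms(1) by auto
  then show ?thesis using assms by (auto simp: tan_density_def zero_less_power_eq)
qed

lemma continuous_on_tan_density:
  assumes "\<epsilon> \<in> {0, -1}" "\<And>r. r \<in> X \<Longrightarrow> 0 < conf \<epsilon> r"
  shows "continuous_on X (tan_density \<epsilon> m)"
proof -
  have "\<epsilon> \<le> 0" using assms(1) by auto
  then have "\<forall>r\<in>X. 1 - \<epsilon> * r\<^sup>2 / 4 \<noteq> 0" by (metis denominator_pos less_irrefl)
  moreover have "\<forall>r\<in>X. conf \<epsilon> r \<noteq> 0" using assms(2) by force
  ultimately show ?thesis
    unfolding tan_density_def[abs_def] by (intro continuous_intros) auto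
qed

lemma tan_primitive_has_derivative:
  assumes "\<epsilon> \<in> {0, -1}" "0 < conf \<epsilon> r"
  shows "(tan_primitive \<epsilon> m has_real_derivative tan_density \<epsilon> m r) (at r)"
proof -
  have "open {r. 0 < conf \<epsilon> r}" by (rule open_conf_pos)
  then obtain d where d: "d > 0" "\<And>s. \<bar>s - \<bar>r\<bar>\<bar> < d \<Longrightarrow> 0 < conf \<epsilon> s"
    using assms(2) unfolding open_dist dist_real_def by (metis conf_abs mem_Collect_eq)
  define b where "b = \<bar>r\<bar> + d / 2"
  have b: "0 < conf \<epsilon> b" "\<bar>r\<bar> < b" using d by (auto simp: b_def)
  have "continuous_on {-b<..<b} (tan_density \<epsilon> m)"
    using conf_between[of \<epsilon> "-b" b] b assms(1) by (intro continuous_on_tan_density) auto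
  then show ?thesis unfolding tan_primitive_def[abs_def]
    by (rule primitive_has_derivative) (use b in auto)
qed

text \<open>The derivatives of both primitives vanish at \<open>0\<close>, so strict monotonicity is obtained on either side of
  \<open>0\<close> separately.\<close>

lemma strict_increasing_off_0:
  fixes f :: "real \<Rightarrow> real"
  assumes "a < b" and f: "\<And>x. a \<le> x \<Longrightarrow> x \<le> b \<Longrightarrow> (f has_real_derivative f' x) (at x)"
    and pos: "\<And>x. a \<le> x \<Longrightarrow> x \<le> b \<Longrightarrow> x \<noteq> 0 \<Longrightarrow> 0 < f' x"
  shows "f a < f b"
proof -
  have *: "f c < f d" if "a \<le> c" "c < d" "d \<le> b" "d \<le> 0 \<or> 0 \<le> c" for c d
  proof (rule DERIV_pos_imp_increasing_open[OF \<open>c < d\<close>])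
    show "\<exists>y. (f has_real_derivative y) (at x) \<and> 0 < y" if "c < x" "x < d" for x
      using f[of x] pos[of x] that \<open>a \<le> c\<close> \<open>d \<le> b\<close> \<open>d \<le> 0 \<or> 0 \<le> c\<close> by (intro exI[of _ "f' x"]) auto
    show "continuous_on {c..d} f"
    proof (rule DERIV_atLeastAtMost_imp_continuous_on)
      show "\<exists>y. (f has_real_derivative y) (at x)" if "c \<le> x" "x \<le> d" for x
        using f[of x] that \<open>a \<le> c\<close> \<open>d \<le> b\<close> by (intro exI[of _ "f' x"]) simp
    qed
  qed
  show ?thesis
  proof (cases "a < 0 \<and> 0 < b")
    case True
    then show ?thesis using *[of a 0] *[of 0 b] by auto
  qed (use *[of a b] \<open>a < b\<close> in auto)
qed

lemma sin_primitive_strict_mono: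
  assumes "even m" "- (pi / 2) \<le> s" "s < t" "t \<le> pi / 2"
  shows "sin_primitive m s < sin_primitive m t"
proof (rule strict_increasing_off_0[OF assms(3) sin_primitive_has_derivative])
  fix x assume "s \<le> x" "x \<le> t" "x \<noteq> 0"
  then have "sin x \<noteq> 0" using assms sin_gt_zero[of x] sin_gt_zero[of "- x"] pi_gt_zero
    by (cases "0 < x") auto
  then show "0 < sin x ^ m" using assms by (simp add: zero_less_power_eq)
qed

lemma sin_primitive_less_iff:
  assumes "even m" "\<bar>s\<bar> \<le> pi / 2" "\<bar>t\<bar> \<le> pi / 2"
  shows "sin_primitive m s < sin_primitive m t \<longleftrightarrow> s < t"
proof -
  have "- (pi / 2) \<le> s" "s \<le> pi / 2" "- (pi / 2) \<le> t" "t \<le> pi / 2" using assms(2,3) by linarith+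
  then show ?thesis
    using sin_primitive_strict_mono[OF assms(1), of s t] sin_primitive_strict_mono[OF assms(1), of t s]
    by (cases s t rule: linorder_cases) force+
qed

lemma sin_primitive_eq_iff:
  assumes "even m" "\<bar>s\<bar> \<le> pi / 2" "\<bar>t\<bar> \<le> pi / 2"
  shows "sin_primitive m s = sin_primitive m t \<longleftrightarrow> s = t"
  using sin_primitive_less_iff[OF assms] sin_primitive_less_iff[OF assms(1,3,2)]
  by (cases s t rule: linorder_cases) auto

lemma tan_primitive_less_iff:
  assumes "\<epsilon> \<in> {0, -1}" "even m" "0 < conf \<epsilon> s" "0 < conf \<epsilon> t"
  shows "tan_primitive \<epsilon> m s < tan_primitive \<epsilon> m t \<longleftrightarrow> s < t"
proof -
  have *: "tan_primitive \<epsilon> m a < tan_primitive \<epsilon> m b" if "a < b" "0 < conf \<epsilon> a" "0 < conf \<epsilon> b" for a b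
  proof (rule strict_increasing_off_0[OF that(1)])
    fix x assume "a \<le> x" "x \<le> b"
    then have "0 < conf \<epsilon> x" using conf_between[of \<epsilon> a b x] assms that by auto
    then show "(tan_primitive \<epsilon> m has_real_derivative tan_density \<epsilon> m x) (at x)" "x \<noteq> 0 \<Longrightarrow> 0 < tan_density \<epsilon> m x"
      using tan_primitive_has_derivative tan_density_pos assms by auto
  qed
  show ?thesis using *[of s t] *[of t s] assms by (cases s t rule: linorder_cases) auto
qed

lemma tan_primitive_eq_iff:
  assumes "\<epsilon> \<in> {0, -1}" "even m" "0 < conf \<epsilon> s" "0 < conf \<epsilon> t"
  shows "tan_primitive \<epsilon> m s = tan_primitive \<epsilon> m t \<longleftrightarrow> s = t"
  using tan_primitive_less_iff[OF assms] tan_primitive_less_iff[OF assms(1,2,4,3)]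
  by (cases s t rule: linorder_cases) auto

text \<open>For \<open>\<epsilon> = -1\<close> the base increases on \<open>[1, 2)\<close> from its value \<open>4 / 5\<close> at \<open>1\<close>.\<close>

lemma tan_density_ge:
  assumes "\<epsilon> \<in> {0, -1}" "1 \<le> r" "0 < conf \<epsilon> r"
  shows "(4 / 5) ^ m * (1 / conf \<epsilon> r) \<le> tan_density \<epsilon> m r"
proof -
  have "4 / 5 \<le> r / (1 - \<epsilon> * r\<^sup>2 / 4)"
  proof (cases "\<epsilon> = 0")
    case False
    then have e: "\<epsilon> = -1" using assms by simp
    have "r < 2" using assms conf_pos_iff[of r] e by simp
    then have "0 \<le> (r - 1) * (4 - r)" using assms by (intro mult_nonneg_nonneg) auto
    moreover have "0 < 1 + r\<^sup>2 / 4" by (simp add: add_pos_nonneg)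
    ultimately show ?thesis by (simp add: e pos_le_divide_eq power2_eq_square algebra_simps)
  qed (use assms in simp)
  then have "(4 / 5) ^ m \<le> (r / (1 - \<epsilon> * r\<^sup>2 / 4)) ^ m" by (intro power_mono) auto
  then show ?thesis using assms(3) by (simp add: tan_density_def divide_right_mono)
qed

text \<open>Beyond \<open>r = 1\<close> the primitive grows at least as fast as a positive multiple of the geodesic radius, which
  is unbounded. Negative values follow by oddness.\<close>

lemma tan_primitive_surj:
  assumes \<epsilon>: "\<epsilon> \<in> {0, -1}" and m: "even m"
  obtains r where "0 < conf \<epsilon> r" "tan_primitive \<epsilon> m r = y"
proof -
  have *: "\<exists>r. 0 < conf \<epsilon> r \<and> tan_primitive \<epsilon> m r = y" if y: "0 \<le> y" for y
  proof -
    define k :: real where "k = (4 / 5) ^ m"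
    have k: "0 < k" by (simp add: k_def)
    have c1: "0 < conf \<epsilon> 1" using \<epsilon> by (auto simp: conf_def)
    \<comment> \<open>Chosen so that \<open>k\<close> times the geodesic radius grows by exactly \<open>y\<close> on \<open>[1, R]\<close>.\<close>
    define R where "R = chart_radius \<epsilon> (geo_radius \<epsilon> 1 + y / k)"
    have R: "0 < conf \<epsilon> R" "geo_radius \<epsilon> R = geo_radius \<epsilon> 1 + y / k"
      using conf_chart_radius[OF \<epsilon>] by (auto simp: R_def)
    have "1 \<le> R" using geo_radius_le_iff[OF \<epsilon> c1 R(1)] R(2) k that by simp
    have pos: "0 < conf \<epsilon> x" if "0 \<le> x" "x \<le> R" for x
      using conf_between[of \<epsilon> 0 R x] R \<epsilon> that by auto
    have "tan_primitive \<epsilon> m 1 - k * geo_radius \<epsilon> 1 \<le> tan_primitive \<epsilon> m R - k * geo_radius \<epsilon> R"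
    proof (rule DERIV_nonneg_imp_nondecreasing[OF \<open>1 \<le> R\<close>, of "\<lambda>r. tan_primitive \<epsilon> m r - k * geo_radius \<epsilon> r"])
      fix x assume x: "1 \<le> x" "x \<le> R"
      have p: "0 < conf \<epsilon> x" using pos x by auto
      have "((\<lambda>r. tan_primitive \<epsilon> m r - k * geo_radius \<epsilon> r) has_real_derivative (tan_density \<epsilon> m x - k * (1 / conf \<epsilon> x))) (at x)"
        by (intro DERIV_diff DERIV_cmult tan_primitive_has_derivative geo_radius_has_derivative \<epsilon> p)
      then show "\<exists>z. ((\<lambda>r. tan_primitive \<epsilon> m r - k * geo_radius \<epsilon> r) has_real_derivative z) (at x) \<and> 0 \<le> z"
        using tan_density_ge[OF \<epsilon> x(1) p, of m] by (auto simp: k_def)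
    qed
    moreover have "0 < tan_primitive \<epsilon> m 1" using tan_primitive_less_iff[OF \<epsilon> m, of 0 1] c1 by simp
    ultimately have "y \<le> tan_primitive \<epsilon> m R" using k by (simp add: R(2) distrib_left)
    moreover have "continuous_on {0..R} (tan_primitive \<epsilon> m)"
      by (rule DERIV_atLeastAtMost_imp_continuous_on) (use tan_primitive_has_derivative[OF \<epsilon> pos] in \<open>intro exI; simp\<close>)
    ultimately obtain r where "0 \<le> r" "r \<le> R" "tan_primitive \<epsilon> m r = y"
      using IVT'[of "tan_primitive \<epsilon> m" 0 y R] y \<open>1 \<le> R\<close> by auto
    then show ?thesis using pos by auto
  qed
  show ?thesis
  proof (cases "0 \<le> y")
    case False
    then obtain r where "0 < conf \<epsilon> r" "tan_primitive \<epsilon> m r = - y" using *[of "- y"] by auto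
    then show ?thesis using that[of "- r"] tan_primitive_minus[OF m, of \<epsilon> r] by simp
  qed (use * that in blast)
qed

text \<open>A full branch of the separated equation, from one vertical tangent to the other. The height \<open>\<psi>\<close> is added in a
  second step, because its existence rests on the continuity of \<open>\<theta>\<close>, a consequence of these assumptions.\<close>

locale angle_profile =
  fixes \<epsilon> :: real and m :: nat and C A r0 B :: real and \<theta> :: "real \<Rightarrow> real"
  assumes \<epsilon>: "\<epsilon> \<in> {0, -1}" and m: "even m" "2 \<le> m"
    and conf_ends: "0 < conf \<epsilon> A" "0 < conf \<epsilon> r0" "0 < conf \<epsilon> B"
    and T_A: "tan_primitive \<epsilon> m A + C = sin_primitive m (- (pi / 2))"
    and T_r0: "tan_primitive \<epsilon> m r0 + C = 0"
    and T_B: "tan_primitive \<epsilon> m B + C = sin_primitive m (pi / 2)"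
    and \<theta>: "\<And>r. A \<le> r \<Longrightarrow> r \<le> B \<Longrightarrow> \<bar>\<theta> r\<bar> \<le> pi / 2 \<and> sin_primitive m (\<theta> r) = tan_primitive \<epsilon> m r + C"
begin

lemma \<epsilon>_le: "\<epsilon> \<le> 0"
  using \<epsilon> by auto

lemma ends: "A < r0" "r0 < B"
proof -
  have "sin_primitive m (- (pi / 2)) < sin_primitive m 0" "sin_primitive m 0 < sin_primitive m (pi / 2)"
    using sin_primitive_strict_mono[OF m(1), of "- (pi / 2)" 0] sin_primitive_strict_mono[OF m(1), of 0 "pi / 2"] by simp_all
  then have "tan_primitive \<epsilon> m A < tan_primitive \<epsilon> m r0" "tan_primitive \<epsilon> m r0 < tan_primitive \<epsilon> m B"
    using T_A T_r0 T_B by auto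
  then show "A < r0" "r0 < B"
    by (simp_all only: tan_primitive_less_iff[OF \<epsilon> m(1)] conf_ends)
qed

lemma conf_pos: "A \<le> r \<Longrightarrow> r \<le> B \<Longrightarrow> 0 < conf \<epsilon> r"
  using conf_between[OF \<epsilon>_le conf_ends(1,3)] .

lemma \<theta>_less_iff: 
  assumes "A \<le> r" "r \<le> B" "A \<le> s" "s \<le> B"
  shows "\<theta> r < \<theta> s \<longleftrightarrow> r < s"
proof -
  have "\<theta> r < \<theta> s \<longleftrightarrow> sin_primitive m (\<theta> r) < sin_primitive m (\<theta> s)"
    by (rule sin_primitive_less_iff[OF m(1), symmetric]) (use \<theta> assms in blast)+
  also have "\<dots> \<longleftrightarrow> tan_primitive \<epsilon> m r < tan_primitive \<epsilon> m s"
    using \<theta>[OF assms(1,2)] \<theta>[OF assms(3,4)] by linarith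
  also have "\<dots> \<longleftrightarrow> r < s"
    by (rule tan_primitive_less_iff[OF \<epsilon> m(1)]) (use conf_pos assms in blast)+
  finally show ?thesis .
qed

lemma \<theta>_ends: "\<theta> A = - (pi / 2)" "\<theta> r0 = 0" "\<theta> B = pi / 2"
proof -
  have *: "\<theta> r = t" if "A \<le> r" "r \<le> B" "\<bar>t\<bar> \<le> pi / 2" "tan_primitive \<epsilon> m r + C = sin_primitive m t" for r t
    using sin_primitive_eq_iff[OF m(1), of "\<theta> r" t] \<theta>[OF that(1,2)] that(3,4) by metis
  show "\<theta> A = - (pi / 2)" by (rule *) (use ends T_A in simp_all)
  show "\<theta> r0 = 0" by (rule *) (use ends T_r0 in simp_all)
  show "\<theta> B = pi / 2" by (rule *) (use ends T_B in simp_all)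
qed

lemma \<theta>_bounds:
  assumes "A < r" "r < B"
  shows "- (pi / 2) < \<theta> r" "\<theta> r < pi / 2"
  using \<theta>_less_iff[of A r] \<theta>_less_iff[of r B] \<theta>_ends assms by auto

lemma cos_\<theta>: "A < r \<Longrightarrow> r < B \<Longrightarrow> 0 < cos (\<theta> r)"
  using \<theta>_bounds by (intro cos_gt_zero_pi) auto

lemma \<theta>_sign:
  assumes "A \<le> r" "r \<le> B"
  shows "0 < \<theta> r \<longleftrightarrow> r0 < r" "\<theta> r < 0 \<longleftrightarrow> r < r0"
  using \<theta>_less_iff[of r0 r] \<theta>_less_iff[of r r0] \<theta>_ends assms ends by auto

lemma sin_\<theta>_sign:
  assumes "A \<le> r" "r \<le> B"
  shows "0 < sin (\<theta> r) \<longleftrightarrow> r0 < r" "sin (\<theta> r) = 0 \<longleftrightarrow> r = r0"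
proof -
  have b: "\<bar>\<theta> r\<bar> \<le> pi / 2" using \<theta>[OF assms] by simp
  have 1: "0 < sin (\<theta> r)" if "r0 < r" using \<theta>_sign[OF assms] that b pi_gt_zero by (intro sin_gt_zero) auto
  have "0 < sin (- \<theta> r)" if "r < r0" using \<theta>_sign[OF assms] that b pi_gt_zero by (intro sin_gt_zero) auto
  then have 2: "sin (\<theta> r) < 0" if "r < r0" using that by simp
  show "0 < sin (\<theta> r) \<longleftrightarrow> r0 < r" "sin (\<theta> r) = 0 \<longleftrightarrow> r = r0"
    using 1 2 \<theta>_ends(2) by (cases r r0 rule: linorder_cases; force)+
qed

lemma tan_\<theta>_sign:
  assumes "A < r" "r < B"
  shows "0 < tan (\<theta> r) \<longleftrightarrow> r0 < r" "tan (\<theta> r) < 0 \<longleftrightarrow> r < r0"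
proof -
  have "0 < tan (\<theta> r) \<longleftrightarrow> 0 < sin (\<theta> r)" "tan (\<theta> r) < 0 \<longleftrightarrow> sin (\<theta> r) < 0"
    using cos_\<theta>[OF assms] by (auto simp: tan_def zero_less_divide_iff divide_less_0_iff)
  moreover have "sin (\<theta> r) < 0 \<longleftrightarrow> r < r0"
    using sin_\<theta>_sign[of r] assms by linarith
  ultimately show "0 < tan (\<theta> r) \<longleftrightarrow> r0 < r" "tan (\<theta> r) < 0 \<longleftrightarrow> r < r0"
    using sin_\<theta>_sign(1)[of r] assms by linarith+
qed

definition sin_inverse :: "real \<Rightarrow> real" where
  "sin_inverse = inv_into {- (pi / 2)..pi / 2} (sin_primitive m)"

lemma sin_inverse: 
  assumes "\<bar>t\<bar> \<le> pi / 2" shows "sin_inverse (sin_primitive m t) = t"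
proof -
  have "inj_on (sin_primitive m) {- (pi / 2)..pi / 2}"
    by (rule inj_onI) (use sin_primitive_eq_iff[OF m(1)] in \<open>auto simp: abs_le_iff\<close>)
  then show ?thesis unfolding sin_inverse_def by (rule inv_into_f_f) (use assms in auto)
qed

lemma continuous_on_sin_primitive: "continuous_on X (sin_primitive m)"
  by (intro continuous_at_imp_continuous_on ballI DERIV_isCont[OF sin_primitive_has_derivative])

lemma sin_primitive_image:
  "sin_primitive m ` {- (pi / 2)..pi / 2} = {sin_primitive m (- (pi / 2))..sin_primitive m (pi / 2)}"
proof (intro equalityI subsetI)
  fix y assume "y \<in> {sin_primitive m (- (pi / 2))..sin_primitive m (pi / 2)}"
  then show "y \<in> sin_primitive m ` {- (pi / 2)..pi / 2}"
    using IVT'[of "sin_primitive m" "- (pi / 2)" y "pi / 2", OF _ _ _ continuous_on_sin_primitive] by force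
next
  fix y assume "y \<in> sin_primitive m ` {- (pi / 2)..pi / 2}"
  then obtain t where "y = sin_primitive m t" "\<bar>t\<bar> \<le> pi / 2" by auto
  then show "y \<in> {sin_primitive m (- (pi / 2))..sin_primitive m (pi / 2)}"
    using sin_primitive_less_iff[OF m(1), of t "- (pi / 2)"] sin_primitive_less_iff[OF m(1), of "pi / 2" t] by force
qed

lemma continuous_on_sin_inverse:
  "continuous_on {sin_primitive m (- (pi / 2))..sin_primitive m (pi / 2)} sin_inverse"
  unfolding sin_primitive_image[symmetric]
  by (rule continuous_on_inv[OF continuous_on_sin_primitive compact_Icc]) (auto simp: sin_inverse)

lemma continuous_on_tan_primitive: "continuous_on {A..B} (tan_primitive \<epsilon> m)"
  by (rule DERIV_atLeastAtMost_imp_continuous_on) (use tan_primitive_has_derivative[OF \<epsilon> conf_pos] in \<open>intro exI; simp\<close>)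

lemma \<theta>_eq: "A \<le> r \<Longrightarrow> r \<le> B \<Longrightarrow> sin_inverse (tan_primitive \<epsilon> m r + C) = \<theta> r"
  using sin_inverse \<theta> by metis

lemma T_range:
  assumes "A \<le> r" "r \<le> B"
  shows "tan_primitive \<epsilon> m r + C \<in> {sin_primitive m (- (pi / 2))..sin_primitive m (pi / 2)}"
  using \<theta>[OF assms] sin_primitive_image by (metis abs_le_iff atLeastAtMost_iff imageI minus_le_iff)

lemma continuous_on_\<theta>: "continuous_on {A..B} \<theta>"
proof (rule continuous_on_eq)
  show "continuous_on {A..B} (\<lambda>r. sin_inverse (tan_primitive \<epsilon> m r + C))"
    by (intro continuous_on_compose2[OF continuous_on_sin_inverse] continuous_intros continuous_on_tan_primitive)
      (use T_range in auto)
qed (use \<theta>_eq in auto)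

lemma isCont_\<theta>: "A < r \<Longrightarrow> r < B \<Longrightarrow> isCont \<theta> r"
  using continuous_on_interior[OF continuous_on_\<theta>, of r] by simp

definition \<theta>' :: "real \<Rightarrow> real" where
  "\<theta>' r = tan_density \<epsilon> m r / sin (\<theta> r) ^ m"

text \<open>The local inverse of \<open>F\<close> is differentiable at \<open>F(\<theta> r)\<close> because \<open>F' = sin\<^sup>m\<close> vanishes only at \<open>\<theta> = 0\<close>, that is
  at \<open>r0\<close>.\<close>

lemma \<theta>_has_derivative:
  assumes r: "A < r" "r < B" "r \<noteq> r0"
  shows "(\<theta> has_real_derivative \<theta>' r) (at r)"
proof -
  let ?y = "tan_primitive \<epsilon> m r + C"
  have g: "sin_inverse ?y = \<theta> r" using \<theta>_eq r by auto
  have y: "?y = sin_primitive m (\<theta> r)" using \<theta>[of r] r by auto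
  have y2: "sin_primitive m (- (pi / 2)) < ?y" "?y < sin_primitive m (pi / 2)"
    unfolding y using sin_primitive_strict_mono[OF m(1)] \<theta>_bounds[OF r(1,2)] by auto
  have "(sin_inverse has_real_derivative inverse (sin (\<theta> r) ^ m)) (at ?y)"
  proof (rule DERIV_inverse_function[where f = "sin_primitive m" and a = "- sin_primitive m (pi / 2)" and b = "sin_primitive m (pi / 2)"])
    show "(sin_primitive m has_real_derivative sin (\<theta> r) ^ m) (at (sin_inverse ?y))"
      unfolding g by (rule sin_primitive_has_derivative)
    show "sin (\<theta> r) ^ m \<noteq> 0" using sin_\<theta>_sign(2)[of r] r by auto
    show "- sin_primitive m (pi / 2) < ?y" "?y < sin_primitive m (pi / 2)"
      using y2 by (auto simp: sin_primitive_minus[OF m(1)])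
    show "sin_primitive m (sin_inverse z) = z" if "- sin_primitive m (pi / 2) < z" "z < sin_primitive m (pi / 2)" for z
    proof -
      have "z \<in> sin_primitive m ` {- (pi / 2)..pi / 2}"
        unfolding sin_primitive_image using that by (simp add: sin_primitive_minus[OF m(1)])
      then show ?thesis by (auto simp: sin_inverse abs_le_iff)
    qed
    show "isCont sin_inverse ?y"
      by (rule continuous_on_interior[OF continuous_on_sin_inverse]) (use y2 in simp)
  qed
  moreover have "((\<lambda>r. tan_primitive \<epsilon> m r + C) has_real_derivative tan_density \<epsilon> m r) (at r)"
    using DERIV_add[OF tan_primitive_has_derivative[OF \<epsilon> conf_pos] DERIV_const, of r] r by simp
  ultimately have "((\<lambda>r. sin_inverse (tan_primitive \<epsilon> m r + C)) has_real_derivative inverse (sin (\<theta> r) ^ m) * tan_density \<epsilon> m r) (at r)"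
    by (rule DERIV_chain2)
  then have "(\<theta> has_real_derivative inverse (sin (\<theta> r) ^ m) * tan_density \<epsilon> m r) (at r)"
    by (rule has_field_derivative_transform_within_open[of _ _ _ "{A<..<B}"]) (use r \<theta>_eq in auto)
  then show ?thesis by (simp add: \<theta>'_def divide_inverse mult.commute)
qed

lemma continuous_on_\<theta>': "continuous_on ({A..B} - {r0}) \<theta>'"
  unfolding \<theta>'_def[abs_def]
  by (intro continuous_intros continuous_on_tan_density \<epsilon> continuous_on_subset[OF continuous_on_\<theta>])
    (use conf_pos sin_\<theta>_sign(2) in auto)

lemma \<theta>'_pos: 
  assumes "A \<le> r" "r \<le> B" "r \<noteq> r0" "r \<noteq> 0" shows "0 < \<theta>' r"
proof -
  have "sin (\<theta> r) \<noteq> 0" using sin_\<theta>_sign(2)[of r] assms by simp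
  then show ?thesis unfolding \<theta>'_def using tan_density_pos[OF \<epsilon> m(1) conf_pos[of r]] assms m
    by (simp add: zero_less_power_eq)
qed

text \<open>A derivative of \<open>\<theta>\<close> at \<open>r0\<close> would make the derivative \<open>sin\<^sup>m(\<theta> r0) \<theta>'\<close> of \<open>F(\<theta>)\<close> vanish there, whereas
  that of \<open>T + C\<close> is positive as \<open>r0 \<noteq> 0\<close>.\<close>

lemma \<theta>_not_differentiable: 
  assumes "r0 \<noteq> 0"
  shows "\<not> \<theta> differentiable (at r0)"
proof
  assume "\<theta> differentiable (at r0)"
  then obtain D where D: "(\<theta> has_real_derivative D) (at r0)" by (auto simp: real_differentiable_def)
  have "((\<lambda>r. sin_primitive m (\<theta> r)) has_real_derivative sin (\<theta> r0) ^ m * D) (at r0)"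
    by (rule DERIV_chain2[OF sin_primitive_has_derivative D])
  then have "((\<lambda>r. tan_primitive \<epsilon> m r + C) has_real_derivative sin (\<theta> r0) ^ m * D) (at r0)"
    by (rule has_field_derivative_transform_within_open[of _ _ _ "{A<..<B}"]) (use ends \<theta> in auto)
  moreover have "((\<lambda>r. tan_primitive \<epsilon> m r + C) has_real_derivative tan_density \<epsilon> m r0) (at r0)"
    using DERIV_add[OF tan_primitive_has_derivative[OF \<epsilon> conf_ends(2)] DERIV_const] by simp
  ultimately have "sin (\<theta> r0) ^ m * D = tan_density \<epsilon> m r0" by (rule DERIV_unique)
  moreover have "0 < tan_density \<epsilon> m r0" by (rule tan_density_pos[OF \<epsilon> m(1) conf_ends(2) assms])
  ultimately show False using m by (simp add: \<theta>_ends zero_power)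
qed

definition \<psi>' :: "real \<Rightarrow> real" where
  "\<psi>' r = tan (\<theta> r) / conf \<epsilon> r"

lemma continuous_on_\<psi>': "continuous_on {A<..<B} \<psi>'"
proof -
  have "\<forall>r\<in>{A<..<B}. cos (\<theta> r) \<noteq> 0" "\<forall>r\<in>{A<..<B}. conf \<epsilon> r \<noteq> 0"
    using cos_\<theta> conf_pos by (auto, metis less_irrefl, metis less_irrefl less_imp_le)
  then show ?thesis unfolding \<psi>'_def[abs_def]
    by (intro continuous_intros continuous_on_subset[OF continuous_on_\<theta>]) auto
qed

lemma \<psi>'_not_differentiable:
  assumes "r0 \<noteq> 0"
  shows "\<not> \<psi>' differentiable (at r0)"
proof
  assume "\<psi>' differentiable (at r0)"
  then obtain D where D: "(\<psi>' has_real_derivative D) (at r0)" by (auto simp: real_differentiable_def)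
  from DERIV_chain2[OF DERIV_arctan DERIV_mult[OF D conf_has_derivative]]
  have "\<exists>E. ((\<lambda>r. arctan (\<psi>' r * conf \<epsilon> r)) has_real_derivative E) (at r0)" by blast
  then obtain E where "((\<lambda>r. arctan (\<psi>' r * conf \<epsilon> r)) has_real_derivative E) (at r0)" ..
  then have "(\<theta> has_real_derivative E) (at r0)"
  proof (rule has_field_derivative_transform_within_open[of _ _ _ "{A<..<B}"])
    fix r assume r: "r \<in> {A<..<B}"
    then have "\<psi>' r * conf \<epsilon> r = tan (\<theta> r)" using conf_pos[of r] by (simp add: \<psi>'_def)
    then show "arctan (\<psi>' r * conf \<epsilon> r) = \<theta> r" using \<theta>_bounds[of r] r by (simp add: arctan_tan)
  qed (use ends in auto)
  then show False using \<theta>_not_differentiable[OF assms] by (auto simp: real_differentiable_def)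
qed

lemma \<psi>'_has_derivative:
  assumes r: "A < r" "r < B" and D: "(\<theta> has_real_derivative D) (at r)"
  shows "(\<psi>' has_real_derivative (D / (cos (\<theta> r))\<^sup>2 * conf \<epsilon> r - tan (\<theta> r) * (\<epsilon> * r / 2)) / (conf \<epsilon> r * conf \<epsilon> r)) (at r)"
proof -
  have c: "cos (\<theta> r) \<noteq> 0" "conf \<epsilon> r \<noteq> 0" using cos_\<theta>[OF r] conf_pos[of r] r by auto
  have "((\<lambda>r. tan (\<theta> r)) has_real_derivative D / (cos (\<theta> r))\<^sup>2) (at r)"
    by (rule DERIV_cong[OF DERIV_chain2[OF DERIV_tan[OF c(1)] D]]) (simp add: divide_inverse)
  from DERIV_divide[OF this conf_has_derivative c(2)]
  show ?thesis by (simp only: \<psi>'_def[abs_def])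
qed

end

text \<open>The additive constant of \<open>\<psi>\<close> is left free, so that a graph can be moved vertically.\<close>

locale profile = angle_profile +
  fixes \<psi> :: "real \<Rightarrow> real"
  assumes \<psi>: "\<And>r. A < r \<Longrightarrow> r < B \<Longrightarrow> (\<psi> has_real_derivative tan (\<theta> r) / conf \<epsilon> r) (at r)"
begin

lemma \<psi>_has_derivative: "A < r \<Longrightarrow> r < B \<Longrightarrow> (\<psi> has_real_derivative \<psi>' r) (at r)"
  unfolding \<psi>'_def by (rule \<psi>)

lemma continuous_on_\<psi>: "X \<subseteq> {A<..<B} \<Longrightarrow> continuous_on X \<psi>"
  using \<psi>_has_derivative DERIV_isCont by (intro continuous_at_imp_continuous_on) fastforce

lemma \<psi>_min:
  assumes "A < r" "r < B" "r \<noteq> r0"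
  shows "\<psi> r0 < \<psi> r"
proof -
  have c: "0 < conf \<epsilon> x" if "A < x" "x < B" for x using conf_pos that by simp
  show ?thesis
  proof (cases "r0 < r")
    case True
    show ?thesis
    proof (rule DERIV_pos_imp_increasing_open[OF True])
      show "\<exists>y. (\<psi> has_real_derivative y) (at x) \<and> 0 < y" if "r0 < x" "x < r" for x
        using \<psi>[of x] tan_\<theta>_sign(1)[of x] c[of x] assms ends that by (intro exI[of _ "tan (\<theta> x) / conf \<epsilon> x"] conjI) auto
    qed (use ends assms in \<open>intro continuous_on_\<psi>, auto\<close>)
  next
    case False
    then have "r < r0" using assms by simp
    then show ?thesis
    proof (rule DERIV_neg_imp_decreasing_open)
      show "\<exists>y. (\<psi> has_real_derivative y) (at x) \<and> y < 0" if "r < x" "x < r0" for x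
        using \<psi>[of x] tan_\<theta>_sign(2)[of x] c[of x] assms ends that by (intro exI[of _ "tan (\<theta> x) / conf \<epsilon> x"] conjI) (auto simp: divide_less_0_iff)
    qed (use ends assms in \<open>intro continuous_on_\<psi>, auto\<close>)
  qed
qed

text \<open>With \<open>M\<close> a bound for \<open>\<theta>'\<close> on \<open>J\<close>, the derivative of \<open>M \<psi> + ln (cos \<theta>)\<close> is
  \<open>tan \<theta> (M / conf \<epsilon> r - \<theta>')\<close>, where the second factor is nonnegative as \<open>conf \<epsilon> r \<le> 1\<close>. So the function
  increases towards the right end and decreases away from the left end.\<close>

lemma \<psi>_ln_cos_bound:
  assumes J: "J = {A..r1} \<and> r1 < r0 \<and> A < r1 \<or> J = {r1..B} \<and> r0 < r1 \<and> r1 < B"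
  obtains M where "0 < M" "\<And>r. r \<in> J \<Longrightarrow> A < r \<Longrightarrow> r < B \<Longrightarrow> M * \<psi> r1 + ln (cos (\<theta> r1)) \<le> M * \<psi> r + ln (cos (\<theta> r))"
proof -
  have sub: "J \<subseteq> {A..B} - {r0}" and cJ: "compact J" "convex J" "r1 \<in> J" using J ends by auto
  have "compact (\<theta>' ` J)" by (intro compact_continuous_image continuous_on_subset[OF continuous_on_\<theta>' sub] cJ)
  then obtain K where K: "\<And>x. x \<in> J \<Longrightarrow> \<bar>\<theta>' x\<bar> \<le> K"
    using compact_imp_bounded bounded_iff by (metis image_eqI real_norm_def)
  \<comment> \<open>Positive as well as a bound, so that one may divide by it.\<close>
  define M where "M = max K 1"
  have M: "0 < M" "\<And>x. x \<in> J \<Longrightarrow> \<theta>' x \<le> M" using K by (auto simp: M_def) (smt (verit) max_def)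
  let ?G = "\<lambda>r. M * \<psi> r + ln (cos (\<theta> r))"
  have G: "(?G has_real_derivative tan (\<theta> r) * (M / conf \<epsilon> r - \<theta>' r)) (at r)" 
    and le: "0 \<le> M / conf \<epsilon> r - \<theta>' r" if "r \<in> J" "A < r" "r < B" for r
  proof -
    have c: "0 < cos (\<theta> r)" "0 < conf \<epsilon> r" "r \<noteq> r0" using cos_\<theta> conf_pos that sub by auto
    have "((\<lambda>r. cos (\<theta> r)) has_real_derivative - sin (\<theta> r) * \<theta>' r) (at r)"
      by (rule DERIV_chain2[OF DERIV_cos \<theta>_has_derivative]) (use that c in auto)
    from DERIV_add[OF DERIV_cmult[OF \<psi>[OF that(2,3)], of M] DERIV_chain2[OF DERIV_ln_divide[OF c(1)] this]]
    show "(?G has_real_derivative tan (\<theta> r) * (M / conf \<epsilon> r - \<theta>' r)) (at r)"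
      by (rule DERIV_cong) (simp add: tan_def algebra_simps)
    have "\<theta>' r \<le> M" using M that by simp
    also have "\<dots> \<le> M / conf \<epsilon> r" using M(1) c(2) conf_le_1[OF \<epsilon>_le, of r] by (simp add: pos_le_divide_eq)
    finally show "0 \<le> M / conf \<epsilon> r - \<theta>' r" by simp
  qed
  have "?G r1 \<le> ?G r" if r: "r \<in> J" "A < r" "r < B" for r
  proof (cases r1 r rule: linorder_cases)
    case less
    show ?thesis
    proof (rule DERIV_nonneg_imp_nondecreasing[OF less_imp_le[OF less]])
      fix x assume x: "r1 \<le> x" "x \<le> r"
      then have xJ: "x \<in> J" "A < x" "x < B" using r J ends by auto
      have "r0 \<le> x" using J r x less by auto
      then have "0 \<le> tan (\<theta> x)" using tan_\<theta>_sign(2)[OF xJ(2,3)] by linarith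
      then have "0 \<le> tan (\<theta> x) * (M / conf \<epsilon> x - \<theta>' x)" using le[OF xJ] by (rule mult_nonneg_nonneg)
      then show "\<exists>y. (?G has_real_derivative y) (at x) \<and> 0 \<le> y"
        using G[OF xJ] by blast
    qed
  next
    case greater
    show ?thesis
    proof (rule DERIV_nonpos_imp_nonincreasing[OF less_imp_le[OF greater]])
      fix x assume x: "r \<le> x" "x \<le> r1"
      then have xJ: "x \<in> J" "A < x" "x < B" using r J ends by auto
      have "x \<le> r0" using J r x greater by auto
      then have "tan (\<theta> x) \<le> 0" using tan_\<theta>_sign(1)[OF xJ(2,3)] by linarith
      then have "tan (\<theta> x) * (M / conf \<epsilon> x - \<theta>' x) \<le> 0" using le[OF xJ] by (rule mult_nonpos_nonneg)
      then show "\<exists>y. (?G has_real_derivative y) (at x) \<and> y \<le> 0"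
        using G[OF xJ] by blast
    qed
  qed simp
  with M(1) show ?thesis by (rule that)
qed

text \<open>At either end \<open>cos \<theta>\<close> tends to \<open>0\<close>, so \<open>ln (cos \<theta>)\<close> tends to \<open>- \<infinity>\<close> and the preceding bound drives \<open>\<psi>\<close>
  up.\<close>

lemma blow_up:
  obtains \<delta> where "0 < \<delta>" "\<And>r. A < r \<Longrightarrow> r < B \<Longrightarrow> r < A + \<delta> \<or> B - \<delta> < r \<Longrightarrow> h < \<psi> r"
proof -
  have *: "\<exists>\<delta>>0. \<forall>r. A < r \<and> r < B \<and> \<bar>r - b\<bar> < \<delta> \<longrightarrow> h < \<psi> r" 
    if b: "b \<in> {A, B}" and J: "J = {A..r1} \<and> r1 < r0 \<and> A < r1 \<and> b = A \<or> J = {r1..B} \<and> r0 < r1 \<and> r1 < B \<and> b = B" for b J r1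
  proof -
    obtain M where M: "0 < M" "\<And>r. r \<in> J \<Longrightarrow> A < r \<Longrightarrow> r < B \<Longrightarrow> M * \<psi> r1 + ln (cos (\<theta> r1)) \<le> M * \<psi> r + ln (cos (\<theta> r))"
      by (rule \<psi>_ln_cos_bound[of J r1]) (use J in auto)
    define L where "L = M * \<psi> r1 + ln (cos (\<theta> r1)) - M * h"
    have "continuous_on {A..B} (\<lambda>r. cos (\<theta> r))" by (intro continuous_intros continuous_on_\<theta>)
    then have "\<exists>\<delta>>0. \<forall>r\<in>{A..B}. dist r b < \<delta> \<longrightarrow> dist (cos (\<theta> r)) (cos (\<theta> b)) < exp L"
      using b ends unfolding continuous_on_iff by auto
    then obtain \<delta> where \<delta>: "0 < \<delta>" "\<And>r. r \<in> {A..B} \<Longrightarrow> \<bar>r - b\<bar> < \<delta> \<Longrightarrow> \<bar>cos (\<theta> r) - cos (\<theta> b)\<bar> < exp L"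
      by (auto simp: dist_real_def)
    have cb: "cos (\<theta> b) = 0" using b by (auto simp: \<theta>_ends)
    show ?thesis
    proof (intro exI[of _ "min \<delta> \<bar>b - r1\<bar>"] conjI allI impI)
      show "0 < min \<delta> \<bar>b - r1\<bar>" using \<delta> J by auto
      fix r assume r: "A < r \<and> r < B \<and> \<bar>r - b\<bar> < min \<delta> \<bar>b - r1\<bar>"
      have c: "0 < cos (\<theta> r)" using cos_\<theta> r by simp
      have "cos (\<theta> r) < exp L" using \<delta>(2)[of r] r cb by auto
      then have "ln (cos (\<theta> r)) < L" using c by (metis exp_gt_zero ln_exp ln_less_cancel_iff)
      moreover have "r \<in> J" using J r by auto
      ultimately have "M * h < M * \<psi> r" using M(2)[of r] r by (simp add: L_def)
      then show "h < \<psi> r" using M(1) by simp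
    qed
  qed
  obtain \<delta>A where \<delta>A: "0 < \<delta>A" "\<forall>r. A < r \<and> r < B \<and> \<bar>r - A\<bar> < \<delta>A \<longrightarrow> h < \<psi> r"
    using *[of A "{A..(A + r0) / 2}" "(A + r0) / 2"] ends by auto
  obtain \<delta>B where \<delta>B: "0 < \<delta>B" "\<forall>r. A < r \<and> r < B \<and> \<bar>r - B\<bar> < \<delta>B \<longrightarrow> h < \<psi> r"
    using *[of B "{(B + r0) / 2..B}" "(B + r0) / 2"] ends by auto
  show ?thesis
    by (rule that[of "min \<delta>A \<delta>B"]) (use \<delta>A \<delta>B in auto)
qed

end

lemma profile_exists:
  assumes \<epsilon>: "\<epsilon> \<in> {0, -1}" and m: "even m" "2 \<le> m"
  obtains A r0 B \<theta> \<psi> where "profile \<epsilon> m C A r0 B \<theta> \<psi>"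
proof -
  obtain A where A: "0 < conf \<epsilon> A" "tan_primitive \<epsilon> m A = sin_primitive m (- (pi / 2)) - C"
    using tan_primitive_surj[OF \<epsilon> m(1)] by blast
  obtain B where B: "0 < conf \<epsilon> B" "tan_primitive \<epsilon> m B = sin_primitive m (pi / 2) - C"
    using tan_primitive_surj[OF \<epsilon> m(1)] by blast
  obtain r0 where r0: "0 < conf \<epsilon> r0" "tan_primitive \<epsilon> m r0 = - C"
    using tan_primitive_surj[OF \<epsilon> m(1)] by blast
  have "\<forall>r. \<exists>t. A \<le> r \<and> r \<le> B \<longrightarrow> \<bar>t\<bar> \<le> pi / 2 \<and> sin_primitive m t = tan_primitive \<epsilon> m r + C"
  proof (intro allI)
    fix r
    show "\<exists>t. A \<le> r \<and> r \<le> B \<longrightarrow> \<bar>t\<bar> \<le> pi / 2 \<and> sin_primitive m t = tan_primitive \<epsilon> m r + C"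
    proof (cases "A \<le> r \<and> r \<le> B")
      case True
      then have "0 < conf \<epsilon> r" using conf_between[of \<epsilon> A B r] A B \<epsilon> by auto
      then have "tan_primitive \<epsilon> m A \<le> tan_primitive \<epsilon> m r" "tan_primitive \<epsilon> m r \<le> tan_primitive \<epsilon> m B"
        using tan_primitive_less_iff[OF \<epsilon> m(1), of r A] tan_primitive_less_iff[OF \<epsilon> m(1), of B r] A B True by force+
      moreover have "continuous_on {- (pi / 2)..pi / 2} (sin_primitive m)"
        by (intro continuous_at_imp_continuous_on ballI DERIV_isCont[OF sin_primitive_has_derivative])
      ultimately show ?thesis
        using IVT'[of "sin_primitive m" "- (pi / 2)" "tan_primitive \<epsilon> m r + C" "pi / 2"] A B by (force simp: abs_le_iff)
    qed auto
  qed
  then obtain \<theta> where \<theta>: "\<And>r. A \<le> r \<Longrightarrow> r \<le> B \<Longrightarrow> \<bar>\<theta> r\<bar> \<le> pi / 2 \<and> sin_primitive m (\<theta> r) = tan_primitive \<epsilon> m r + C"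
    by metis
  interpret angle_profile \<epsilon> m C A r0 B \<theta>
    by unfold_locales (use assms A B r0 \<theta> in auto)
  have "\<exists>\<psi>. \<forall>r. ereal A < ereal r \<longrightarrow> ereal r < ereal B \<longrightarrow> (\<psi> has_vector_derivative \<psi>' r) (at r)"
  proof (rule einterval_antiderivative)
    show "isCont \<psi>' r" if "ereal A < ereal r" "ereal r < ereal B" for r
      using continuous_on_\<psi>' that by (auto simp: continuous_on_eq_continuous_at)
  qed (use ends in simp)
  then obtain \<psi> where \<psi>: "\<And>r. A < r \<Longrightarrow> r < B \<Longrightarrow> (\<psi> has_real_derivative \<psi>' r) (at r)"
    by (auto simp: has_real_derivative_iff_has_vector_derivative)
  have "profile \<epsilon> m C A r0 B \<theta> \<psi>"
    by unfold_locales (use \<psi> in \<open>simp add: \<psi>'_def\<close>)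
  then show ?thesis by (rule that)
qed

section \<open>Profiles with their minimum on the axis\<close>

text \<open>L'Hopital: a function whose derivative is asymptotic to \<open>x\<^sup>m\<close> is asymptotic to \<open>x\<^sup>m\<^sup>+\<^sup>1 / (m + 1)\<close>. It
  serves to compare \<open>F\<close> and \<open>T\<close> at \<open>0\<close>.\<close>

lemma tendsto_primitive_ratio:
  fixes f :: "real \<Rightarrow> real"
  assumes f: "\<forall>\<^sub>F x in at 0. (f has_real_derivative f' x) (at x)" and f0: "(f \<longlongrightarrow> 0) (at 0)"
    and lim: "((\<lambda>x. f' x / x ^ m) \<longlongrightarrow> 1) (at 0)"
  shows "((\<lambda>x. f x / x ^ Suc m) \<longlongrightarrow> 1 / Suc m) (at 0)"
proof (rule lhopital[OF f0 _ _ _ f])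
  show "((\<lambda>x::real. x ^ Suc m) \<longlongrightarrow> 0) (at 0)"
    by (rule tendsto_eq_intros refl)+ simp
  have ne: "\<forall>\<^sub>F x::real in at 0. x \<noteq> 0" by (simp add: eventually_at_filter)
  show "\<forall>\<^sub>F x::real in at 0. x ^ Suc m \<noteq> 0" "\<forall>\<^sub>F x::real in at 0. real (Suc m) * x ^ m \<noteq> 0"
    by (rule eventually_mono[OF ne]; simp)+
  show "\<forall>\<^sub>F x in at 0. ((\<lambda>x. x ^ Suc m) has_real_derivative real (Suc m) * x ^ m) (at x)"
    using DERIV_pow[of "Suc m"] by (intro eventuallyI) simp
  have "((\<lambda>x. (1 / Suc m) * (f' x / x ^ m)) \<longlongrightarrow> (1 / Suc m) * 1) (at 0)"
    by (intro tendsto_mult tendsto_const lim)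
  then show "((\<lambda>x. f' x / (real (Suc m) * x ^ m)) \<longlongrightarrow> 1 / Suc m) (at 0)" by (simp add: field_simps)
qed

lemma sin_over_self_tendsto_1: "((\<lambda>x. sin x / x) \<longlongrightarrow> 1) (at (0::real))"
  using DERIV_sin[of "0::real"] by (simp add: DERIV_def)

context angle_profile
begin

text \<open>The profile of the bowl: by oddness of the primitives it is symmetric about its minimum.\<close>

lemma centered:
  assumes "r0 = 0"
  shows "C = 0" "A = - B" "0 < B"
proof -
  show C: "C = 0" using T_r0 assms by simp
  show "0 < B" using ends assms by simp
  have "tan_primitive \<epsilon> m (- B) = tan_primitive \<epsilon> m A"
    using T_A T_B C by (simp add: tan_primitive_minus[OF m(1)] sin_primitive_minus[OF m(1)])
  then show "A = - B" using tan_primitive_eq_iff[OF \<epsilon> m(1), of "- B" A] conf_ends by simp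
qed

text \<open>Both sides of \<open>F(\<theta>) = T(r)\<close> are asymptotic to the \<open>(m + 1)\<close>-st power of their argument divided by
  \<open>m + 1\<close>, and \<open>m + 1\<close> is odd, so roots may be extracted for either sign of \<open>r\<close>.\<close>

lemma \<theta>_ratio:
  assumes "r0 = 0"
  shows "((\<lambda>r. \<theta> r / r) \<longlongrightarrow> 1) (at 0)"
proof -
  note c = centered[OF assms]
  have ev: "\<forall>\<^sub>F r in at 0. A < r \<and> r < B \<and> r \<noteq> (0::real)"
    using c eventually_at_in_open'[of "{A<..<B}" 0] by (auto simp: eventually_at_filter elim: eventually_mono)
  have \<theta>0: "(\<theta> \<longlongrightarrow> 0) (at 0)" using isCont_\<theta>[of 0] c assms \<theta>_ends(2) by (simp add: isCont_def)
  have \<theta>n: "\<theta> r \<noteq> 0" if "A < r" "r < B" "r \<noteq> 0" for r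
    using \<theta>_sign[of r] that assms by (cases "0 < r") auto
  have "\<forall>\<^sub>F r in at 0. \<theta> r \<noteq> 0"
    using ev by eventually_elim (use \<theta>n in auto)
  with \<theta>0 have fl: "filterlim \<theta> (at 0) (at 0)" by (auto simp: filterlim_at)
  have "((\<lambda>x::real. (sin x / x) ^ m) \<longlongrightarrow> 1 ^ m) (at 0)"
    by (intro tendsto_power sin_over_self_tendsto_1)
  then have "((\<lambda>x. sin_primitive m x / x ^ Suc m) \<longlongrightarrow> 1 / Suc m) (at 0)"
    using DERIV_isCont[OF sin_primitive_has_derivative[of m 0]]
    by (intro tendsto_primitive_ratio[where f' = "\<lambda>x. sin x ^ m"] eventuallyI sin_primitive_has_derivative)
      (simp_all add: isCont_def power_divide)
  then have 1: "((\<lambda>r. sin_primitive m (\<theta> r) / \<theta> r ^ Suc m) \<longlongrightarrow> 1 / Suc m) (at 0)"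
    by (rule filterlim_compose[OF _ fl])
  have "((\<lambda>r. 1 / ((1 - \<epsilon> * r\<^sup>2 / 4) ^ m * conf \<epsilon> r)) \<longlongrightarrow> 1 / ((1 - \<epsilon> * 0\<^sup>2 / 4) ^ m * conf \<epsilon> 0)) (at 0)"
    unfolding conf_def by (intro tendsto_intros) auto
  then have "((\<lambda>r. 1 / ((1 - \<epsilon> * r\<^sup>2 / 4) ^ m * conf \<epsilon> r)) \<longlongrightarrow> 1) (at 0)" by simp
  moreover have "\<forall>\<^sub>F r in at 0. 1 / ((1 - \<epsilon> * r\<^sup>2 / 4) ^ m * conf \<epsilon> r) = tan_density \<epsilon> m r / r ^ m"
    by (auto simp: eventually_at_filter tan_density_def power_divide)
  ultimately have "((\<lambda>r. tan_density \<epsilon> m r / r ^ m) \<longlongrightarrow> 1) (at 0)"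
    by (rule Lim_transform_eventually)
  moreover have "\<forall>\<^sub>F r in at 0. (tan_primitive \<epsilon> m has_real_derivative tan_density \<epsilon> m r) (at r)"
    using ev by eventually_elim (intro tan_primitive_has_derivative \<epsilon> conf_pos; simp)
  moreover have "(tan_primitive \<epsilon> m \<longlongrightarrow> 0) (at 0)"
    using DERIV_isCont[OF tan_primitive_has_derivative[OF \<epsilon>, of 0 m]] by (simp add: isCont_def)
  ultimately have 2: "((\<lambda>r. tan_primitive \<epsilon> m r / r ^ Suc m) \<longlongrightarrow> 1 / Suc m) (at 0)"
    by (intro tendsto_primitive_ratio)
  have "((\<lambda>r. (tan_primitive \<epsilon> m r / r ^ Suc m) / (sin_primitive m (\<theta> r) / \<theta> r ^ Suc m)) \<longlongrightarrow> (1 / Suc m) / (1 / Suc m)) (at 0)"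
    by (intro tendsto_divide 1 2) simp
  moreover have "\<forall>\<^sub>F r in at 0. (tan_primitive \<epsilon> m r / r ^ Suc m) / (sin_primitive m (\<theta> r) / \<theta> r ^ Suc m) = (\<theta> r / r) ^ Suc m"
    using ev
  proof eventually_elim
    case (elim r)
    then have "sin_primitive m (\<theta> r) = tan_primitive \<epsilon> m r" using \<theta>[of r] c by simp
    moreover have "tan_primitive \<epsilon> m r \<noteq> 0"
      using tan_primitive_eq_iff[OF \<epsilon> m(1) conf_pos[of r], of 0] elim by simp
    ultimately show ?case using \<theta>n elim by (simp add: power_divide del: power_Suc)
  qed
  ultimately have "((\<lambda>r. (\<theta> r / r) ^ Suc m) \<longlongrightarrow> 1) (at 0)"
    by (simp add: Lim_transform_eventually del: power_Suc)
  \<comment> \<open>Since \<open>Suc m\<close> is odd, the root undoes the power for negative arguments too.\<close>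
  then have "((\<lambda>r. root (Suc m) ((\<theta> r / r) ^ Suc m)) \<longlongrightarrow> root (Suc m) 1) (at 0)"
    by (rule tendsto_real_root)
  then show ?thesis using m by (simp add: odd_real_root_power_cancel del: power_Suc)
qed

lemma \<theta>_has_derivative_0:
  assumes "r0 = 0"
  shows "(\<theta> has_real_derivative 1) (at 0)"
  using \<theta>_ratio[OF assms] \<theta>_ends(2) assms by (simp add: DERIV_def)

lemma \<theta>'_tendsto_1:
  assumes "r0 = 0"
  shows "(\<theta>' \<longlongrightarrow> 1) (at 0)"
proof -
  note c = centered[OF assms]
  have ev: "\<forall>\<^sub>F r in at 0. A < r \<and> r < B \<and> r \<noteq> (0::real)"
    using c eventually_at_in_open'[of "{A<..<B}" 0] by (auto simp: eventually_at_filter elim: eventually_mono)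
  have \<theta>n: "\<theta> r \<noteq> 0" if "A < r" "r < B" "r \<noteq> 0" for r
    using \<theta>_sign[of r] that assms by (cases "0 < r") auto
  have "(\<theta> \<longlongrightarrow> 0) (at 0)" using isCont_\<theta>[of 0] c assms \<theta>_ends(2) by (simp add: isCont_def)
  moreover have "\<forall>\<^sub>F r in at 0. \<theta> r \<noteq> 0"
    using ev by eventually_elim (use \<theta>n in auto)
  ultimately have fl: "filterlim \<theta> (at 0) (at 0)" by (auto simp: filterlim_at)
  have s: "((\<lambda>r. sin (\<theta> r) / \<theta> r) \<longlongrightarrow> 1) (at 0)"
    by (rule filterlim_compose[OF sin_over_self_tendsto_1 fl])
  have "((\<lambda>r. 1 / (((1 - \<epsilon> * r\<^sup>2 / 4) ^ m * conf \<epsilon> r) * ((\<theta> r / r) * (sin (\<theta> r) / \<theta> r)) ^ m)) \<longlongrightarrow>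
      1 / (((1 - \<epsilon> * 0\<^sup>2 / 4) ^ m * conf \<epsilon> 0) * (1 * 1) ^ m)) (at 0)"
    unfolding conf_def by (intro tendsto_intros s \<theta>_ratio assms) auto
  then have "((\<lambda>r. 1 / (((1 - \<epsilon> * r\<^sup>2 / 4) ^ m * conf \<epsilon> r) * ((\<theta> r / r) * (sin (\<theta> r) / \<theta> r)) ^ m)) \<longlongrightarrow> 1) (at 0)"
    by simp
  moreover have "\<forall>\<^sub>F r in at 0. 1 / (((1 - \<epsilon> * r\<^sup>2 / 4) ^ m * conf \<epsilon> r) * ((\<theta> r / r) * (sin (\<theta> r) / \<theta> r)) ^ m) = \<theta>' r"
    using ev
  proof eventually_elim
    case (elim r)
    then have "(\<theta> r / r) * (sin (\<theta> r) / \<theta> r) = sin (\<theta> r) / r" using \<theta>n by simp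
    then show ?case by (simp add: \<theta>'_def tan_density_def power_divide)
  qed
  ultimately show ?thesis by (rule Lim_transform_eventually)
qed

end

section \<open>Translators swept out by profiles\<close>

context profile
begin

lemma \<psi>_strict_mono:
  assumes "r0 \<le> r" "r < s" "s < B"
  shows "\<psi> r < \<psi> s"
proof (rule DERIV_pos_imp_increasing_open[OF assms(2)])
  show "\<exists>y. (\<psi> has_real_derivative y) (at x) \<and> 0 < y" if x: "r < x" "x < s" for x
    using \<psi>[of x] tan_\<theta>_sign(1)[of x] conf_pos[of x] assms ends x
    by (intro exI[of _ "tan (\<theta> x) / conf \<epsilon> x"] conjI) auto
qed (use ends assms in \<open>intro continuous_on_\<psi>, auto\<close>)

lemma C1_on_graph: "C1_on ({x::'a::real_inner. norm x \<in> {A<..<B}} - {0}) (\<lambda>x. \<psi> (norm x))"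
  by (rule C1_on_radial[where f' = \<psi>'])
    (auto intro: \<psi>_has_derivative continuous_on_subset[OF continuous_on_\<psi>'])

text \<open>The second derivative of the profile. For \<open>r0 = 0\<close> the quotient defining \<open>\<theta>'\<close> is \<open>0 / 0\<close> at the origin, and its
  limit \<open>1\<close> has to be inserted.\<close>

definition \<psi>'' :: "real \<Rightarrow> real" where
  "\<psi>'' r = ((if r = 0 \<and> r0 = 0 then 1 else \<theta>' r) / (cos (\<theta> r))\<^sup>2 * conf \<epsilon> r - tan (\<theta> r) * (\<epsilon> * r / 2)) / (conf \<epsilon> r * conf \<epsilon> r)"

lemma \<psi>'_has_derivative':
  assumes "A < r" "r < B" "r \<noteq> r0 \<or> r0 = 0"
  shows "(\<psi>' has_real_derivative \<psi>'' r) (at r)"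
  unfolding \<psi>''_def
proof (rule \<psi>'_has_derivative[OF assms(1,2)])
  show "(\<theta> has_real_derivative (if r = 0 \<and> r0 = 0 then 1 else \<theta>' r)) (at r)"
    using \<theta>_has_derivative[OF assms(1,2)] \<theta>_has_derivative_0 assms(3) by auto
qed

lemma continuous_on_\<psi>'': 
  assumes "X \<subseteq> {A<..<B}" "continuous_on X (\<lambda>r. if r = 0 \<and> r0 = 0 then 1 else \<theta>' r)"
  shows "continuous_on X \<psi>''"
proof -
  have "\<forall>r\<in>X. cos (\<theta> r) \<noteq> 0" "\<forall>r\<in>X. conf \<epsilon> r \<noteq> 0"
    using cos_\<theta> conf_pos assms(1) by (metis greaterThanLessThan_iff less_irrefl subsetD, metis greaterThanLessThan_iff less_irrefl less_imp_le subsetD)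
  then show ?thesis unfolding \<psi>''_def[abs_def]
    by (intro continuous_intros assms(2) continuous_on_subset[OF continuous_on_\<theta>]) (use assms(1) in auto)
qed

lemma C2_on_graph: "C2_on ({x::'a::real_inner. norm x \<in> {A<..<B} - {r0}} - {0}) (\<lambda>x. \<psi> (norm x))"
proof (rule C2_on_radial[where f' = \<psi>' and f'' = \<psi>''])
  have "continuous_on ({A<..<B} - {r0} - {0}) \<theta>'"
    by (rule continuous_on_subset[OF continuous_on_\<theta>']) auto
  then have "continuous_on ({A<..<B} - {r0} - {0}) (\<lambda>r. if r = 0 \<and> r0 = 0 then 1 else \<theta>' r)"
    by (rule continuous_on_eq) auto
  then show "continuous_on ({A<..<B} - {r0} - {0}) \<psi>''"
    by (intro continuous_on_\<psi>'') auto
qed (auto intro: \<psi>_has_derivative \<psi>'_has_derivative')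

lemma C2_on_centered_graph:
  assumes "r0 = 0"
  shows "C2_on {x::'a::real_inner. norm x < B} (\<lambda>x. \<psi> (norm x))"
proof (rule C2_on_radial_even[where f' = \<psi>' and f'' = \<psi>''])
  note c = centered[OF assms]
  show "0 < B" by fact
  show "(\<psi> has_real_derivative \<psi>' r) (at r)" "(\<psi>' has_real_derivative \<psi>'' r) (at r)" if "\<bar>r\<bar> < B" for r
  proof -
    have r: "A < r" "r < B" using that unfolding c(2) by auto
    show "(\<psi> has_real_derivative \<psi>' r) (at r)" by (rule \<psi>_has_derivative[OF r])
    show "(\<psi>' has_real_derivative \<psi>'' r) (at r)" by (rule \<psi>'_has_derivative'[OF r disjI2[OF assms]])
  qed
  show "\<psi>' 0 = 0" using \<theta>_ends(2) assms by (simp add: \<psi>'_def)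
  have "continuous_on {-B<..<B} (\<lambda>r. if r = 0 \<and> r0 = 0 then 1 else \<theta>' r)"
    unfolding continuous_on_eq_continuous_at[OF open_greaterThanLessThan]
  proof
    fix r assume r: "r \<in> {-B<..<B}"
    let ?g = "\<lambda>r. if r = 0 \<and> r0 = 0 then 1 else \<theta>' r"
    show "isCont ?g r"
    proof (cases "r = 0")
      case True
      have "(?g \<longlongrightarrow> 1) (at 0)"
        by (rule Lim_transform_eventually[OF \<theta>'_tendsto_1[OF assms]]) (simp add: eventually_at_filter)
      then show ?thesis using True assms by (simp add: isCont_def)
    next
      case False
      have "continuous_on ({-B<..<B} - {0}) \<theta>'"
        by (rule continuous_on_subset[OF continuous_on_\<theta>']) (use c assms in auto)
      then have "continuous_on ({-B<..<B} - {0}) ?g" by (rule continuous_on_eq) auto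
      moreover have "open ({-B<..<B} - {0::real})" by (intro open_Diff) auto
      ultimately show ?thesis using False r continuous_on_eq_continuous_at by blast
    qed
  qed
  then show "continuous_on {-B<..<B} \<psi>''" by (intro continuous_on_\<psi>'') (use c in auto)
qed

context
  fixes S :: "((real^'n) \<times> real) set" and N p
  assumes sheet: "rot_sheet \<epsilon> S N p \<psi> \<theta>" and r: "A < norm (fst p)" "norm (fst p) < B"
    and origin: "fst p = 0 \<Longrightarrow> r0 = 0" and card: "CARD('n) = Suc m"
begin

lemma sheet_hypersurface_C1: "hypersurface_at C1_on S p"
proof -
  obtain U where U: "p \<in> S" "open U" "p \<in> U" "\<And>q. q \<in> U \<Longrightarrow> q \<in> S \<longleftrightarrow> snd q = \<psi> (norm (fst q))"
    using sheet by (auto simp: rot_sheet_def)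
  show ?thesis
  proof (cases "fst p = 0")
    case True
    have "open {x::real^'n. norm x < B}" by (intro open_Collect_less continuous_intros)
    then show ?thesis
      by (rule hypersurface_graph(1)[OF _ _ U(2,3,1,4) C2_on_imp_C1_on[OF C2_on_centered_graph]])
        (use origin True r in auto)
  next
    case False
    have "open ({x::real^'n. norm x \<in> {A<..<B}} - {0})"
      by (intro open_Diff open_radial) auto
    then show ?thesis
      by (rule hypersurface_graph(1)[OF _ _ U(2,3,1,4) C1_on_graph]) (use False r in auto)
  qed
qed

lemma sheet_hypersurface_C2: 
  assumes "norm (fst p) \<noteq> r0 \<or> fst p = 0"
  shows "hypersurface_at C2_on S p"
proof -
  obtain U where U: "p \<in> S" "open U" "p \<in> U" "\<And>q. q \<in> U \<Longrightarrow> q \<in> S \<longleftrightarrow> snd q = \<psi> (norm (fst q))"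
    using sheet by (auto simp: rot_sheet_def)
  show ?thesis
  proof (cases "fst p = 0")
    case True
    have "open {x::real^'n. norm x < B}" by (intro open_Collect_less continuous_intros)
    then show ?thesis
      by (rule hypersurface_graph(2)[OF _ _ U(2,3,1,4) C2_on_centered_graph])
        (use origin True r in auto)
  next
    case False
    have "open ({x::real^'n. norm x \<in> {A<..<B} - {r0}} - {0})"
      by (intro open_Diff open_radial) auto
    then show ?thesis
      by (rule hypersurface_graph(2)[OF _ _ U(2,3,1,4) C2_on_graph]) (use False r assms in auto)
  qed
qed

lemma sheet_not_hypersurface_C2:
  assumes "norm (fst p) = r0" "fst p \<noteq> 0"
  shows "\<not> hypersurface_at C2_on S p"
proof
  assume C2: "hypersurface_at C2_on S p"
  obtain U where U: "p \<in> S" "open U" "p \<in> U" "\<And>q. q \<in> U \<Longrightarrow> q \<in> S \<longleftrightarrow> snd q = \<psi> (norm (fst q))"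
    using sheet by (auto simp: rot_sheet_def)
  have "\<psi>' differentiable (at (norm (fst p)))"
    by (rule C2_hypersurface_profile_differentiable[OF U(2,3,1,4) assms(2) _ _ _ _ C2, of "{A<..<B}"])
      (use r \<psi>_has_derivative \<theta>_ends assms in \<open>auto simp: \<psi>'_def\<close>)
  then show False using \<psi>'_not_differentiable assms by auto
qed

lemma sheet_unit_normal:
  "QR_metric \<epsilon> p (N p) (N p) = 1" "v \<in> tangent_space S p \<Longrightarrow> QR_metric \<epsilon> p (N p) v = 0"
  "angle_function \<epsilon> N p = cos (\<theta> (norm (fst p)))"
proof -
  have 0: "\<theta> 0 = 0" if "fst p = 0" using origin[OF that] \<theta>_ends(2) by simp
  note n = rot_sheet_unit_normal[OF sheet \<psi>[OF r] cos_\<theta>[OF r] conf_pos[OF less_imp_le[OF r(1)] less_imp_le[OF r(2)]] 0]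
  show "QR_metric \<epsilon> p (N p) (N p) = 1" by (rule n(1))
  show "v \<in> tangent_space S p \<Longrightarrow> QR_metric \<epsilon> p (N p) v = 0" by (rule n(2))
  show "angle_function \<epsilon> N p = cos (\<theta> (norm (fst p)))" by (rule n(3))
qed

lemma sheet_normal_continuous: "continuous (at p within S) N"
proof -
  have "isCont (rot_normal \<epsilon> \<theta>) (fst p)"
  proof (cases "fst p = 0")
    case True
    have "\<theta> 0 = 0" using origin[OF True] \<theta>_ends(2) by simp
    from has_derivative_continuous[OF rot_normal_has_derivative_0[OF \<theta>_has_derivative_0[OF origin[OF True]] this]]
    show ?thesis by (simp only: True)
  next
    case False
    have "isCont (\<lambda>x. \<theta> (norm x)) (fst p)"
      by (rule isCont_o2[where f = norm and g = \<theta>]) (auto intro: isCont_\<theta>[OF r])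
    then show ?thesis unfolding rot_normal_def[abs_def] conf_def
      by (intro continuous_intros) (use False in auto)
  qed
  then have "isCont (\<lambda>q. rot_normal \<epsilon> \<theta> (fst q)) p" by (intro isCont_o2[where f = fst and g = "rot_normal \<epsilon> \<theta>"]) auto
  then have "((\<lambda>q. rot_normal \<epsilon> \<theta> (fst q)) \<longlongrightarrow> rot_normal \<epsilon> \<theta> (fst p)) (at p within S)"
    unfolding isCont_def by (rule tendsto_within_subset) simp
  moreover obtain U where U: "p \<in> S" "open U" "p \<in> U" "\<forall>q\<in>S \<inter> U. N q = rot_normal \<epsilon> \<theta> (fst q)"
    using sheet by (auto simp: rot_sheet_def)
  then have "\<forall>\<^sub>F q in at p within S. rot_normal \<epsilon> \<theta> (fst q) = N q"
    unfolding eventually_at_topological by (intro exI[of _ U]) auto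
  ultimately have "(N \<longlongrightarrow> rot_normal \<epsilon> \<theta> (fst p)) (at p within S)"
    by (rule Lim_transform_eventually)
  then show ?thesis using U by (simp add: continuous_within)
qed

text \<open>The product of the curvatures is \<open>c cos \<theta> \<theta>'\<close> times the \<open>m\<close>-th power of \<open>(1 - \<epsilon> r\<^sup>2 / 4) / r sin \<theta>\<close>, and the
  profile equation makes everything but \<open>cos \<theta>\<close> cancel.\<close>

lemma sheet_curvature:
  assumes "norm (fst p) \<noteq> r0 \<or> fst p = 0"
  shows "\<exists>k. principal_curvatures \<epsilon> S N p k \<and> (\<Prod>i\<in>UNIV. k i) = angle_function \<epsilon> N p \<and>
    (r0 \<le> norm (fst p) \<longrightarrow> (\<forall>i. 0 < k i))"
proof (cases "fst p = 0")
  case True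
  then have r0: "r0 = 0" "\<theta> 0 = 0" using origin \<theta>_ends(2) by auto
  have "(\<psi> has_real_derivative 0) (at 0)" using \<psi>[of 0] ends r0 by simp
  then show ?thesis
    using rot_sheet_principal_curvatures_0[OF sheet True \<theta>_has_derivative_0[OF r0(1)] r0(2)] sheet_unit_normal(3) True r0
    by (intro exI[of _ "\<lambda>_. 1"]) simp
next
  case False
  define \<rho> where "\<rho> = norm (fst p)"
  have \<rho>: "0 < \<rho>" "A < \<rho>" "\<rho> < B" "\<rho> \<noteq> r0" using r assms False by (auto simp: \<rho>_def)
  have s: "sin (\<theta> \<rho>) \<noteq> 0" using sin_\<theta>_sign(2)[of \<rho>] \<rho> by simp
  have c: "0 < conf \<epsilon> \<rho>" "0 < cos (\<theta> \<rho>)" "0 < 1 - \<epsilon> * \<rho>\<^sup>2 / 4"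
    using conf_pos cos_\<theta> \<rho> denominator_pos[OF \<epsilon>_le] by auto
  fix k0 :: 'n
  let ?k = "\<lambda>i. if i = k0 then conf \<epsilon> \<rho> * cos (\<theta> \<rho>) * \<theta>' \<rho> else (1 - \<epsilon> * \<rho>\<^sup>2 / 4) / \<rho> * sin (\<theta> \<rho>)"
  have 1: "principal_curvatures \<epsilon> S N p ?k"
    using rot_sheet_principal_curvatures[OF sheet False \<theta>_has_derivative \<psi> cos_\<theta> conf_pos] \<rho> unfolding \<rho>_def by simp
  have "(\<Prod>i\<in>UNIV. ?k i) = ?k k0 * (\<Prod>i\<in>UNIV - {k0}. ?k i)" by (rule prod.remove) auto
  also have "(\<Prod>i\<in>UNIV - {k0}. ?k i) = (\<Prod>i\<in>UNIV - {k0}. (1 - \<epsilon> * \<rho>\<^sup>2 / 4) / \<rho> * sin (\<theta> \<rho>))"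
    by (rule prod.cong) auto
  also have "\<dots> = ((1 - \<epsilon> * \<rho>\<^sup>2 / 4) / \<rho> * sin (\<theta> \<rho>)) ^ m" using card by simp
  also have "?k k0 * \<dots> = cos (\<theta> \<rho>)"
    using c s \<rho> by (simp add: \<theta>'_def tan_density_def power_divide power_mult_distrib)
  finally have 2: "(\<Prod>i\<in>UNIV. ?k i) = angle_function \<epsilon> N p" by (simp add: sheet_unit_normal(3) \<rho>_def)
  have "0 < ?k i" if "r0 \<le> \<rho>" for i
    using sin_\<theta>_sign(1)[of \<rho>] \<theta>'_pos[of \<rho>] that \<rho> c by simp
  with 1 2 show ?thesis unfolding \<rho>_def by blast
qed

text \<open>In the chart \<open>x \<mapsto> (x, \<psi>(norm x))\<close> the set \<open>L\<close> lies over a sphere.\<close>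

lemma sheet_null:
  assumes x0: "fst p \<noteq> 0" and L: "\<And>q. q \<in> L \<Longrightarrow> norm (fst q) = \<rho>"
  shows "\<exists>U (V :: (real^'n) set) f h. open U \<and> p \<in> U \<and> C1_on V f \<and> (\<forall>x\<in>V. inj (frechet_derivative f (at x))) \<and>
     homeomorphism V (S \<inter> U) f h \<and> negligible {x \<in> V. f x \<in> L}"
proof -
  obtain U where U: "p \<in> S" "open U" "p \<in> U" "\<And>q. q \<in> U \<Longrightarrow> q \<in> S \<longleftrightarrow> snd q = \<psi> (norm (fst q))"
    using sheet unfolding rot_sheet_def by blast
  define f where "f x = (x, \<psi> (norm x))" for x :: "real^'n"
  define D where "D = {x::real^'n. norm x \<in> {A<..<B}} - {0}"
  have D: "open D" unfolding D_def by (intro open_Diff open_radial) auto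
  obtain u' where u': "\<And>x. x \<in> D \<Longrightarrow> ((\<lambda>x. \<psi> (norm x)) has_derivative blinfun_apply (u' x)) (at x)" "continuous_on D u'"
    using C1_on_graph unfolding C1_on_def D_def by blast
  have df: "(f has_derivative (\<lambda>w. (w, u' x w))) (at x)" if "x \<in> D" for x
    unfolding f_def[abs_def] by (intro has_derivative_Pair has_derivative_ident u' that)
  have cf: "continuous_on D f" using df has_derivative_continuous by (intro continuous_at_imp_continuous_on) blast
  have oV: "open (D \<inter> f -` U)" by (rule continuous_open_preimage[OF cf D U(2)])
  let ?V = "D \<inter> f -` U" and ?U = "U \<inter> fst -` D"
  have C1: "C1_on ?V f"
  proof -
    define i1 :: "(real^'n) \<Rightarrow>\<^sub>L ((real^'n) \<times> real)" where "i1 = Blinfun (\<lambda>w. (w, 0))"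
    define i2 :: "real \<Rightarrow>\<^sub>L ((real^'n) \<times> real)" where "i2 = Blinfun (\<lambda>t. (0, t))"
    have i: "blinfun_apply i1 = (\<lambda>w. (w, 0))" "blinfun_apply i2 = (\<lambda>t. (0, t))"
      unfolding i1_def i2_def
      by (intro bounded_linear_Blinfun_apply bounded_linear_Pair bounded_linear_ident bounded_linear_zero)+
    show ?thesis
    proof (rule C1_onI[where f' = "\<lambda>x. i1 + (i2 o\<^sub>L u' x)", OF oV])
      fix x assume "x \<in> ?V"
      then show "(f has_derivative blinfun_apply (i1 + (i2 o\<^sub>L u' x))) (at x)"
        by (intro has_derivative_eq_rhs[OF df]) (auto simp: blinfun.add_left i)
    next
      show "continuous_on ?V (\<lambda>x. i1 + (i2 o\<^sub>L u' x))"
        by (intro continuous_intros continuous_on_subset[OF u'(2)]) auto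
    qed
  qed
  have "inj (frechet_derivative f (at x))" if "x \<in> ?V" for x
    unfolding frechet_derivative_at[OF df, symmetric, of x, OF IntD1[OF that]] by (rule injI) simp
  moreover have "homeomorphism ?V (S \<inter> ?U) f fst"
  proof (rule homeomorphismI)
    show "continuous_on ?V f" using cf by (rule continuous_on_subset) auto
    show "continuous_on (S \<inter> ?U) fst" by (intro continuous_intros)
    show "f ` ?V \<subseteq> S \<inter> ?U" using U(4) by (auto simp: f_def)
    show "fst ` (S \<inter> ?U) \<subseteq> ?V" using U(4) by (auto simp: f_def)
    show "f (fst q) = q" if "q \<in> S \<inter> ?U" for q using U(4)[of q] that by (auto simp: f_def prod_eq_iff)
  qed (simp add: f_def)
  moreover have "negligible {x \<in> ?V. f x \<in> L}"
    by (rule negligible_subset[OF negligible_sphere[of 0 \<rho>]]) (use L in \<open>fastforce simp: f_def\<close>)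
  moreover have "open ?U" "p \<in> ?U" using U D r x0 by (auto simp: D_def intro!: open_Int open_vimage_fst)
  ultimately show ?thesis using C1 by blast
qed

end

end

text \<open>All the conditions on a translator are local, so each point may be described by a profile of its own; the
  two sheets of a cone use different ones.\<close>

lemma n_translator_of_sheets:
  fixes S :: "((real^'n) \<times> real) set"
  assumes S: "S \<subseteq> QR_space \<epsilon>" "L \<subseteq> S" and card: "CARD('n) = Suc m"
    and sheets: "\<And>p. p \<in> S \<Longrightarrow> \<exists>C A r0 B \<theta> \<psi>. profile \<epsilon> m C A r0 B \<theta> \<psi> \<and> rot_sheet \<epsilon> S N p \<psi> \<theta> \<and>
       A < norm (fst p) \<and> norm (fst p) < B \<and> (fst p = 0 \<longrightarrow> r0 = 0) \<and>
       (p \<in> L \<longleftrightarrow> norm (fst p) = r0 \<and> fst p \<noteq> 0)"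
    and L: "\<And>q. q \<in> L \<Longrightarrow> norm (fst q) = \<rho>"
  shows "n_translator \<epsilon> S N L"
proof -
  have *: "hypersurface_at C1_on S p \<and> (p \<notin> L \<longrightarrow> hypersurface_at C2_on S p) \<and> (p \<in> L \<longrightarrow> \<not> hypersurface_at C2_on S p) \<and>
      continuous (at p within S) N \<and> QR_metric \<epsilon> p (N p) (N p) = 1 \<and> (\<forall>v\<in>tangent_space S p. QR_metric \<epsilon> p (N p) v = 0) \<and>
      (p \<notin> L \<longrightarrow> (\<exists>k. principal_curvatures \<epsilon> S N p k \<and> (\<Prod>i\<in>UNIV. k i) = angle_function \<epsilon> N p)) \<and>
      (p \<in> L \<longrightarrow> (\<exists>U (V :: (real^'n) set) f h. open U \<and> p \<in> U \<and> C1_on V f \<and> (\<forall>x\<in>V. inj (frechet_derivative f (at x))) \<and>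
       homeomorphism V (S \<inter> U) f h \<and> negligible {x \<in> V. f x \<in> L}))"
    if p: "p \<in> S" for p
  proof -
    obtain C A r0 B \<theta> \<psi> where P: "profile \<epsilon> m C A r0 B \<theta> \<psi>" and sh: "rot_sheet \<epsilon> S N p \<psi> \<theta>"
      and r: "A < norm (fst p)" "norm (fst p) < B" and o: "fst p = 0 \<Longrightarrow> r0 = 0"
      and pL: "p \<in> L \<longleftrightarrow> norm (fst p) = r0 \<and> fst p \<noteq> 0"
      using sheets[OF p] by blast
    interpret profile \<epsilon> m C A r0 B \<theta> \<psi> by (rule P)
    note facts = sh r o card
    have n: "norm (fst p) \<noteq> r0 \<or> fst p = 0" if "p \<notin> L" using that pL by blast
    show ?thesis
      using sheet_hypersurface_C1[OF facts] sheet_hypersurface_C2[OF facts n] sheet_not_hypersurface_C2[OF facts]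
        sheet_normal_continuous[OF facts] sheet_unit_normal[OF facts] sheet_curvature[OF facts n] sheet_null[OF facts _ L, of L]
        pL by (intro conjI impI ballI) blast+
  qed
  then show ?thesis
    unfolding n_translator_def C2_singular_on_def embedded_C1_hypersurface_def unit_normal_field_def
      null_in_hypersurface_def continuous_on_eq_continuous_within
    using S by (intro conjI ballI) blast+
qed

section \<open>Shape of the rotated profile\<close>

text \<open>Rotations preserve the norm, and the transposed matrix provides preimages.\<close>

lemma rotationalI:
  fixes S :: "((real^'n) \<times> real) set"
  assumes "\<And>x y t. norm x = norm y \<Longrightarrow> (x, t) \<in> S \<Longrightarrow> (y, t) \<in> S"
  shows "rotational S"
  unfolding rotational_def
proof (intro allI impI)
  fix M :: "real^'n^'n" assume "rotation_matrix M"
  then have M: "orthogonal_matrix M" by (simp add: rotation_matrix_def)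
  have n: "norm (M *v x) = norm x" if "orthogonal_matrix M" for x and M :: "real^'n^'n"
    using orthogonal_transformation_matrix[of "(*v) M"] orthogonal_transformation_norm[of "(*v) M"] that
    by (simp add: matrix_of_matrix_vector_mul)
  show "(\<lambda>(x, t). (M *v x, t)) ` S = S"
  proof (intro equalityI subsetI)
    fix q assume "q \<in> (\<lambda>(x, t). (M *v x, t)) ` S"
    then obtain x t where "(x, t) \<in> S" "q = (M *v x, t)" by auto
    then show "q \<in> S" using assms[of x "M *v x" t] n[OF M] by simp
  next
    fix q assume q: "q \<in> S"
    obtain x t where xt: "q = (x, t)" by (cases q)
    have "(transpose M *v x, t) \<in> S"
      using assms[of x "transpose M *v x" t] n[of "transpose M"] M q xt by simp
    moreover have "M *v (transpose M *v x) = x"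
      using M by (metis matrix_vector_mul_assoc orthogonal_matrix_def matrix_vector_mul_lid)
    ultimately show "q \<in> (\<lambda>(x, t). (M *v x, t)) ` S"
      unfolding xt by (intro image_eqI[of _ _ "(transpose M *v x, t)"]) auto
  qed
qed

lemma geo_radius_continuous:
  assumes "\<epsilon> \<in> {0, -1}" "0 < conf \<epsilon> b" "0 < \<eta>"
  obtains \<delta> where "0 < \<delta>" "\<And>r. \<bar>r - b\<bar> < \<delta> \<Longrightarrow> \<bar>geo_radius \<epsilon> r - geo_radius \<epsilon> b\<bar> < \<eta>"
proof -
  have "isCont (geo_radius \<epsilon>) b" by (rule DERIV_isCont[OF geo_radius_has_derivative[OF assms(1,2)]])
  then show ?thesis using assms(3) that unfolding continuous_at_eps_delta by (metis dist_real_def)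
qed

lemma geo_radius_inverse_continuous:
  assumes "\<epsilon> \<in> {0, -1}" "0 < conf \<epsilon> b" "0 < \<delta>"
  obtains \<eta> where "0 < \<eta>" "\<And>r. 0 < conf \<epsilon> r \<Longrightarrow> \<bar>geo_radius \<epsilon> r - geo_radius \<epsilon> b\<bar> < \<eta> \<Longrightarrow> \<bar>r - b\<bar> < \<delta>"
proof -
  have "isCont (\<lambda>s::real. 2 * tanh (s / 2)) x" for x
    by (intro continuous_intros isCont_tanh) auto
  then have "isCont (chart_radius \<epsilon>) (geo_radius \<epsilon> b)"
    by (cases "\<epsilon> = 0") (auto simp: chart_radius_def[abs_def])
  then obtain \<eta> where "0 < \<eta>" "\<And>s. \<bar>s - geo_radius \<epsilon> b\<bar> < \<eta> \<Longrightarrow> \<bar>chart_radius \<epsilon> s - chart_radius \<epsilon> (geo_radius \<epsilon> b)\<bar> < \<delta>"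
    using assms(3) unfolding continuous_at_eps_delta by (metis dist_real_def)
  then show ?thesis using that[of \<eta>] chart_radius_geo_radius[OF assms(1)] assms(2) by metis
qed

context profile
begin

definition surface :: "((real^'n) \<times> real) set" where
  "surface = {q. A < norm (fst q) \<and> norm (fst q) < B \<and> snd q = \<psi> (norm (fst q))}"

lemma surface_vertical_graph:
  "surface = vertical_graph (\<lambda>x::real^'n. \<psi> (norm x)) {x. A < norm x \<and> norm x < B}"
  by (force simp: surface_def vertical_graph_def)

lemma surface_subset: "surface \<subseteq> QR_space \<epsilon>"
  using conf_pos by (auto simp: surface_def QR_space_def Q_space_iff mem_Times_iff)

lemma surface_rotational: "rotational surface"
  by (rule rotationalI) (simp add: surface_def)

lemma open_annulus: "open {x::real^'n. A < norm x \<and> norm x < B}"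
  by (intro open_Collect_conj open_Collect_less continuous_intros)

lemma surface_sheet:
  assumes "p \<in> surface"
  shows "rot_sheet \<epsilon> surface (\<lambda>q. rot_normal \<epsilon> \<theta> (fst q)) p \<psi> \<theta>"
  unfolding rot_sheet_def
  using assms open_vimage_fst[OF open_annulus]
  by (intro conjI exI[of _ "fst -` {x. A < norm x \<and> norm x < B}"]) (auto simp: surface_def)

lemma \<psi>_ge_min: "A < r \<Longrightarrow> r < B \<Longrightarrow> \<psi> r0 \<le> \<psi> r"
  using \<psi>_min[of r] by (cases "r = r0") auto

lemma surface_half_space: "surface \<subseteq> UNIV \<times> {\<psi> r0..}"
  using \<psi>_ge_min by (auto simp: surface_def mem_Times_iff)

lemma surface_min_height:
  assumes "0 \<le> r0"
  shows "min_height_set surface = {x::real^'n. norm x = r0} \<times> {\<psi> r0}"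
proof -
  obtain e :: "real^'n" where e: "norm e = 1" using unit_direction[of 0] by blast
  have 0: "(r0 *\<^sub>R e, \<psi> r0) \<in> surface" using ends assms e by (simp add: surface_def)
  show ?thesis
  proof (intro equalityI subsetI)
    fix p :: "(real^'n) \<times> real" assume "p \<in> min_height_set surface"
    then have p: "p \<in> surface" "snd p \<le> \<psi> r0" using 0 by (auto simp: min_height_set_def)
    then show "p \<in> {x. norm x = r0} \<times> {\<psi> r0}"
      using \<psi>_min[of "norm (fst p)"] by (force simp: surface_def mem_Times_iff)
  next
    fix p assume "p \<in> {x::real^'n. norm x = r0} \<times> {\<psi> r0}"
    then show "p \<in> min_height_set surface"
      using ends surface_half_space by (force simp: min_height_set_def surface_def mem_Times_iff)
  qed
qed

lemma surface_unbounded: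
  assumes "0 < B"
  shows "height_unbounded_above (surface :: ((real^'n) \<times> real) set)"
  unfolding height_unbounded_above_def
proof
  fix h
  obtain \<delta> where \<delta>: "0 < \<delta>" "\<And>r. A < r \<Longrightarrow> r < B \<Longrightarrow> r < A + \<delta> \<or> B - \<delta> < r \<Longrightarrow> h < \<psi> r"
    using blow_up[of h] by blast
  define r where "r = Max {B - \<delta> / 2, (A + B) / 2, B / 2}"
  have r: "A < r" "r < B" "B - \<delta> < r" "0 < r" using less_trans[OF ends] assms \<delta>(1) by (auto simp: r_def less_max_iff_disj)
  obtain e :: "real^'n" where e: "norm e = 1" using unit_direction[of 0] by blast
  have "(r *\<^sub>R e, \<psi> r) \<in> surface" using r e by (simp add: surface_def)
  then show "\<exists>p\<in>surface :: ((real^'n) \<times> real) set. h < snd p" using \<delta>(2)[of r] r by (intro bexI) auto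
qed

text \<open>Bounded height keeps the radius away from both ends, so the part of the surface in a compact set is a
  graph over a compact annulus or ball.\<close>

lemma surface_proper: "proper_in_QR \<epsilon> (surface :: ((real^'n) \<times> real) set)"
  unfolding proper_in_QR_def
proof (intro conjI allI impI surface_subset)
  fix K :: "((real^'n) \<times> real) set" assume K: "compact K \<and> K \<subseteq> QR_space \<epsilon>"
  then have "bounded (snd ` K)" by (intro compact_imp_bounded compact_continuous_image continuous_intros) auto
  then obtain h where h: "\<And>q. q \<in> K \<Longrightarrow> \<bar>snd q\<bar> \<le> h" by (auto simp: bounded_iff)
  obtain \<delta> where \<delta>: "0 < \<delta>" "\<And>r. A < r \<Longrightarrow> r < B \<Longrightarrow> r < A + \<delta> \<or> B - \<delta> < r \<Longrightarrow> h < \<psi> r"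
    using blow_up[of h] by blast
  define D where "D = cball (0::real^'n) (B - \<delta>) \<inter> {x. A + \<delta> \<le> norm x}"
  have D: "compact D" unfolding D_def
    by (intro compact_Int_closed compact_cball closed_Collect_le continuous_intros)
  have "continuous_on D (\<lambda>x. (x, \<psi> (norm x)))"
    by (intro continuous_intros continuous_on_compose2[OF continuous_on_\<psi>[of "{A<..<B}"]])
      (use \<delta>(1) in \<open>auto simp: D_def\<close>)
  then have c: "compact ((\<lambda>x. (x, \<psi> (norm x))) ` D)" by (rule compact_continuous_image[OF _ D])
  have "surface \<inter> K = (\<lambda>x. (x, \<psi> (norm x))) ` D \<inter> K"
  proof (intro equalityI subsetI)
    fix q assume q: "q \<in> surface \<inter> K"
    then have "\<not> h < \<psi> (norm (fst q))" using h[of q] by (auto simp: surface_def)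
    then have "fst q \<in> D" using \<delta>(2)[of "norm (fst q)"] q by (force simp: surface_def D_def)
    then show "q \<in> (\<lambda>x. (x, \<psi> (norm x))) ` D \<inter> K"
      using q by (intro IntI image_eqI[of _ _ "fst q"]) (auto simp: surface_def prod_eq_iff)
  next
    fix q assume "q \<in> (\<lambda>x. (x, \<psi> (norm x))) ` D \<inter> K"
    then show "q \<in> surface \<inter> K" using \<delta>(1) by (auto simp: surface_def D_def)
  qed
  then show "compact (surface \<inter> K)" using c K by (simp add: compact_Int)
qed

lemma level_near_ends:
  assumes "0 < \<delta>"
  obtains T where "\<And>r. A < r \<Longrightarrow> r < B \<Longrightarrow> T < \<psi> r \<Longrightarrow> r < A + \<delta> \<or> B - \<delta> < r"
    "\<And>t. T < t \<Longrightarrow> \<exists>r. A < r \<and> r < B \<and> r < A + \<delta> \<and> \<psi> r = t"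
    "\<And>t. T < t \<Longrightarrow> \<exists>r. A < r \<and> r < B \<and> B - \<delta> < r \<and> \<psi> r = t"
proof -
  obtain k where k: "0 < k" "k \<le> \<delta>" "k \<le> B - A"
    using that assms less_trans[OF ends] by (metis diff_gt_0_iff_gt linear order_refl)
  define d where "d = k / 2"
  have d: "0 < d" "d < \<delta>" "A + d \<le> B - d" "A + d < B" "A < B - d"
    using k less_trans[OF ends] by (simp_all add: d_def)
  have "compact (\<psi> ` {A + d..B - d})"
    by (intro compact_continuous_image continuous_on_\<psi>) (use d in auto)
  then obtain T where T: "\<And>r. r \<in> {A + d..B - d} \<Longrightarrow> \<bar>\<psi> r\<bar> \<le> T"
    using compact_imp_bounded bounded_iff by (metis image_eqI real_norm_def)
  show ?thesis
  proof (rule that[of T])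
    show "r < A + \<delta> \<or> B - \<delta> < r" if "A < r" "r < B" "T < \<psi> r" for r
      using T[of r] that d by force
    fix t assume t: "T < t"
    obtain e where e: "0 < e" "\<And>r. A < r \<Longrightarrow> r < B \<Longrightarrow> r < A + e \<or> B - e < r \<Longrightarrow> t < \<psi> r"
      using blow_up[of t] by blast
    define b where "b = min d e / 2"
    have b: "0 < b" "b < d" "b < e" using d e by (auto simp: b_def)
    have 1: "t < \<psi> (A + b)" "t < \<psi> (B - b)" using e(2)[of "A + b"] e(2)[of "B - b"] b d by auto
    have 2: "\<psi> (A + d) < t" "\<psi> (B - d) < t" using T[of "A + d"] T[of "B - d"] t d by auto
    have "\<exists>r\<ge>A + b. r \<le> A + d \<and> \<psi> r = t"
      using 1 2 b d by (intro IVT2') (auto intro!: continuous_on_\<psi>)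
    then show "\<exists>r. A < r \<and> r < B \<and> r < A + \<delta> \<and> \<psi> r = t" using b d by force
    have "\<exists>r\<ge>B - d. r \<le> B - b \<and> \<psi> r = t"
      using 1 2 b d by (intro IVT') (auto intro!: continuous_on_\<psi>)
    then show "\<exists>r. A < r \<and> r < B \<and> B - \<delta> < r \<and> \<psi> r = t" using b d by force
  qed
qed

text \<open>If \<open>A < 0\<close>, no point has norm \<open>A\<close>, and only the cylinder of radius \<open>B\<close> remains.\<close>

lemma surface_asymptotic:
  assumes "0 < B"
  shows "vertically_asymptotic \<epsilon> (surface :: ((real^'n) \<times> real) set) ({x. norm x = A \<or> norm x = B} \<times> UNIV)"
  unfolding vertically_asymptotic_def
proof (intro conjI allI impI)
  fix \<eta> :: real assume \<eta>: "0 < \<eta>"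
  obtain \<delta>A where \<delta>A: "0 < \<delta>A" "\<And>r. \<bar>r - A\<bar> < \<delta>A \<Longrightarrow> \<bar>geo_radius \<epsilon> r - geo_radius \<epsilon> A\<bar> < \<eta>"
    using geo_radius_continuous[OF \<epsilon> conf_ends(1) \<eta>] by blast
  obtain \<delta>B where \<delta>B: "0 < \<delta>B" "\<And>r. \<bar>r - B\<bar> < \<delta>B \<Longrightarrow> \<bar>geo_radius \<epsilon> r - geo_radius \<epsilon> B\<bar> < \<eta>"
    using geo_radius_continuous[OF \<epsilon> conf_ends(3) \<eta>] by blast
  \<comment> \<open>If \<open>A < 0\<close>, a nonnegative radius must not lie within \<open>\<delta>\<close> of \<open>A\<close>; and radii within \<open>\<delta>\<close> of \<open>B\<close> must be nonnegative.\<close>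
  define \<delta> where "\<delta> = min (min \<delta>A \<delta>B) (min B (if A < 0 then - A else B))"
  have \<delta>: "0 < \<delta>" "\<delta> \<le> \<delta>A" "\<delta> \<le> \<delta>B" "\<delta> \<le> B" "A < 0 \<Longrightarrow> A + \<delta> \<le> 0"
    using \<delta>A \<delta>B assms by (auto simp: \<delta>_def min_def)
  obtain T where T: "\<And>r. A < r \<Longrightarrow> r < B \<Longrightarrow> T < \<psi> r \<Longrightarrow> r < A + \<delta> \<or> B - \<delta> < r"
    "\<And>t. T < t \<Longrightarrow> \<exists>r. A < r \<and> r < B \<and> r < A + \<delta> \<and> \<psi> r = t"
    "\<And>t. T < t \<Longrightarrow> \<exists>r. A < r \<and> r < B \<and> B - \<delta> < r \<and> \<psi> r = t"
    using level_near_ends[OF \<delta>(1)] by blast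
  have dist: "QR_dist \<epsilon> (r *\<^sub>R e, t) (b *\<^sub>R e, t) < \<eta>" "QR_dist \<epsilon> (b *\<^sub>R e, t) (r *\<^sub>R e, t) < \<eta>"
    if "norm e = 1" "A < r" "r < B" "b = A \<and> r < A + \<delta> \<or> b = B \<and> B - \<delta> < r" for r b t and e :: "real^'n"
  proof -
    have "\<bar>geo_radius \<epsilon> r - geo_radius \<epsilon> b\<bar> < \<eta>"
      using that(2-4) \<delta> \<delta>A(2)[of r] \<delta>B(2)[of r] by auto
    moreover have "0 < conf \<epsilon> r" "0 < conf \<epsilon> b" using conf_pos[of r] conf_ends that by auto
    ultimately show "QR_dist \<epsilon> (r *\<^sub>R e, t) (b *\<^sub>R e, t) < \<eta>" "QR_dist \<epsilon> (b *\<^sub>R e, t) (r *\<^sub>R e, t) < \<eta>"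
      using QR_dist_radial_le[OF \<epsilon> that(1), of r b t] QR_dist_radial_le[OF \<epsilon> that(1), of b r t] by linarith+
  qed
  show "\<exists>T. (\<forall>p\<in>surface :: ((real^'n) \<times> real) set. T < snd p \<longrightarrow> (\<exists>q\<in>{x. norm x = A \<or> norm x = B} \<times> UNIV. QR_dist \<epsilon> p q < \<eta>)) \<and>
     (\<forall>q\<in>{x. norm x = A \<or> norm x = B} \<times> UNIV. T < snd q \<longrightarrow> (\<exists>p\<in>surface :: ((real^'n) \<times> real) set. QR_dist \<epsilon> p q < \<eta>))"
  proof (intro exI[of _ T] conjI ballI impI)
    fix p :: "(real^'n) \<times> real" assume p: "p \<in> surface" "T < snd p"
    obtain e where e: "norm e = 1" "fst p = norm (fst p) *\<^sub>R e" by (rule unit_direction[of "fst p"])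
    have pe: "(norm (fst p) *\<^sub>R e, snd p) = p" using e(2) by (simp add: prod_eq_iff)
    have r: "A < norm (fst p)" "norm (fst p) < B" "T < \<psi> (norm (fst p))" using p by (auto simp: surface_def)
    from T(1)[OF r] show "\<exists>q\<in>{x. norm x = A \<or> norm x = B} \<times> UNIV. QR_dist \<epsilon> p q < \<eta>"
    proof
      assume a: "norm (fst p) < A + \<delta>"
      then have "0 \<le> A" using \<delta>(5) norm_ge_zero[of "fst p"] by linarith
      then show ?thesis using dist(1)[OF e(1) r(1,2), of A "snd p"] a e(1) unfolding pe
        by (intro bexI[of _ "(A *\<^sub>R e, snd p)"]) auto
    next
      assume "B - \<delta> < norm (fst p)"
      then show ?thesis using dist(1)[OF e(1) r(1,2), of B "snd p"] e(1) assms unfolding pe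
        by (intro bexI[of _ "(B *\<^sub>R e, snd p)"]) auto
    qed
  next
    fix q :: "(real^'n) \<times> real" assume q: "q \<in> {x. norm x = A \<or> norm x = B} \<times> UNIV" "T < snd q"
    obtain e where e: "norm e = 1" "fst q = norm (fst q) *\<^sub>R e" by (rule unit_direction[of "fst q"])
    have qe: "(norm (fst q) *\<^sub>R e, snd q) = q" using e(2) by (simp add: prod_eq_iff)
    from q(1) have "norm (fst q) = A \<or> norm (fst q) = B" by auto
    then obtain r where r: "A < r" "r < B" "0 \<le> r" "\<psi> r = snd q"
        "norm (fst q) = A \<and> r < A + \<delta> \<or> norm (fst q) = B \<and> B - \<delta> < r"
    proof
      assume a: "norm (fst q) = A"
      obtain r where "A < r" "r < B" "r < A + \<delta>" "\<psi> r = snd q" using T(2)[OF q(2)] by blast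
      then show ?thesis using that[of r] a norm_ge_zero[of "fst q"] by auto
    next
      assume b: "norm (fst q) = B"
      obtain r where "A < r" "r < B" "B - \<delta> < r" "\<psi> r = snd q" using T(3)[OF q(2)] by blast
      then show ?thesis using that[of r] b \<delta>(4) by auto
    qed
    have "(r *\<^sub>R e, snd q) \<in> surface" using r e(1) by (simp add: surface_def)
    then show "\<exists>p\<in>surface :: ((real^'n) \<times> real) set. QR_dist \<epsilon> p q < \<eta>"
      using dist(1)[OF e(1) r(1,2,5), of "snd q"] unfolding qe by blast
  qed
next
  fix T
  obtain \<delta> where \<delta>: "0 < \<delta>" "\<And>r. A < r \<Longrightarrow> r < B \<Longrightarrow> r < A + \<delta> \<or> B - \<delta> < r \<Longrightarrow> T < \<psi> r"
    using blow_up[of T] by blast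
  obtain \<eta>A where \<eta>A: "0 < \<eta>A" "\<And>r. 0 < conf \<epsilon> r \<Longrightarrow> \<bar>geo_radius \<epsilon> r - geo_radius \<epsilon> A\<bar> < \<eta>A \<Longrightarrow> \<bar>r - A\<bar> < \<delta>"
    using geo_radius_inverse_continuous[OF \<epsilon> conf_ends(1) \<delta>(1)] by blast
  obtain \<eta>B where \<eta>B: "0 < \<eta>B" "\<And>r. 0 < conf \<epsilon> r \<Longrightarrow> \<bar>geo_radius \<epsilon> r - geo_radius \<epsilon> B\<bar> < \<eta>B \<Longrightarrow> \<bar>r - B\<bar> < \<delta>"
    using geo_radius_inverse_continuous[OF \<epsilon> conf_ends(3) \<delta>(1)] by blast
  show "\<exists>\<eta>>0. \<forall>p\<in>surface :: ((real^'n) \<times> real) set. \<forall>q\<in>{x. norm x = A \<or> norm x = B} \<times> UNIV. QR_dist \<epsilon> p q < \<eta> \<longrightarrow> T < snd p"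
  proof (intro exI[of _ "min \<eta>A \<eta>B"] conjI ballI impI)
    show "0 < min \<eta>A \<eta>B" using \<eta>A \<eta>B by simp
    fix p q :: "(real^'n) \<times> real"
    assume p: "p \<in> surface" and q: "q \<in> {x. norm x = A \<or> norm x = B} \<times> UNIV" and d: "QR_dist \<epsilon> p q < min \<eta>A \<eta>B"
    define r where "r = norm (fst p)"
    have r: "A < r" "r < B" "snd p = \<psi> r" using p by (auto simp: surface_def r_def)
    have c: "0 < conf \<epsilon> r" using conf_pos r by simp
    have nq: "norm (fst q) = A \<or> norm (fst q) = B" using q by auto
    have "fst p \<in> Q_space \<epsilon>" "fst q \<in> Q_space \<epsilon>" using c nq conf_ends by (auto simp: Q_space_iff r_def)
    from QR_dist_ge[OF \<epsilon> this] d have "\<bar>geo_radius \<epsilon> r - geo_radius \<epsilon> (norm (fst q))\<bar> < min \<eta>A \<eta>B"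
      by (simp add: r_def)
    then have "r < A + \<delta> \<or> B - \<delta> < r" using nq \<eta>A(2)[OF c] \<eta>B(2)[OF c] by auto
    then show "T < snd p" using \<delta>(2) r by simp
  qed
qed

lemma shift: "profile \<epsilon> m C A r0 B \<theta> (\<lambda>r. \<psi> r - d)"
  by unfold_locales (use \<psi> DERIV_diff[OF \<psi> DERIV_const[of d]] in simp)

end

section \<open>Bowls, grim reapers and cones\<close>

text \<open>The linear part of the expansion cancels in the sum over \<open>h\<close> and \<open>- h\<close>, leaving \<open>2 d = 0\<close>.\<close>

lemma radial_not_differentiable:
  fixes f :: "real \<Rightarrow> real"
  assumes f: "(f has_real_derivative d) (at 0)" and d: "d \<noteq> 0"
  shows "\<not> (\<lambda>x::real^'n. f (norm x)) differentiable (at 0)"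
proof
  assume "(\<lambda>x::real^'n. f (norm x)) differentiable (at 0)"
  then obtain D where D: "((\<lambda>x::real^'n. f (norm x)) has_derivative D) (at 0)" by (auto simp: differentiable_def)
  have lin: "D (- h) = - D h" for h using has_derivative_linear[OF D] by (rule linear_neg)
  let ?Q = "\<lambda>h::real^'n. (f (norm h) - f 0 - D h) / norm h"
  have "((\<lambda>h::real^'n. norm (?Q h)) \<longlongrightarrow> 0) (at 0)"
    using D by (simp add: has_derivative_at)
  then have Q: "(?Q \<longlongrightarrow> 0) (at 0)" by (rule tendsto_norm_zero_cancel)
  have "filterlim uminus (at 0) (at (0::real^'n))"
    by (auto simp: filterlim_at eventually_at_filter intro!: tendsto_eq_intros)
  from filterlim_compose[OF Q this] have Q': "((\<lambda>h::real^'n. ?Q (- h)) \<longlongrightarrow> 0) (at 0)" .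
  have "((\<lambda>h::real^'n. 2 * ((f (norm h) - f 0) / norm h)) \<longlongrightarrow> 0) (at 0)"
    using tendsto_add[OF Q Q'] by (simp add: lin add_divide_distrib[symmetric])
  moreover have "((\<lambda>r. (f r - f 0) / r) \<longlongrightarrow> d) (at 0)" using f by (simp add: DERIV_def)
  then have "((\<lambda>h::real^'n. (f (norm h) - f 0) / norm h) \<longlongrightarrow> d) (at 0)"
    by (rule filterlim_compose[OF _ filterlim_norm_at_0])
  then have "((\<lambda>h::real^'n. 2 * ((f (norm h) - f 0) / norm h)) \<longlongrightarrow> 2 * d) (at 0)"
    by (intro tendsto_mult tendsto_const)
  ultimately have "2 * d = 0" by (intro tendsto_unique[of "at (0::real^'n)"]) auto
  with d show False by simp
qed

lemma conical_singularity_radial: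
  fixes f :: "real \<Rightarrow> real"
  assumes \<epsilon>: "\<epsilon> \<in> {0, -1}" and f: "(f has_real_derivative d) (at 0)" and d: "d \<noteq> 0"
  shows "conical_singularity \<epsilon> (\<lambda>x::real^'n. f (norm x))"
proof -
  have "((\<lambda>r. (f r - f 0) / r) \<longlongrightarrow> d) (at 0)" using f by (simp add: DERIV_def)
  moreover have "((\<lambda>r. geo_radius \<epsilon> r / r) \<longlongrightarrow> 1) (at 0)"
    using geo_radius_has_derivative[OF \<epsilon>, of 0] by (simp add: DERIV_def)
  ultimately have "((\<lambda>r. ((f r - f 0) / r) / (geo_radius \<epsilon> r / r)) \<longlongrightarrow> d / 1) (at 0)"
    by (intro tendsto_divide) auto
  moreover have "\<forall>\<^sub>F r in at 0. ((f r - f 0) / r) / (geo_radius \<epsilon> r / r) = (f r - f 0) / geo_radius \<epsilon> r"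
    by (simp add: eventually_at_filter)
  ultimately have "((\<lambda>r. (f r - f 0) / geo_radius \<epsilon> r) \<longlongrightarrow> d / 1) (at 0)"
    by (rule Lim_transform_eventually)
  then have "((\<lambda>r. (f r - f 0) / geo_radius \<epsilon> r) \<longlongrightarrow> d) (at 0)" by simp
  then have l: "((\<lambda>x::real^'n. (f (norm x) - f 0) / geo_radius \<epsilon> (norm x)) \<longlongrightarrow> d) (at 0)"
    by (rule filterlim_compose[OF _ filterlim_norm_at_0])
  have "open {x::real^'n. 0 < conf \<epsilon> (norm x)}"
    by (intro open_Collect_less continuous_intros)
  then have "\<forall>\<^sub>F x::real^'n in at 0. 0 < conf \<epsilon> (norm x)"
    unfolding eventually_at_topological by (intro exI[of _ "{x::real^'n. 0 < conf \<epsilon> (norm x)}"]) auto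
  then have "\<forall>\<^sub>F x::real^'n in at 0. (f (norm x) - f 0) / geo_radius \<epsilon> (norm x) = (f (norm x) - f (norm (0::real^'n))) / Q_dist \<epsilon> 0 x"
    by eventually_elim (simp add: Q_dist_origin[OF \<epsilon>] Q_space_iff)
  from Lim_transform_eventually[OF l this] show ?thesis
    unfolding conical_singularity_def using radial_not_differentiable[OF f d] d by blast
qed

text \<open>The derivative of a function that vanishes on \<open>S\<close> kills the half-lines \<open>(e, a)\<close> and \<open>(e, b)\<close> for every unit
  vector \<open>e\<close>. As \<open>a \<noteq> b\<close>, it kills the vertical direction, hence all horizontal ones, so it is zero.\<close>

lemma double_cone_not_C1:
  fixes S :: "((real^'n) \<times> real) set"
  assumes f: "(f has_real_derivative a) (at 0)" "f 0 = 0" and g: "(g has_real_derivative b) (at 0)" "g 0 = 0"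
    and ab: "a \<noteq> b" and \<rho>: "0 < \<rho>"
    and S: "\<And>x. norm x < \<rho> \<Longrightarrow> (x, f (norm x)) \<in> S \<and> (x, g (norm x)) \<in> S"
  shows "\<not> hypersurface_at C1_on S (0, 0)"
proof
  assume "hypersurface_at C1_on S (0, 0)"
  then obtain U and F :: "(real^'n) \<times> real \<Rightarrow> real" where U: "open U" "(0, 0) \<in> U" "C1_on U F" "S \<inter> U = {q \<in> U. F q = 0}"
    "\<forall>q\<in>S \<inter> U. frechet_derivative F (at q) \<noteq> (\<lambda>_. 0)" "(0, 0) \<in> S"
    unfolding hypersurface_at_def
    apply (elim conjE exE)
    subgoal for W F by (rule that[of W F])
    done
  obtain F' where F: "\<And>q. q \<in> U \<Longrightarrow> (F has_derivative blinfun_apply (F' q)) (at q)" using U(3) by (auto simp: C1_on_def)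
  let ?D = "blinfun_apply (F' (0, 0))"
  have key: "?D (e, c) = 0" if e: "norm e = 1" and h: "(h has_real_derivative c) (at 0)" "h 0 = 0"
    and hS: "\<And>x. norm x < \<rho> \<Longrightarrow> (x, h (norm x)) \<in> S" for e :: "real^'n" and h c
  proof -
    let ?q = "\<lambda>t. (t *\<^sub>R e, h t)"
    have dq: "(?q has_vector_derivative (e, c)) (at 0)"
      by (intro has_vector_derivative_Pair h(1)[unfolded has_real_derivative_iff_has_vector_derivative])
        (auto intro!: derivative_eq_intros)
    have "((F \<circ> ?q) has_vector_derivative ?D (e, c)) (at 0)"
      by (rule vector_derivative_diff_chain_within[OF dq has_derivative_at_withinI]) (use F[OF U(2)] h(2) in simp)
    then have 1: "((F \<circ> ?q) has_vector_derivative ?D (e, c)) (at 0 within {0..})"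
      by (rule has_vector_derivative_at_within)
    have "isCont ?q 0" using dq by (rule has_vector_derivative_continuous)
    then have "(?q \<longlongrightarrow> (0, 0)) (at 0)" using h(2) by (simp add: isCont_def)
    then have "\<forall>\<^sub>F t in at 0. ?q t \<in> U" using U by (intro topological_tendstoD)
    then have "\<forall>\<^sub>F t in at 0 within {0..}. ?q t \<in> U" by (rule filter_leD[OF at_le[OF subset_UNIV]])
    moreover have "\<forall>\<^sub>F t in at 0 within {0..}. 0 \<le> t \<and> t < \<rho>"
      using \<rho> by (auto simp: eventually_at dist_real_def intro!: exI[of _ \<rho>])
    ultimately have ev: "\<forall>\<^sub>F t in at 0 within {0..}. 0 = (F \<circ> ?q) t"
    proof eventually_elim
      case (elim t)
      then have "?q t \<in> S" using hS[of "t *\<^sub>R e"] e by simp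
      then have "F (?q t) = 0" using elim U(4) by blast
      then show ?case by simp
    qed
    have 2: "((F \<circ> ?q) has_vector_derivative 0) (at 0 within {0..})"
      unfolding has_vector_derivative_def
      by (rule has_derivative_transform_eventually[OF _ ev]) (use U(2,4,6) h(2) in auto)
    show ?thesis
      by (rule vector_derivative_unique_within[OF _ 1 2]) (simp add: at_within_Ici_at_right)
  qed
  have all: "?D (e, a) = 0" "?D (e, b) = 0" if "norm e = 1" for e :: "real^'n"
    using key[OF that f] key[OF that g] S by auto
  obtain e0 :: "real^'n" where e0: "norm e0 = 1" using unit_direction[of 0] by blast
  have dec: "?D (w, t) = ?D (w, 0) + t * ?D (0, 1)" for w t
  proof -
    have "(w, t) = (w, 0) + t *\<^sub>R (0, 1)" by simp
    then have "?D (w, t) = ?D ((w, 0) + t *\<^sub>R (0, 1))" by (rule arg_cong)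
    then show ?thesis unfolding blinfun.add_right blinfun.scaleR_right real_scaleR_def .
  qed
  have "a * ?D (0, 1) = b * ?D (0, 1)" using all[OF e0] dec[of e0 a] dec[of e0 b] by linarith
  then have z: "?D (0, 1) = 0" using ab by simp
  have h0: "?D (w, 0) = 0" for w
  proof -
    obtain e where e: "norm e = 1" "w = norm w *\<^sub>R e" by (rule unit_direction[of w])
    have "?D (e, 0) = 0" using all[OF e(1)] dec[of e a] z by simp
    moreover have "(w, 0) = norm w *\<^sub>R (e, 0::real)" using e(2) by simp
    then have "?D (w, 0) = ?D (norm w *\<^sub>R (e, 0))" by (rule arg_cong)
    ultimately show ?thesis by (simp only: blinfun.scaleR_right scaleR_zero_right)
  qed
  have "?D = (\<lambda>_. 0)"
  proof
    show "?D v = 0" for v using dec[of "fst v" "snd v"] h0[of "fst v"] z by simp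
  qed
  then have "frechet_derivative F (at (0, 0)) = (\<lambda>_. 0)" using frechet_derivative_at[OF F[OF U(2)]] by simp
  then show False using U by blast
qed

lemma horizontal_sphereI:
  assumes "\<epsilon> \<in> {0, -1}" "0 < conf \<epsilon> r" "0 < r"
  shows "horizontal_sphere \<epsilon> ({x::real^'n. norm x = r} \<times> {h})"
proof -
  have "0 < geo_radius \<epsilon> r" using geo_radius_less_iff[OF assms(1), of 0 r] assms by simp
  then show ?thesis unfolding horizontal_sphere_def
    using Q_ball_eq(3)[OF assms(1,2)] assms(3) by (intro exI[of _ "geo_radius \<epsilon> r"] exI[of _ h]) auto
qed

context
  fixes \<epsilon> :: real and m :: nat
  assumes \<epsilon>: "\<epsilon> \<in> {0, -1}" and m: "even m" "2 \<le> m" and card: "CARD('n::finite) = Suc m"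
begin

lemma bowl_soliton:
  "\<exists>(\<Sigma>\<^sub>0 :: ((real^'n) \<times> real) set) N R u.
       0 < R \<and> C2_on (Q_ball \<epsilon> R) u \<and> \<Sigma>\<^sub>0 = vertical_graph u (Q_ball \<epsilon> R) \<and>
       rotational \<Sigma>\<^sub>0 \<and> n_translator \<epsilon> \<Sigma>\<^sub>0 N {} \<and> strictly_convex \<epsilon> \<Sigma>\<^sub>0 N \<and>
       \<Sigma>\<^sub>0 \<subseteq> UNIV \<times> {0..} \<and> height_unbounded_above \<Sigma>\<^sub>0 \<and>
       vertically_asymptotic \<epsilon> \<Sigma>\<^sub>0 (Q_sphere \<epsilon> R \<times> UNIV)"
proof -
  obtain A r0 B \<theta> \<psi>0 where P0: "profile \<epsilon> m 0 A r0 B \<theta> \<psi>0"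
    using profile_exists[OF \<epsilon> m, of 0] by blast
  define \<psi> where "\<psi> = (\<lambda>r. \<psi>0 r - \<psi>0 0)"
  interpret profile \<epsilon> m 0 A r0 B \<theta> \<psi> unfolding \<psi>_def by (rule profile.shift[OF P0])
  have r0: "r0 = 0" using T_r0 tan_primitive_eq_iff[OF \<epsilon> m(1) conf_ends(2), of 0] by simp
  note c = centered[OF r0]
  have nA: "A < norm x" for x :: "real^'n" using c norm_ge_zero[of x] by linarith
  have dom: "{x::real^'n. A < norm x \<and> norm x < B} = {x. norm x < B}" using nA by auto
  have "norm x \<noteq> A" for x :: "real^'n" using nA[of x] by simp
  then have ball: "Q_ball \<epsilon> (geo_radius \<epsilon> B) = {x::real^'n. norm x < B}"
    "Q_sphere \<epsilon> (geo_radius \<epsilon> B) = {x::real^'n. norm x = A \<or> norm x = B}"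
    by (simp_all only: Q_ball_eq[OF \<epsilon> conf_ends(3) less_imp_le[OF c(3)]] simp_thms)
  let ?S = "surface :: ((real^'n) \<times> real) set" and ?N = "\<lambda>q. rot_normal \<epsilon> \<theta> (fst q)"
  have S: "?S = vertical_graph (\<lambda>x. \<psi> (norm x)) (Q_ball \<epsilon> (geo_radius \<epsilon> B))"
    unfolding surface_vertical_graph dom ball ..
  have sheets: "rot_sheet \<epsilon> ?S ?N p \<psi> \<theta>" "A < norm (fst p)" "norm (fst p) < B" if "p \<in> ?S" for p
    using surface_sheet[OF that] that by (auto simp: surface_def)
  have tr: "n_translator \<epsilon> ?S ?N {}"
    by (rule n_translator_of_sheets[OF surface_subset _ card, of "{}" _ 0])
      (use sheets r0 profile_axioms in \<open>auto intro!: exI\<close>)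
  have conv: "strictly_convex \<epsilon> ?S ?N"
    unfolding strictly_convex_def
  proof
    fix p assume p: "p \<in> ?S"
    have "\<exists>k. principal_curvatures \<epsilon> ?S ?N p k \<and> (\<Prod>i\<in>UNIV. k i) = angle_function \<epsilon> ?N p \<and> (r0 \<le> norm (fst p) \<longrightarrow> (\<forall>i. 0 < k i))"
      by (rule sheet_curvature[OF sheets[OF p] _ card]) (use r0 in auto)
    then show "\<exists>k. principal_curvatures \<epsilon> ?S ?N p k \<and> (\<forall>i. 0 < k i)" using r0 by auto
  qed
  have R: "0 < geo_radius \<epsilon> B" using geo_radius_less_iff[OF \<epsilon> _ conf_ends(3), of 0] c by simp
  have "\<psi> r0 = 0" by (simp add: r0 \<psi>_def)
  then have half: "?S \<subseteq> UNIV \<times> {0..}" using surface_half_space by simp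
  have as: "vertically_asymptotic \<epsilon> ?S (Q_sphere \<epsilon> (geo_radius \<epsilon> B) \<times> UNIV)"
    unfolding ball by (rule surface_asymptotic[OF c(3)])
  have C2: "C2_on (Q_ball \<epsilon> (geo_radius \<epsilon> B)) (\<lambda>x::real^'n. \<psi> (norm x))"
    unfolding ball by (rule C2_on_centered_graph[OF r0])
  show ?thesis
    by (intro exI conjI) (rule R C2 S surface_rotational tr conv half surface_unbounded[OF c(3)] as)+
qed

text \<open>The constant \<open>C\<close> places the left end of the profile, where the tangent is vertical, at the chart radius
  \<open>a\<close> of \<open>\<mu>\<close>.\<close>

lemma grim_reapers:
  "\<forall>\<mu>\<ge>0. \<exists>(\<Sigma> :: ((real^'n) \<times> real) set) R.
       \<mu> < R \<and> rotational \<Sigma> \<and> proper_in_QR \<epsilon> \<Sigma> \<and>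
       (\<exists>N. n_translator \<epsilon> \<Sigma> N (min_height_set \<Sigma>)) \<and>
       (\<exists>u. C1_on (Q_ball \<epsilon> R - Q_cball \<epsilon> \<mu>) u \<and>
            \<Sigma> = vertical_graph u (Q_ball \<epsilon> R - Q_cball \<epsilon> \<mu>)) \<and>
       in_upper_half_space \<Sigma> \<and> height_unbounded_above \<Sigma> \<and>
       vertically_asymptotic \<epsilon> \<Sigma> ((Q_sphere \<epsilon> R \<union> Q_sphere \<epsilon> \<mu>) \<times> UNIV) \<and>
       horizontal_sphere \<epsilon> (min_height_set \<Sigma>)"
  (is "\<forall>\<mu>\<ge>0. ?reaper \<mu>")
proof (intro allI impI)
  fix \<mu> :: real assume \<mu>: "0 \<le> \<mu>"
  define a where "a = chart_radius \<epsilon> \<mu>"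
  have a: "0 < conf \<epsilon> a" "geo_radius \<epsilon> a = \<mu>" "0 \<le> a"
    using conf_chart_radius[OF \<epsilon>] chart_radius_nonneg[OF \<mu>] by (auto simp: a_def)
  obtain A r0 B \<theta> \<psi> where "profile \<epsilon> m (sin_primitive m (- (pi / 2)) - tan_primitive \<epsilon> m a) A r0 B \<theta> \<psi>"
    using profile_exists[OF \<epsilon> m] by blast
  then interpret profile \<epsilon> m "sin_primitive m (- (pi / 2)) - tan_primitive \<epsilon> m a" A r0 B \<theta> \<psi> .
  have A: "A = a" using T_A tan_primitive_eq_iff[OF \<epsilon> m(1) conf_ends(1) a(1)] by simp
  have B: "0 < B" "0 < r0" using ends a A by linarith+
  let ?S = "surface :: ((real^'n) \<times> real) set" and ?N = "\<lambda>q. rot_normal \<epsilon> \<theta> (fst q)"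
  let ?R = "geo_radius \<epsilon> B"
  have dom: "Q_ball \<epsilon> ?R - Q_cball \<epsilon> \<mu> = {x::real^'n. A < norm x \<and> norm x < B}"
    unfolding a(2)[symmetric] Q_ball_eq(1)[OF \<epsilon> conf_ends(3) less_imp_le[OF B(1)]] Q_ball_eq(2)[OF \<epsilon> a(1,3)] A by auto
  have sph: "(Q_sphere \<epsilon> ?R \<union> Q_sphere \<epsilon> \<mu>) = {x::real^'n. norm x = A \<or> norm x = B}"
    unfolding a(2)[symmetric] Q_ball_eq(3)[OF \<epsilon> conf_ends(3) less_imp_le[OF B(1)]] Q_ball_eq(3)[OF \<epsilon> a(1,3)] A by auto
  have R: "\<mu> < ?R" using geo_radius_less_iff[OF \<epsilon> a(1) conf_ends(3)] ends A a by simp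
  have min: "min_height_set ?S = {x. norm x = r0} \<times> {\<psi> r0}" by (rule surface_min_height) (use B in simp)
  have tr: "n_translator \<epsilon> ?S ?N (min_height_set ?S)"
  proof (rule n_translator_of_sheets[OF surface_subset _ card, of _ _ r0])
    show "min_height_set ?S \<subseteq> ?S" by (auto simp: min_height_set_def)
    fix p assume p: "p \<in> ?S"
    have "A < norm (fst p)" "norm (fst p) < B" "snd p = \<psi> (norm (fst p))" using p by (auto simp: surface_def)
    moreover have "fst p \<noteq> 0" using calculation(1) A a by auto
    moreover have "p \<in> min_height_set ?S \<longleftrightarrow> norm (fst p) = r0"
      unfolding min using calculation by (auto simp: mem_Times_iff)
    ultimately show "\<exists>C A r0 B \<theta> \<psi>. profile \<epsilon> m C A r0 B \<theta> \<psi> \<and> rot_sheet \<epsilon> ?S ?N p \<psi> \<theta> \<and>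
       A < norm (fst p) \<and> norm (fst p) < B \<and> (fst p = 0 \<longrightarrow> r0 = 0) \<and>
       (p \<in> min_height_set ?S \<longleftrightarrow> norm (fst p) = r0 \<and> fst p \<noteq> 0)"
      using surface_sheet[OF p] profile_axioms by blast
  qed (auto simp: min)
  have dom': "{x::real^'n. A < norm x \<and> norm x < B} = {x. norm x \<in> {A<..<B}} - {0}" using A a by auto
  have C1: "C1_on (Q_ball \<epsilon> ?R - Q_cball \<epsilon> \<mu>) (\<lambda>x::real^'n. \<psi> (norm x))"
    unfolding dom dom' by (rule C1_on_graph)
  have gr: "?S = vertical_graph (\<lambda>x. \<psi> (norm x)) (Q_ball \<epsilon> ?R - Q_cball \<epsilon> \<mu>)"
    unfolding dom by (rule surface_vertical_graph)
  have as: "vertically_asymptotic \<epsilon> ?S ((Q_sphere \<epsilon> ?R \<union> Q_sphere \<epsilon> \<mu>) \<times> UNIV)"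
    unfolding sph by (rule surface_asymptotic[OF B(1)])
  have half: "in_upper_half_space ?S" using surface_half_space by (auto simp: in_upper_half_space_def)
  have hs: "horizontal_sphere \<epsilon> (min_height_set ?S)"
    unfolding min by (rule horizontal_sphereI[OF \<epsilon> conf_ends(2) B(2)])
  show "?reaper \<mu>"
    by (intro exI[of _ ?S] exI[of _ ?R] conjI exI[of _ ?N] exI[of _ "\<lambda>x. \<psi> (norm x)"])
      (rule R surface_rotational surface_proper tr C1 gr half surface_unbounded[OF B(1)] as hs)+
qed

end

lemma rot_sheetI:
  assumes W: "open W" "p \<in> W" and p: "p \<in> S"
    and S: "\<And>q. q \<in> W \<Longrightarrow> q \<in> S \<longleftrightarrow> snd q = \<psi> (norm (fst q))"
    and N: "\<And>q. q \<in> W \<Longrightarrow> q \<in> S \<Longrightarrow> N q = rot_normal \<epsilon> \<theta> (fst q)"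
  shows "rot_sheet \<epsilon> S N p \<psi> \<theta>"
  unfolding rot_sheet_def using assms by blast

text \<open>These sets isolate one sheet of a cone from the other.\<close>

lemma open_comparison:
  fixes g :: "real \<Rightarrow> real"
  assumes "open J" "continuous_on J g"
  shows "open {q :: 'a::real_normed_vector \<times> real. norm (fst q) \<in> J \<and> g (norm (fst q)) < snd q}"
    and "open {q :: 'a::real_normed_vector \<times> real. norm (fst q) \<in> J \<and> snd q < g (norm (fst q))}"
proof -
  let ?V = "(\<lambda>q :: 'a \<times> real. norm (fst q)) -` J"
  have V: "open ?V" by (intro open_vimage assms continuous_intros)
  have c: "continuous_on ?V (\<lambda>q. snd q - g (norm (fst q)))"
    by (intro continuous_intros continuous_on_compose2[OF assms(2)]) auto
  have "open (?V \<inter> (\<lambda>q. snd q - g (norm (fst q))) -` {0<..})" "open (?V \<inter> (\<lambda>q. snd q - g (norm (fst q))) -` {..<0})"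
    by (intro continuous_open_preimage[OF c V] open_greaterThan open_lessThan)+
  moreover have "?V \<inter> (\<lambda>q. snd q - g (norm (fst q))) -` {0<..} = {q. norm (fst q) \<in> J \<and> g (norm (fst q)) < snd q}"
    "?V \<inter> (\<lambda>q. snd q - g (norm (fst q))) -` {..<0} = {q. norm (fst q) \<in> J \<and> snd q < g (norm (fst q))}"
    by auto
  ultimately show "open {q :: 'a \<times> real. norm (fst q) \<in> J \<and> g (norm (fst q)) < snd q}"
    "open {q :: 'a \<times> real. norm (fst q) \<in> J \<and> snd q < g (norm (fst q))}" by simp_all
qed

lemma angle_square_limit_radial:
  fixes N :: "(real^'n) \<times> real \<Rightarrow> (real^'n) \<times> real"
  assumes \<epsilon>: "\<epsilon> \<in> {0, -1}" and B: "0 < conf \<epsilon> B" "0 < B" and \<theta>: "isCont \<theta> 0"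
    and N: "\<And>x. norm x < B \<Longrightarrow> x \<noteq> 0 \<Longrightarrow> angle_function \<epsilon> N (x, u x) = cos (\<theta> (norm x))"
  shows "angle_square_limit \<epsilon> N u (geo_radius \<epsilon> B) ((cos (\<theta> 0))\<^sup>2)"
  unfolding angle_square_limit_def
proof (intro exI conjI ballI)
  fix x :: "real^'n" assume "x \<in> Q_ball \<epsilon> (geo_radius \<epsilon> B) - {0}"
  then have x: "norm x < B" "x \<noteq> 0" using Q_ball_eq(1)[OF \<epsilon> B(1)] B by auto
  then have c: "0 < conf \<epsilon> (norm x)" using conf_between[of \<epsilon> 0 B "norm x"] B \<epsilon> by auto
  show "angle_function \<epsilon> N (x, u x) = cos (\<theta> (chart_radius \<epsilon> (Q_dist \<epsilon> 0 x)))"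
    using N[OF x] c by (simp add: Q_dist_origin[OF \<epsilon>] Q_space_iff chart_radius_geo_radius[OF \<epsilon>])
next
  have "((\<lambda>s. \<theta> (chart_radius \<epsilon> s)) \<longlongrightarrow> \<theta> 0) (at_right 0)"
    by (rule isCont_tendsto_compose[OF \<theta> chart_radius_tendsto_0])
  then show "((\<lambda>s. (cos (\<theta> (chart_radius \<epsilon> s)))\<^sup>2) \<longlongrightarrow> (cos (\<theta> 0))\<^sup>2) (at_right 0)"
    by (intro tendsto_intros)
qed

lemma proper_in_QR_Un: "proper_in_QR \<epsilon> S \<Longrightarrow> proper_in_QR \<epsilon> T \<Longrightarrow> proper_in_QR \<epsilon> (S \<union> T)"
  unfolding proper_in_QR_def by (simp add: Int_Un_distrib2 compact_Un)

context
  fixes \<epsilon> :: real and m :: nat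
  assumes \<epsilon>: "\<epsilon> \<in> {0, -1}" and m: "even m" "2 \<le> m" and card: "CARD('n::finite) = Suc m"
begin

text \<open>At \<open>r = 0\<close> the equation reads \<open>F(\<theta> 0) = C\<close>, so \<open>C = F(t)\<close> prescribes the angle \<open>t\<close> at the vertex.\<close>

lemma cone_profile:
  assumes t: "\<bar>t\<bar> < pi / 2"
  obtains A r0 B \<theta> \<psi> where "profile \<epsilon> m (sin_primitive m t) A r0 B \<theta> \<psi>" "\<psi> 0 = 0" "A < 0" "0 < B" "\<theta> 0 = t"
    "r0 < 0 \<longleftrightarrow> 0 < t" "0 < r0 \<longleftrightarrow> t < 0"
proof -
  obtain A r0 B \<theta> \<psi>0 where P0: "profile \<epsilon> m (sin_primitive m t) A r0 B \<theta> \<psi>0"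
    using profile_exists[OF \<epsilon> m] by blast
  define \<psi> where "\<psi> = (\<lambda>r. \<psi>0 r - \<psi>0 0)"
  interpret profile \<epsilon> m "sin_primitive m t" A r0 B \<theta> \<psi> unfolding \<psi>_def by (rule profile.shift[OF P0])
  have le: "\<bar>t\<bar> \<le> pi / 2" "\<bar>- (pi / 2)\<bar> \<le> pi / 2" "\<bar>pi / 2\<bar> \<le> pi / 2" "\<bar>0\<bar> \<le> pi / 2" using t pi_gt_zero by simp_all
  have c0: "0 < conf \<epsilon> 0" by simp
  have "sin_primitive m (- (pi / 2)) < sin_primitive m t" "sin_primitive m t < sin_primitive m (pi / 2)"
    using sin_primitive_less_iff[OF m(1) le(2,1)] sin_primitive_less_iff[OF m(1) le(1,3)] t by auto
  then have "tan_primitive \<epsilon> m A < tan_primitive \<epsilon> m 0" "tan_primitive \<epsilon> m 0 < tan_primitive \<epsilon> m B"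
    unfolding tan_primitive_0 using T_A T_B by linarith+
  then have AB: "A < 0" "0 < B"
    using tan_primitive_less_iff[OF \<epsilon> m(1) conf_ends(1) c0] tan_primitive_less_iff[OF \<epsilon> m(1) c0 conf_ends(3)] by blast+
  have "sin_primitive m (\<theta> 0) = sin_primitive m t" "\<bar>\<theta> 0\<bar> \<le> pi / 2" using \<theta>[of 0] AB by auto
  then have "\<theta> 0 = t" using sin_primitive_eq_iff[OF m(1) _ le(1)] by blast
  moreover have "r0 < 0 \<longleftrightarrow> 0 < \<theta> 0" "0 < r0 \<longleftrightarrow> \<theta> 0 < 0" using \<theta>_sign[of 0] AB by auto
  moreover have "\<psi> 0 = 0" by (simp add: \<psi>_def)
  ultimately show ?thesis using that[OF profile_axioms] AB by simp
qed

text \<open>The upper sheet belongs to the angle \<open>t = arcsin l\<close> at the vertex and the lower one to \<open>- t\<close>. Both satisfy the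
  same differential equation, so their angles, and with them their heights, stay ordered for \<open>r > 0\<close>; in
  particular the sheets meet only at the vertex. The upper sheet rises from the vertex, so the minimum lies
  on the lower one.\<close>

lemma translating_cones:
  "\<forall>l\<in>{0<..<1}. \<exists>(K :: ((real^'n) \<times> real) set) Rp Rm.
       0 < Rp \<and> Rp < Rm \<and> rotational K \<and> proper_in_QR \<epsilon> K \<and>
       (\<exists>N up um.
          n_translator \<epsilon> (K - {(0, 0)}) N (min_height_set K) \<and>
          K = vertical_graph up (Q_ball \<epsilon> Rp) \<union> vertical_graph um (Q_ball \<epsilon> Rm) \<and>
          up 0 = 0 \<and> um 0 = 0 \<and>
          continuous_on (Q_ball \<epsilon> Rp) up \<and> C1_on (Q_ball \<epsilon> Rp - {0}) up \<and>
          continuous_on (Q_ball \<epsilon> Rm) um \<and> C1_on (Q_ball \<epsilon> Rm - {0}) um \<and>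
          conical_singularity \<epsilon> up \<and> conical_singularity \<epsilon> um \<and>
          vertically_asymptotic \<epsilon> (vertical_graph up (Q_ball \<epsilon> Rp))
            (Q_sphere \<epsilon> Rp \<times> UNIV) \<and>
          vertically_asymptotic \<epsilon> (vertical_graph um (Q_ball \<epsilon> Rm))
            (Q_sphere \<epsilon> Rm \<times> UNIV) \<and>
          angle_square_limit \<epsilon> N up Rp (1 - l\<^sup>2) \<and>
          angle_square_limit \<epsilon> N um Rm (1 - l\<^sup>2)) \<and>
       in_upper_half_space K \<and> height_unbounded_above K \<and>
       \<not> hypersurface_at C1_on K (0, 0) \<and>
       horizontal_sphere \<epsilon> (min_height_set K)"
  (is "\<forall>l\<in>_. ?cone l")
proof
  fix l :: real assume l: "l \<in> {0<..<1}"
  define t where "t = arcsin l"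
  have t: "0 < t" "t < pi / 2" "sin t = l"
    using l arcsin_less_arcsin[of 0 l] arcsin_less_arcsin[of l 1] by (auto simp: t_def)
  have cos2: "(cos t)\<^sup>2 = 1 - l\<^sup>2" using cos_squared_eq[of t] t(3) by simp
  have ab: "\<bar>t\<bar> < pi / 2" "\<bar>- t\<bar> < pi / 2" using t by auto
  obtain Ap rp Bp \<theta>p \<psi>p where Pp: "profile \<epsilon> m (sin_primitive m t) Ap rp Bp \<theta>p \<psi>p" and p0: "\<psi>p 0 = 0" "Ap < 0" "0 < Bp" "\<theta>p 0 = t" "rp < 0"
    using cone_profile[OF ab(1)] t(1) by metis
  obtain Am rm Bm \<theta>m \<psi>m where Pm: "profile \<epsilon> m (sin_primitive m (- t)) Am rm Bm \<theta>m \<psi>m" and m0: "\<psi>m 0 = 0" "Am < 0" "0 < Bm" "\<theta>m 0 = - t" "0 < rm"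
    using cone_profile[OF ab(2)] t(1) by (metis neg_less_0_iff_less)
  interpret p: profile \<epsilon> m "sin_primitive m t" Ap rp Bp \<theta>p \<psi>p by (rule Pp)
  interpret q: profile \<epsilon> m "sin_primitive m (- t)" Am rm Bm \<theta>m \<psi>m by (rule Pm)
  have F: "0 < sin_primitive m t" "sin_primitive m (- t) < 0"
    using sin_primitive_strict_mono[OF m(1), of 0 t] t pi_gt_zero by (auto simp: sin_primitive_minus[OF m(1)])
  have Bpm: "Bp < Bm"
    using p.T_B q.T_B F tan_primitive_less_iff[OF \<epsilon> m(1) p.conf_ends(3) q.conf_ends(3)] by linarith
  have ang: "\<theta>m r < \<theta>p r" if "0 \<le> r" "r \<le> Bp" for r
  proof -
    have "sin_primitive m (\<theta>m r) < sin_primitive m (\<theta>p r)" "\<bar>\<theta>m r\<bar> \<le> pi / 2" "\<bar>\<theta>p r\<bar> \<le> pi / 2"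
      using p.\<theta>[of r] q.\<theta>[of r] that p0 m0 Bpm F by auto
    then show ?thesis using sin_primitive_less_iff[OF m(1)] by blast
  qed
  have \<psi>less: "\<psi>m r < \<psi>p r" if r: "0 < r" "r < Bp" for r
  proof -
    have "\<psi>p 0 - \<psi>m 0 < \<psi>p r - \<psi>m r"
    proof (rule DERIV_pos_imp_increasing_open[OF r(1), of "\<lambda>r. \<psi>p r - \<psi>m r"])
      fix x assume x: "0 < x" "x < r"
      have d: "((\<lambda>r. \<psi>p r - \<psi>m r) has_real_derivative (tan (\<theta>p x) / conf \<epsilon> x - tan (\<theta>m x) / conf \<epsilon> x)) (at x)"
        by (intro DERIV_diff p.\<psi> q.\<psi>) (use x r p0 m0 Bpm in auto)
      have "tan (\<theta>m x) < tan (\<theta>p x)"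
        by (rule tan_monotone) (use ang[of x] p.\<theta>_bounds[of x] q.\<theta>_bounds[of x] x r p0 m0 Bpm in auto)
      moreover have "0 < conf \<epsilon> x" using p.conf_pos[of x] x r p0 by simp
      ultimately have "0 < tan (\<theta>p x) / conf \<epsilon> x - tan (\<theta>m x) / conf \<epsilon> x" by (simp add: divide_strict_right_mono)
      with d show "\<exists>y. ((\<lambda>r. \<psi>p r - \<psi>m r) has_real_derivative y) (at x) \<and> 0 < y" by blast
    next
      show "continuous_on {0..r} (\<lambda>r. \<psi>p r - \<psi>m r)"
        by (intro continuous_on_diff p.continuous_on_\<psi> q.continuous_on_\<psi>) (use r p0 m0 Bpm in auto)
    qed
    then show ?thesis using p0 m0 by simp
  qed
  have \<psi>p_pos: "0 < \<psi>p r" if "0 < r" "r < Bp" for r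
    using p.\<psi>_strict_mono[of 0 r] that p0 by simp
  have \<psi>m_neg: "\<psi>m rm < 0" using q.\<psi>_min[of 0] m0 by simp
  let ?Gp = "p.surface :: ((real^'n) \<times> real) set" and ?Gm = "q.surface :: ((real^'n) \<times> real) set"
  define K where "K = ?Gp \<union> ?Gm"
  \<comment> \<open>The upward normal of the sheet that contains the point.\<close>
  define N where "N q = (if norm (fst q) < Bp \<and> snd q = \<psi>p (norm (fst q)) then rot_normal \<epsilon> \<theta>p (fst q) else rot_normal \<epsilon> \<theta>m (fst q))"
    for q :: "(real^'n) \<times> real"
  have nA: "Ap < norm x" "Am < norm x" for x :: "real^'n" using p0 m0 norm_ge_zero[of x] by linarith+
  have K_iff: "q \<in> K \<longleftrightarrow> norm (fst q) < Bp \<and> snd q = \<psi>p (norm (fst q)) \<or> norm (fst q) < Bm \<and> snd q = \<psi>m (norm (fst q))" for q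
    using nA[of "fst q"] by (auto simp: K_def p.surface_def q.surface_def)
  have dom: "{x::real^'n. Ap < norm x \<and> norm x < Bp} = {x. norm x < Bp}" "{x::real^'n. Am < norm x \<and> norm x < Bm} = {x. norm x < Bm}"
    using nA by auto
  let ?Rp = "geo_radius \<epsilon> Bp" and ?Rm = "geo_radius \<epsilon> Bm"
  have ballp: "Q_ball \<epsilon> ?Rp = {x::real^'n. norm x < Bp}" "Q_sphere \<epsilon> ?Rp = {x::real^'n. norm x = Bp}"
    by (rule Q_ball_eq[OF \<epsilon> p.conf_ends(3) less_imp_le[OF p0(3)]])+
  have ballm: "Q_ball \<epsilon> ?Rm = {x::real^'n. norm x < Bm}" "Q_sphere \<epsilon> ?Rm = {x::real^'n. norm x = Bm}"
    by (rule Q_ball_eq[OF \<epsilon> q.conf_ends(3) less_imp_le[OF m0(3)]])+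
  have Gp: "?Gp = vertical_graph (\<lambda>x. \<psi>p (norm x)) (Q_ball \<epsilon> ?Rp)"
    unfolding p.surface_vertical_graph dom ballp ..
  have Gm: "?Gm = vertical_graph (\<lambda>x. \<psi>m (norm x)) (Q_ball \<epsilon> ?Rm)"
    unfolding q.surface_vertical_graph dom ballm ..
  \<comment> \<open>The minimum lies on the lower sheet only, at the radius \<open>rm\<close> and below the vertex.\<close>
  have K_ge: "\<psi>m rm \<le> snd q" "snd q = \<psi>m rm \<Longrightarrow> norm (fst q) = rm \<and> q \<in> ?Gm" if "q \<in> K" for q
  proof -
    have "0 \<le> \<psi>p r" if "0 \<le> r" "r < Bp" for r using \<psi>p_pos[of r] p0 that by (cases "r = 0") auto
    from this[of "norm (fst q)"] have *: "q \<in> ?Gp \<Longrightarrow> \<psi>m rm < snd q"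
      using \<psi>m_neg by (auto simp: p.surface_def)
    have **: "q \<in> ?Gm \<Longrightarrow> \<psi>m rm \<le> snd q \<and> (snd q = \<psi>m rm \<longrightarrow> norm (fst q) = rm)"
      using q.\<psi>_min[of "norm (fst q)"] by (cases "norm (fst q) = rm") (auto simp: q.surface_def)
    show "\<psi>m rm \<le> snd q" "snd q = \<psi>m rm \<Longrightarrow> norm (fst q) = rm \<and> q \<in> ?Gm"
      using * ** that by (auto simp: K_def)
  qed
  have min: "min_height_set K = {x. norm x = rm} \<times> {\<psi>m rm}"
  proof (intro equalityI subsetI)
    fix z :: "(real^'n) \<times> real" assume z: "z \<in> min_height_set K"
    obtain e :: "real^'n" where e: "norm e = 1" using unit_direction[of 0] by blast
    have "(rm *\<^sub>R e, \<psi>m rm) \<in> K" using e m0 q.ends by (simp add: K_iff)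
    then have "z \<in> K" "snd z \<le> \<psi>m rm" using z by (auto simp: min_height_set_def)
    then show "z \<in> {x. norm x = rm} \<times> {\<psi>m rm}" using K_ge[of z] by (auto simp: mem_Times_iff)
  next
    fix z :: "(real^'n) \<times> real" assume z: "z \<in> {x. norm x = rm} \<times> {\<psi>m rm}"
    then have "z \<in> K" using q.ends by (auto simp: K_iff)
    moreover have "snd z = \<psi>m rm" using z by auto
    ultimately show "z \<in> min_height_set K" by (simp add: min_height_set_def K_ge(1))
  qed
  let ?S = "K - {(0, 0)}"
  have cp: "continuous_on {0<..<Bp} \<psi>p" "continuous_on {0<..<Bp} \<psi>m" "continuous_on {0<..<Bm} \<psi>m"
    using p0 m0 Bpm by (auto intro!: p.continuous_on_\<psi> q.continuous_on_\<psi>)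
  have nz: "0 < norm (fst z)" if "z \<in> ?S" for z
  proof -
    have "fst z \<noteq> 0" using that p0 m0 by (auto simp: K_iff prod_eq_iff)
    then show ?thesis by simp
  qed
  have sheet_p: "rot_sheet \<epsilon> ?S N z \<psi>p \<theta>p" if z: "z \<in> ?S" "norm (fst z) < Bp" "snd z = \<psi>p (norm (fst z))" for z
  proof (rule rot_sheetI[OF open_comparison(1)[OF open_greaterThanLessThan cp(2)]])
    show "z \<in> {q. norm (fst q) \<in> {0<..<Bp} \<and> \<psi>m (norm (fst q)) < snd q}"
      using nz[OF z(1)] z \<psi>less by simp
  qed (use z(1) in \<open>auto simp: K_iff N_def\<close>)
  have sheet_m: "rot_sheet \<epsilon> ?S N z \<psi>m \<theta>m" if z: "z \<in> ?S" "norm (fst z) < Bm" "snd z = \<psi>m (norm (fst z))" for z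
  proof (cases "norm (fst z) < Bp")
    case True
    show ?thesis
    proof (rule rot_sheetI[OF open_comparison(2)[OF open_greaterThanLessThan cp(1)]])
      show "z \<in> {q. norm (fst q) \<in> {0<..<Bp} \<and> snd q < \<psi>p (norm (fst q))}"
        using nz[OF z(1)] z \<psi>less True by simp
    qed (use z(1) Bpm in \<open>auto simp: K_iff N_def\<close>)
  next
    case False
    obtain \<delta> where \<delta>: "0 < \<delta>" "\<And>r. Ap < r \<Longrightarrow> r < Bp \<Longrightarrow> r < Ap + \<delta> \<or> Bp - \<delta> < r \<Longrightarrow> snd z + 1 < \<psi>p r"
      using p.blow_up[of "snd z + 1"] by blast
    \<comment> \<open>Outside the radius \<open>r1\<close> the upper sheet lies above the height of \<open>z\<close>, so a slab around \<open>z\<close> avoids it.\<close>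
    define r1 where "r1 = max 0 (Bp - \<delta>)"
    have r1: "0 \<le> r1" "r1 < Bp" "\<And>r. r1 < r \<Longrightarrow> r < Bp \<Longrightarrow> snd z + 1 < \<psi>p r"
      using \<delta> p0 by (auto simp: r1_def)
    show ?thesis
    proof (rule rot_sheetI[OF open_comparison(2)[OF open_greaterThanLessThan[of r1 Bm] continuous_on_const[of _ "snd z + 1"]]])
      show "z \<in> {q. norm (fst q) \<in> {r1<..<Bm} \<and> snd q < snd z + 1}"
        using z r1 False by simp
    next
      fix w :: "(real^'n) \<times> real" assume w: "w \<in> {q. norm (fst q) \<in> {r1<..<Bm} \<and> snd q < snd z + 1}"
      then have *: "\<not> (norm (fst w) < Bp \<and> snd w = \<psi>p (norm (fst w)))" using r1(3)[of "norm (fst w)"] by auto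
      then show "w \<in> ?S \<longleftrightarrow> snd w = \<psi>m (norm (fst w))" using w r1(1) by (auto simp: K_iff)
      show "N w = rot_normal \<epsilon> \<theta>m (fst w)" unfolding N_def using * by (rule if_not_P)
    qed (use z in auto)
  qed
  have sub: "K \<subseteq> QR_space \<epsilon>" using p.surface_subset q.surface_subset by (auto simp: K_def)
  have min_z: "z \<in> min_height_set K \<longleftrightarrow> norm (fst z) = rm" if "snd z = \<psi>m (norm (fst z))" for z
    using that by (auto simp: min mem_Times_iff)
  have tr: "n_translator \<epsilon> ?S N (min_height_set K)"
  proof (rule n_translator_of_sheets[where \<rho> = rm, OF _ _ card])
    show "?S \<subseteq> QR_space \<epsilon>" using sub by auto
    have "min_height_set K \<subseteq> K" by (auto simp: min_height_set_def)
    moreover have "(0, 0) \<notin> min_height_set K" using m0(5) by (simp add: min)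
    ultimately show "min_height_set K \<subseteq> ?S" by blast
  next
    fix z assume z: "z \<in> ?S"
    from z have "norm (fst z) < Bp \<and> snd z = \<psi>p (norm (fst z)) \<or> norm (fst z) < Bm \<and> snd z = \<psi>m (norm (fst z))"
      by (simp add: K_iff)
    then show "\<exists>C A r0 B \<theta> \<psi>. profile \<epsilon> m C A r0 B \<theta> \<psi> \<and> rot_sheet \<epsilon> ?S N z \<psi> \<theta> \<and>
       A < norm (fst z) \<and> norm (fst z) < B \<and> (fst z = 0 \<longrightarrow> r0 = 0) \<and>
       (z \<in> min_height_set K \<longleftrightarrow> norm (fst z) = r0 \<and> fst z \<noteq> 0)"
    proof
      assume a: "norm (fst z) < Bp \<and> snd z = \<psi>p (norm (fst z))"
      have "z \<notin> min_height_set K"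
        using \<psi>p_pos[of "norm (fst z)"] nz[OF z] a \<psi>m_neg by (auto simp: min mem_Times_iff)
      moreover have "norm (fst z) \<noteq> rp" using p0(5) norm_ge_zero[of "fst z"] by linarith
      ultimately show ?thesis using a nA(1)[of "fst z"] nz[OF z]
        by (intro exI[of _ "sin_primitive m t"] exI[of _ Ap] exI[of _ rp] exI[of _ Bp] exI[of _ \<theta>p] exI[of _ \<psi>p]
            conjI Pp sheet_p[OF z]) simp_all
    next
      assume a: "norm (fst z) < Bm \<and> snd z = \<psi>m (norm (fst z))"
      then show ?thesis using min_z[of z] nA(2)[of "fst z"] nz[OF z]
        by (intro exI[of _ "sin_primitive m (- t)"] exI[of _ Am] exI[of _ rm] exI[of _ Bm] exI[of _ \<theta>m] exI[of _ \<psi>m]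
            conjI Pm sheet_m[OF z]) simp_all
    qed
  qed (simp add: min mem_Times_iff)
  have asp: "vertically_asymptotic \<epsilon> (vertical_graph (\<lambda>x. \<psi>p (norm x)) (Q_ball \<epsilon> ?Rp)) ((Q_sphere \<epsilon> ?Rp :: (real^'n) set) \<times> UNIV)"
  proof -
    have "norm x \<noteq> Ap" for x :: "real^'n" using nA[of x] by simp
    then have s: "Q_sphere \<epsilon> ?Rp = {x::real^'n. norm x = Ap \<or> norm x = Bp}"
      by (simp_all only: ballp simp_thms)
    show ?thesis unfolding Gp[symmetric] s by (rule p.surface_asymptotic[OF p0(3)])
  qed
  have asm: "vertically_asymptotic \<epsilon> (vertical_graph (\<lambda>x. \<psi>m (norm x)) (Q_ball \<epsilon> ?Rm)) ((Q_sphere \<epsilon> ?Rm :: (real^'n) set) \<times> UNIV)"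
  proof -
    have "norm x \<noteq> Am" for x :: "real^'n" using nA[of x] by simp
    then have s: "Q_sphere \<epsilon> ?Rm = {x::real^'n. norm x = Am \<or> norm x = Bm}"
      by (simp_all only: ballm simp_thms)
    show ?thesis unfolding Gm[symmetric] s by (rule q.surface_asymptotic[OF m0(3)])
  qed
  have setp: "{x::real^'n. norm x < Bp} = {x. norm x \<in> {Ap<..<Bp}}" and setm: "{x::real^'n. norm x < Bm} = {x. norm x \<in> {Am<..<Bm}}"
    using nA by auto
  have C1p: "C1_on (Q_ball \<epsilon> ?Rp - {0}) (\<lambda>x::real^'n. \<psi>p (norm x))" unfolding ballp setp by (rule p.C1_on_graph)
  have C1m: "C1_on (Q_ball \<epsilon> ?Rm - {0}) (\<lambda>x::real^'n. \<psi>m (norm x))" unfolding ballm setm by (rule q.C1_on_graph)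
  have cgp: "continuous_on (Q_ball \<epsilon> ?Rp) (\<lambda>x::real^'n. \<psi>p (norm x))" unfolding ballp setp
    by (rule continuous_on_compose2[OF p.continuous_on_\<psi>[OF order_refl]]) (auto intro: continuous_intros)
  have cgm: "continuous_on (Q_ball \<epsilon> ?Rm) (\<lambda>x::real^'n. \<psi>m (norm x))" unfolding ballm setm
    by (rule continuous_on_compose2[OF q.continuous_on_\<psi>[OF order_refl]]) (auto intro: continuous_intros)
  have dp: "(\<psi>p has_real_derivative tan t) (at 0)" using p.\<psi>[of 0] p0 by simp
  have dm: "(\<psi>m has_real_derivative - tan t) (at 0)" using q.\<psi>[of 0] m0 by simp
  have tan: "0 < tan t" using t by (simp add: tan_gt_zero)
  have csp: "conical_singularity \<epsilon> (\<lambda>x::real^'n. \<psi>p (norm x))"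
    by (rule conical_singularity_radial[OF \<epsilon> dp]) (use tan in simp)
  have csm: "conical_singularity \<epsilon> (\<lambda>x::real^'n. \<psi>m (norm x))"
    by (rule conical_singularity_radial[OF \<epsilon> dm]) (use tan in simp)
  have angp: "angle_square_limit \<epsilon> N (\<lambda>x. \<psi>p (norm x)) ?Rp (1 - l\<^sup>2)"
    unfolding cos2[symmetric] p0(4)[symmetric]
    by (rule angle_square_limit_radial[OF \<epsilon> p.conf_ends(3) p0(3) p.isCont_\<theta>[OF p0(2,3)]])
      (simp add: angle_function_def N_def rot_normal_def QR_metric_def Q_metric_conf)
  have angm: "angle_square_limit \<epsilon> N (\<lambda>x. \<psi>m (norm x)) ?Rm (1 - l\<^sup>2)"
  proof -
    have "angle_square_limit \<epsilon> N (\<lambda>x. \<psi>m (norm x)) ?Rm ((cos (\<theta>m 0))\<^sup>2)"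
    proof (rule angle_square_limit_radial[OF \<epsilon> q.conf_ends(3) m0(3) q.isCont_\<theta>[OF m0(2,3)]])
      fix x :: "real^'n" assume "norm x < Bm" "x \<noteq> 0"
      then have "\<not> (norm x < Bp \<and> \<psi>m (norm x) = \<psi>p (norm x))" using \<psi>less[of "norm x"] by auto
      then have "N (x, \<psi>m (norm x)) = rot_normal \<epsilon> \<theta>m x" unfolding N_def by auto
      then show "angle_function \<epsilon> N (x, \<psi>m (norm x)) = cos (\<theta>m (norm x))"
        by (simp add: angle_function_def rot_normal_def QR_metric_def Q_metric_conf)
    qed
    then show ?thesis by (simp add: m0 cos2)
  qed
  have rot: "rotational K" by (rule rotationalI) (simp add: K_iff)
  have proper: "proper_in_QR \<epsilon> K" unfolding K_def by (intro proper_in_QR_Un p.surface_proper q.surface_proper)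
  have half: "in_upper_half_space K"
    unfolding in_upper_half_space_def using K_ge(1) by (intro exI[of _ "\<psi>m rm"]) (auto simp: mem_Times_iff)
  have unb: "height_unbounded_above K"
  proof -
    have "height_unbounded_above ?Gp" by (rule p.surface_unbounded[OF p0(3)])
    then show ?thesis unfolding height_unbounded_above_def K_def by blast
  qed
  have vertex: "\<not> hypersurface_at C1_on K (0, 0)"
    by (rule double_cone_not_C1[OF dp p0(1) dm m0(1) _ p0(3)]) (use tan Bpm in \<open>auto simp: K_iff\<close>)
  have hs: "horizontal_sphere \<epsilon> (min_height_set K)"
    unfolding min by (rule horizontal_sphereI[OF \<epsilon> q.conf_ends(2) m0(5)])
  have Rp: "0 < ?Rp" using geo_radius_less_iff[OF \<epsilon> _ p.conf_ends(3), of 0] p0 by simp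
  have Rpm: "?Rp < ?Rm" using geo_radius_less_iff[OF \<epsilon> p.conf_ends(3) q.conf_ends(3)] Bpm by simp
  have un: "K = vertical_graph (\<lambda>x. \<psi>p (norm x)) (Q_ball \<epsilon> ?Rp) \<union> vertical_graph (\<lambda>x. \<psi>m (norm x)) (Q_ball \<epsilon> ?Rm)"
    unfolding K_def Gp Gm ..
  have z: "\<psi>p (norm (0::real^'n)) = 0" "\<psi>m (norm (0::real^'n)) = 0" using p0 m0 by simp_all
  show "?cone l"
    by (intro exI[of _ K] exI[of _ ?Rp] exI[of _ ?Rm] conjI exI[of _ N] exI[of _ "\<lambda>x. \<psi>p (norm x)"] exI[of _ "\<lambda>x. \<psi>m (norm x)"])
      (rule Rp Rpm rot proper tr un z cgp C1p cgm C1m csp csm asp asm angp angm half unb vertex hs)+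
qed

end

lemma choice3:
  "\<forall>x\<in>X. \<exists>a b c. P x a b c \<Longrightarrow> \<exists>f g h. \<forall>x\<in>X. P x (f x) (g x) (h x)"
  by metis

lemma choice2:
  "\<forall>x. Q x \<longrightarrow> (\<exists>a b. P x a b) \<Longrightarrow> \<exists>f g. \<forall>x. Q x \<longrightarrow> P x (f x) (g x)"
  by metis

theorem theorem4:
  fixes \<epsilon> :: real
  assumes "\<epsilon> \<in> {0, -1}"
    and "CARD('n::finite) \<ge> 3"
    and "odd CARD('n)"
  shows
   "(\<exists>(\<Sigma>\<^sub>0 :: ((real^'n) \<times> real) set) N R u.
       0 < R \<and> C2_on (Q_ball \<epsilon> R) u \<and> \<Sigma>\<^sub>0 = vertical_graph u (Q_ball \<epsilon> R) \<and>
       rotational \<Sigma>\<^sub>0 \<and> n_translator \<epsilon> \<Sigma>\<^sub>0 N {} \<and> strictly_convex \<epsilon> \<Sigma>\<^sub>0 N \<and>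
       \<Sigma>\<^sub>0 \<subseteq> UNIV \<times> {0..} \<and> height_unbounded_above \<Sigma>\<^sub>0 \<and>
       vertically_asymptotic \<epsilon> \<Sigma>\<^sub>0 (Q_sphere \<epsilon> R \<times> UNIV))
  \<and> (\<exists>(K :: real \<Rightarrow> ((real^'n) \<times> real) set) Rp Rm. \<forall>l\<in>{0<..<1}.
       0 < Rp l \<and> Rp l < Rm l \<and> rotational (K l) \<and> proper_in_QR \<epsilon> (K l) \<and>
       (\<exists>N up um.
          n_translator \<epsilon> (K l - {(0, 0)}) N (min_height_set (K l)) \<and>
          K l = vertical_graph up (Q_ball \<epsilon> (Rp l)) \<union> vertical_graph um (Q_ball \<epsilon> (Rm l)) \<and>
          up 0 = 0 \<and> um 0 = 0 \<and>
          continuous_on (Q_ball \<epsilon> (Rp l)) up \<and> C1_on (Q_ball \<epsilon> (Rp l) - {0}) up \<and>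
          continuous_on (Q_ball \<epsilon> (Rm l)) um \<and> C1_on (Q_ball \<epsilon> (Rm l) - {0}) um \<and>
          conical_singularity \<epsilon> up \<and> conical_singularity \<epsilon> um \<and>
          vertically_asymptotic \<epsilon> (vertical_graph up (Q_ball \<epsilon> (Rp l)))
            (Q_sphere \<epsilon> (Rp l) \<times> UNIV) \<and>
          vertically_asymptotic \<epsilon> (vertical_graph um (Q_ball \<epsilon> (Rm l)))
            (Q_sphere \<epsilon> (Rm l) \<times> UNIV) \<and>
          angle_square_limit \<epsilon> N up (Rp l) (1 - l\<^sup>2) \<and>
          angle_square_limit \<epsilon> N um (Rm l) (1 - l\<^sup>2)) \<and>
       in_upper_half_space (K l) \<and> height_unbounded_above (K l) \<and>
       \<not> hypersurface_at C1_on (K l) (0, 0) \<and>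
       horizontal_sphere \<epsilon> (min_height_set (K l)))
  \<and> (\<exists>(\<Sigma> :: real \<Rightarrow> ((real^'n) \<times> real) set) R. \<forall>\<mu>\<ge>0.
       \<mu> < R \<mu> \<and> rotational (\<Sigma> \<mu>) \<and> proper_in_QR \<epsilon> (\<Sigma> \<mu>) \<and>
       (\<exists>N. n_translator \<epsilon> (\<Sigma> \<mu>) N (min_height_set (\<Sigma> \<mu>))) \<and>
       (\<exists>u. C1_on (Q_ball \<epsilon> (R \<mu>) - Q_cball \<epsilon> \<mu>) u \<and>
            \<Sigma> \<mu> = vertical_graph u (Q_ball \<epsilon> (R \<mu>) - Q_cball \<epsilon> \<mu>)) \<and>
       in_upper_half_space (\<Sigma> \<mu>) \<and> height_unbounded_above (\<Sigma> \<mu>) \<and>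
       vertically_asymptotic \<epsilon> (\<Sigma> \<mu>) ((Q_sphere \<epsilon> (R \<mu>) \<union> Q_sphere \<epsilon> \<mu>) \<times> UNIV) \<and>
       horizontal_sphere \<epsilon> (min_height_set (\<Sigma> \<mu>)))"
proof -
  obtain m where m: "even m" "2 \<le> m" "CARD('n) = Suc m"
    using assms(2,3) by (cases "CARD('n)") auto
  show ?thesis
    by (intro conjI bowl_soliton[OF assms(1) m] choice3[OF translating_cones[OF assms(1) m]]
        choice2[OF grim_reapers[OF assms(1) m]])
qed

end
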